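(* Let $E$ be a Fréchet space, $U\subset E$ an open subset, and let $D$ be an involutive, smooth distribution of constant rank $n$ on $U$. Assume that for every point $x_0\in U$ there are vector fields $X_1,\dots,X_n$ defined on an open neighborhood of $x_0$ which form a basis of $D$ there (i.e. $X_1(y),\dots,X_n(y)$ is a basis of $D_y$ for all $y$ in that neighborhood), such that $X_1,\dots,X_{n-1}$ admit local flows and $X_n$ admits a local semiflow. Then $D$ admits a weak foliation of rank $n$.
   Context: Smoothness: a curve $c:\mathbb{R}\to E$ into a Fréchet space is smooth if all derivatives exist as limits of difference quotients; a map between open subsets of Fréchet spaces is smooth if it maps smooth curves to smooth curves (and similarly, in the usual sense, on relatively open subsets of half spaces). A vector field on an open set $U\subset E$ is a smooth map $X:U\to E$. The Lie bracket is $[X,Y](x)=DX(x)\cdot Y(x)-DY(x)\cdot X(x)$. Local (semi)flows: $X$ admits a local flow around $x_0$ if there are $\varepsilon>0$, an open neighborhood $V$ of $x_0$ and a smooth map $Fl:\,]-\varepsilon,\varepsilon[\,\times V\to U$ with $\frac{d}{dt}Fl(t,y)=X(Fl(t,y))$, $Fl(0,y)=y$, and $Fl(t,Fl(s,y))=Fl(s+t,y)$ whenever $s,t,s+t\in\,]-\varepsilon,\varepsilon[$ and $Fl(s,y)\in V$. A local semiflow is defined in the same way with $]-\varepsilon,\varepsilon[$ replaced by $[0,\varepsilon[$. "Admits a local (semi)flow" means that this holds around every point of the domain of $X$. Distributions: a distribution on $U$ is a collection $D=\{D_x\}_{x\in U}$ of vector subspaces of $T_xU=E$. It is smooth if for every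 $x\in U$ there are an open neighborhood $V\subset U$ of $x$ and finitely many vector fields $X_1,\dots,X_k$ on $V$ whose values at $y$ span $D_y$ for every $y\in V$. It is involutive if for any two locally defined vector fields $X,Y$ with values in $D$ the bracket $[X,Y]$ has values in $D$. It has constant rank $n$ if $\dim D_x=n$ for all $x\in U$. Weak foliations: a tangential manifold (with boundary) for $D$ is an immersion $\phi_N:N\to U$ of a finite-dimensional manifold (with boundary) $N$ such that $D_{\phi_N(p)}\subset T_p\phi_N(T_pN)$ for all $p\in N$ (at boundary points $T_pN$ denotes the full tangent vector space, and an immersion is a smooth map with injective tangent maps). $D$ admits a weak foliation of rank $m$ if for every $x_0\in U$ there are a (relatively) open subset $V$ of $\{\mathbf{u}\in\mathbb{R}^m: u_m\ge 0\}$, an open subset $W''$ of a Fréchet space $E''$ and a smooth map $\psi:V\times W''\to U$ such that: (i) $x_0=\psi(\mathbf{u}_0,x_0'')$ for some $(\mathbf{u}_0,x_0'')\in V\times W''$; (ii) $T_{(\mathbf{u}_0,x_0'')}\psi:\mathbb{R}^m\times E''\to E$ is an isomorphism; (iii) $\psi(\cdot,x'')$ is a tangential manifold (with boundary) for $D$ for every $x''\in W''$; (iv) the tangent distribution given by all tangent spaces of these tangential manifolds has constant rank $m$ (that is, at each $y\in U$ the span of the tangent spaces at $y$ of all these tangential manifolds through $y$ has dimension $m$). *)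

theory Defs
  imports "HOL-Analysis.Analysis"
begin

section \<open>Frechet spaces\<close>

text \<open>
  A Frechet space is given by its topology \<open>T\<close>; its underlying vector space is
  \<open>topspace T\<close>, a linear subspace of the ambient type, with the vector operations of the
  type. Taking \<open>topspace T = UNIV\<close> covers every Frechet space structure on a type; allowing
  proper subspaces makes it possible to quantify over Frechet spaces inside a formula.
\<close>

definition seminorm_on :: "'a::real_vector set \<Rightarrow> ('a \<Rightarrow> real) \<Rightarrow> bool" where
  "seminorm_on S p \<longleftrightarrow>
     (\<forall>x\<in>S. 0 \<le> p x) \<and>
     (\<forall>x\<in>S. \<forall>y\<in>S. p (x + y) \<le> p x + p y) \<and>
     (\<forall>a. \<forall>x\<in>S. p (a *\<^sub>R x) = \<bar>a\<bar> * p x)"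

definition frechet_space :: "'a::real_vector topology \<Rightarrow> bool" where
  "frechet_space T \<longleftrightarrow>
     subspace (topspace T) \<and>
     (\<exists>p :: nat \<Rightarrow> 'a \<Rightarrow> real.
        (\<forall>k. seminorm_on (topspace T) (p k)) \<and>
        (\<forall>x\<in>topspace T. (\<forall>k. p k x = 0) \<longrightarrow> x = 0) \<and>
        (\<forall>G. openin T G \<longleftrightarrow>
             G \<subseteq> topspace T \<and>
             (\<forall>x\<in>G. \<exists>N. \<exists>e>0. \<forall>y\<in>topspace T. (\<forall>k\<le>N. p k (y - x) < e) \<longrightarrow> y \<in> G)) \<and>
        (\<forall>s :: nat \<Rightarrow> 'a.
             range s \<subseteq> topspace T \<and>
             (\<forall>k. \<forall>e>0. \<exists>M. \<forall>i\<ge>M. \<forall>j\<ge>M. p k (s i - s j) < e) \<longrightarrow>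
             (\<exists>x\<in>topspace T. \<forall>k. (\<lambda>i. p k (s i - x)) \<longlonglongrightarrow> 0)))"


section \<open>Smooth curves and smooth maps\<close>

text \<open>The function \<open>d k\<close> is the \<open>k\<close>-th derivative of the curve.\<close>

definition smooth_curve :: "'a::real_vector topology \<Rightarrow> (real \<Rightarrow> 'a) \<Rightarrow> bool" where
  "smooth_curve T c \<longleftrightarrow>
     range c \<subseteq> topspace T \<and>
     (\<exists>d :: nat \<Rightarrow> real \<Rightarrow> 'a.
        d 0 = c \<and>
        (\<forall>k t. limitin T (\<lambda>h. (d k (t + h) - d k t) /\<^sub>R h) (d (Suc k) t) (at 0)))"

text \<open>
  Here \<open>A\<close> is an open subset of the space with topology \<open>S\<close>, or a relatively open
  subset of a half space of it; in both cases smoothness is tested on the smooth curves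
  that stay in \<open>A\<close>.
\<close>

definition smooth_map ::
  "'a::real_vector topology \<Rightarrow> 'a set \<Rightarrow> 'b::real_vector topology \<Rightarrow> ('a \<Rightarrow> 'b) \<Rightarrow> bool" where
  "smooth_map S A T f \<longleftrightarrow>
     A \<subseteq> topspace S \<and> f ` A \<subseteq> topspace T \<and>
     (\<forall>c. smooth_curve S c \<and> range c \<subseteq> A \<longrightarrow> smooth_curve T (f \<circ> c))"

text \<open>
  \<open>L\<close> is the tangent map of \<open>f : A \<rightarrow> T\<close> at \<open>p\<close>: it is linear and gives the one-sided
  directional derivatives of \<open>f\<close> in all directions pointing into \<open>A\<close>. At an interior point
  these are all directions (and, using \<open>v\<close> and \<open>- v\<close>, the derivatives are two-sided); at a
  boundary point of a half space they still span the full tangent space. In both cases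
  \<open>L\<close> is determined on \<open>topspace S\<close>.
\<close>

definition has_tangent_map ::
  "'a::real_vector topology \<Rightarrow> 'a set \<Rightarrow> 'b::real_vector topology \<Rightarrow>
   ('a \<Rightarrow> 'b) \<Rightarrow> 'a \<Rightarrow> ('a \<Rightarrow> 'b) \<Rightarrow> bool" where
  "has_tangent_map S A T f p L \<longleftrightarrow>
     (\<forall>v\<in>topspace S. \<forall>w\<in>topspace S. L (v + w) = L v + L w) \<and>
     (\<forall>a. \<forall>v\<in>topspace S. L (a *\<^sub>R v) = a *\<^sub>R L v) \<and>
     (\<forall>v\<in>topspace S. (\<forall>\<^sub>F h in at_right 0. p + h *\<^sub>R v \<in> A) \<longrightarrow>
        limitin T (\<lambda>h. (f (p + h *\<^sub>R v) - f p) /\<^sub>R h) (L v) (at_right 0))"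


section \<open>Vector fields and local (semi)flows\<close>

definition vector_field :: "'a::real_vector topology \<Rightarrow> 'a set \<Rightarrow> ('a \<Rightarrow> 'a) \<Rightarrow> bool" where
  "vector_field E W X \<longleftrightarrow> openin E W \<and> smooth_map E W E X"

definition dir_deriv ::
  "'a::real_vector topology \<Rightarrow> ('a \<Rightarrow> 'a) \<Rightarrow> 'a \<Rightarrow> 'a \<Rightarrow> 'a" where
  "dir_deriv E X x v = (THE w. limitin E (\<lambda>h. (X (x + h *\<^sub>R v) - X x) /\<^sub>R h) w (at 0))"

definition lie_bracket ::
  "'a::real_vector topology \<Rightarrow> ('a \<Rightarrow> 'a) \<Rightarrow> ('a \<Rightarrow> 'a) \<Rightarrow> 'a \<Rightarrow> 'a" where
  "lie_bracket E X Y x = dir_deriv E X x (Y x) - dir_deriv E Y x (X x)"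

definition flow_on ::
  "'a::real_vector topology \<Rightarrow> 'a set \<Rightarrow> ('a \<Rightarrow> 'a) \<Rightarrow>
   real set \<Rightarrow> 'a set \<Rightarrow> (real \<times> 'a \<Rightarrow> 'a) \<Rightarrow> bool" where
  "flow_on E W X I V Fl \<longleftrightarrow>
     smooth_map (prod_topology euclideanreal E) (I \<times> V) E Fl \<and>
     Fl ` (I \<times> V) \<subseteq> W \<and>
     (\<forall>t\<in>I. \<forall>y\<in>V.
        limitin E (\<lambda>s. (Fl (s, y) - Fl (t, y)) /\<^sub>R (s - t)) (X (Fl (t, y))) (at t within I)) \<and>
     (\<forall>y\<in>V. Fl (0, y) = y) \<and>
     (\<forall>s\<in>I. \<forall>t\<in>I. \<forall>y\<in>V. s + t \<in> I \<and> Fl (s, y) \<in> V \<longrightarrow>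
        Fl (t, Fl (s, y)) = Fl (s + t, y))"

definition admits_local_flow ::
  "'a::real_vector topology \<Rightarrow> 'a set \<Rightarrow> ('a \<Rightarrow> 'a) \<Rightarrow> bool" where
  "admits_local_flow E W X \<longleftrightarrow>
     (\<forall>x0\<in>W. \<exists>\<epsilon>>0. \<exists>V Fl. openin E V \<and> x0 \<in> V \<and> flow_on E W X {-\<epsilon><..<\<epsilon>} V Fl)"

definition admits_local_semiflow ::
  "'a::real_vector topology \<Rightarrow> 'a set \<Rightarrow> ('a \<Rightarrow> 'a) \<Rightarrow> bool" where
  "admits_local_semiflow E W X \<longleftrightarrow>
     (\<forall>x0\<in>W. \<exists>\<epsilon>>0. \<exists>V Fl. openin E V \<and> x0 \<in> V \<and> flow_on E W X {0..<\<epsilon>} V Fl)"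


section \<open>Distributions\<close>

definition distribution_on ::
  "'a::real_vector topology \<Rightarrow> 'a set \<Rightarrow> ('a \<Rightarrow> 'a set) \<Rightarrow> bool" where
  "distribution_on E U D \<longleftrightarrow> (\<forall>x\<in>U. subspace (D x) \<and> D x \<subseteq> topspace E)"

definition smooth_distribution ::
  "'a::real_vector topology \<Rightarrow> 'a set \<Rightarrow> ('a \<Rightarrow> 'a set) \<Rightarrow> bool" where
  "smooth_distribution E U D \<longleftrightarrow>
     (\<forall>x\<in>U. \<exists>V k. \<exists>X :: nat \<Rightarrow> 'a \<Rightarrow> 'a.
        openin E V \<and> x \<in> V \<and> V \<subseteq> U \<and>
        (\<forall>i<k. vector_field E V (X i)) \<and>
        (\<forall>y\<in>V. span ((\<lambda>i. X i y) ` {..<k}) = D y))"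

definition involutive ::
  "'a::real_vector topology \<Rightarrow> 'a set \<Rightarrow> ('a \<Rightarrow> 'a set) \<Rightarrow> bool" where
  "involutive E U D \<longleftrightarrow>
     (\<forall>W X Y. W \<subseteq> U \<and> vector_field E W X \<and> vector_field E W Y \<and>
        (\<forall>x\<in>W. X x \<in> D x \<and> Y x \<in> D x) \<longrightarrow>
        (\<forall>x\<in>W. lie_bracket E X Y x \<in> D x))"

text \<open>
  The library assigns \<open>dim = 0\<close> to infinite-dimensional spaces; this definition is only
  used for \<open>n > 0\<close>, where \<open>dim (D x) = n\<close> has its usual meaning.
\<close>

definition constant_rank :: "'a::real_vector set \<Rightarrow> ('a \<Rightarrow> 'a set) \<Rightarrow> nat \<Rightarrow> bool" where
  "constant_rank U D n \<longleftrightarrow> (\<forall>x\<in>U. dim (D x) = n)"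


section \<open>Tangential manifolds and weak foliations\<close>

text \<open>
  The space of \<open>m\<close>-tuples is \<open>real ^ 'm\<close> for an ordered finite index type \<open>'m\<close> with
  \<open>m = CARD('m) \<ge> 1\<close> elements; the last coordinate has index \<open>Max UNIV\<close>.
\<close>

definition half_space :: "(real ^ 'm::{finite,linorder}) set" where
  "half_space = {u. 0 \<le> u $ Max UNIV}"

text \<open>
  The manifold is here a relatively open subset \<open>V\<close> of the half space, so all its tangent
  spaces, also those at boundary points, are \<open>real ^ 'm\<close>.
\<close>

definition tangential_manifold ::
  "'a::real_vector topology \<Rightarrow> 'a set \<Rightarrow> ('a \<Rightarrow> 'a set) \<Rightarrow>
   (real ^ 'm::{finite,linorder}) set \<Rightarrow> (real ^ 'm::{finite,linorder} \<Rightarrow> 'a) \<Rightarrow> bool" where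
  "tangential_manifold E U D V \<phi> \<longleftrightarrow>
     openin (top_of_set half_space) V \<and>
     smooth_map euclidean V E \<phi> \<and> \<phi> ` V \<subseteq> U \<and>
     (\<forall>u\<in>V. \<exists>L. has_tangent_map euclidean V E \<phi> u L \<and> inj L \<and> D (\<phi> u) \<subseteq> range L)"

definition tangent_space ::
  "'a::real_vector topology \<Rightarrow> (real ^ 'm::{finite,linorder}) set \<Rightarrow> (real ^ 'm::{finite,linorder} \<Rightarrow> 'a) \<Rightarrow>
   real ^ 'm::{finite,linorder} \<Rightarrow> 'a set" where
  "tangent_space E V \<phi> u = {w. \<exists>L. has_tangent_map euclidean V E \<phi> u L \<and> w \<in> range L}"

text \<open>
  The family of all tangential manifolds \<open>\<psi> x0 (\<cdot>, x'')\<close>, where \<open>x0\<close> ranges over \<open>U\<close> and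
  \<open>x''\<close> over \<open>W x0\<close>, defines the tangent distribution whose value at \<open>y\<close> is spanned by the
  tangent spaces at \<open>y\<close> of all members of the family passing through \<open>y\<close>.
\<close>

definition tangent_distribution ::
  "'a::real_vector topology \<Rightarrow> 'a set \<Rightarrow> ('a \<Rightarrow> (real ^ 'm::{finite,linorder}) set) \<Rightarrow>
   ('a \<Rightarrow> 'a set) \<Rightarrow> ('a \<Rightarrow> (real ^ 'm::{finite,linorder}) \<times> 'a \<Rightarrow> 'a) \<Rightarrow> 'a \<Rightarrow> 'a set" where
  "tangent_distribution E U V W \<psi> y =
     span (\<Union>{tangent_space E (V x0) (\<lambda>u'. \<psi> x0 (u', x'')) u | x0 u x''.
               x0 \<in> U \<and> u \<in> V x0 \<and> x'' \<in> W x0 \<and> \<psi> x0 (u, x'') = y})"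

text \<open>
  The Frechet space \<open>F x0\<close> (the parameter space of the chart at \<open>x0\<close>) has its carrier in the
  type of \<open>E\<close>. This is no restriction: since the tangent map of \<open>\<psi> x0\<close> is required to be an
  isomorphism onto \<open>E\<close>, any parameter space is isomorphic to a subspace of \<open>E\<close>.
  The rank condition concerns all charts together, so the charts are chosen as a family.
\<close>

definition admits_weak_foliation ::
  "'m::{finite,linorder} itself \<Rightarrow> 'a::real_vector topology \<Rightarrow> 'a set \<Rightarrow> ('a \<Rightarrow> 'a set) \<Rightarrow> bool"
  where
  "admits_weak_foliation _ E U D \<longleftrightarrow>
     (\<exists>(V :: 'a \<Rightarrow> (real ^ 'm::{finite,linorder}) set) (F :: 'a \<Rightarrow> 'a topology) W
       (\<psi> :: 'a \<Rightarrow> (real ^ 'm::{finite,linorder}) \<times> 'a \<Rightarrow> 'a).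
        (\<forall>x0\<in>U.
           openin (top_of_set half_space) (V x0) \<and>
           frechet_space (F x0) \<and> openin (F x0) (W x0) \<and>
           smooth_map (prod_topology euclidean (F x0)) (V x0 \<times> W x0) E (\<psi> x0) \<and>
           \<psi> x0 ` (V x0 \<times> W x0) \<subseteq> U \<and>
           (\<exists>u0\<in>V x0. \<exists>x0''\<in>W x0. \<psi> x0 (u0, x0'') = x0 \<and>
              (\<exists>L. has_tangent_map (prod_topology euclidean (F x0)) (V x0 \<times> W x0) E
                      (\<psi> x0) (u0, x0'') L \<and>
                   homeomorphic_map (prod_topology euclidean (F x0)) E L)) \<and>
           (\<forall>x''\<in>W x0. tangential_manifold E U D (V x0) (\<lambda>u. \<psi> x0 (u, x'')))) \<and>
        constant_rank U (tangent_distribution E U V W \<psi>) CARD('m))"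

end

theory Submission
  imports Defs
begin

text \<open>
  Around \<open>x0\<close> the chart is \<open>\<psi>(u, x) = Fl\<^sub>1(u\<^sub>1, \<dots> Fl\<^sub>n(u\<^sub>n, x0 + x))\<close> with \<open>x\<close> in a closed complement
  of \<open>D x0\<close>, the semiflow being applied first. Its partial derivatives are pushforwards of the
  frame fields under genuine flows only, so it suffices that such flows preserve \<open>D\<close>; at the
  boundary nothing but the time derivative and the continuity of the semiflow enters.
  A functional that annihilates \<open>D\<close> at the end of an orbit turns the pushed forward frame into a
  solution of a finite homogeneous linear system, by involutivity, and this solution vanishes.

  All of this needs first derivatives only. A map that preserves smooth curves has locally bounded
  second directional derivatives, since otherwise some smooth curve would be mapped to a curve
  with unbounded second derivative. Hence its difference quotients converge locally uniformly and
  its differential is jointly continuous.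
\<close>


section \<open>Smooth bump functions\<close>

text \<open>Invariance of \<open>D\<close> is proved by comparing two points of one orbit, at times
  r and s, through the flow for time r - s, whose sign is arbitrary. This is why the field with only
  a semiflow is applied first: its orbits are then never followed backwards, and its dependence on
  the initial point is differentiated only at the base point, where time zero makes it the identity.
  Testing with one functional at a time leaves n real unknowns. Their system is governed by the
  coefficients of the brackets in the frame, which are bounded near the base point: functionals dual
  to the frame at that point give a matrix close to the identity nearby. The same matrix estimate,
  applied to the partial derivatives of the chart, makes the tangent maps of all leaves injective on
  one common domain. By a count of dimensions the tangent spaces of the leaves are then equal to
  \<open>D\<close>. Hence leaves of different charts through a point share their tangent space, and
  the rank condition, which couples all charts, holds for any independent choice of them.\<close>

fun n_diff :: "nat \<Rightarrow> (real \<Rightarrow> real) \<Rightarrow> bool" where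
  "n_diff 0 f \<longleftrightarrow> True"
| "n_diff (Suc n) f \<longleftrightarrow> (\<exists>f'. (\<forall>x. (f has_real_derivative f' x) (at x)) \<and> n_diff n f')"

text \<open>Each finite order is a separate statement, so the closure properties below are
  inductions on the order in which no coherent sequence of derivatives has to be carried along;
  \<open>smooth_fun_derivs\<close> recovers such a sequence.\<close>

definition smooth_fun :: "(real \<Rightarrow> real) \<Rightarrow> bool" where
  "smooth_fun f \<longleftrightarrow> (\<forall>n. n_diff n f)"

lemma n_diff_SucD: "n_diff (Suc n) f \<Longrightarrow> n_diff n f"
proof (induction n arbitrary: f)
  case (Suc n)
  then obtain f' where "\<forall>x. (f has_real_derivative f' x) (at x)" "n_diff (Suc n) f'" by auto
  with Suc.IH[of f'] show ?case by auto
qed simp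

lemma n_diff_const: "n_diff n (\<lambda>x. c)"
proof (induction n arbitrary: c)
  case (Suc n)
  have "\<forall>x. ((\<lambda>x. c) has_real_derivative 0) (at x)" by simp
  with Suc[of 0] show ?case by (metis n_diff.simps(2))
qed simp

lemma n_diff_id: "n_diff n (\<lambda>x. x)"
proof (cases n)
  case (Suc m)
  have "\<forall>x. ((\<lambda>x. x) has_real_derivative 1) (at x)" by simp
  with n_diff_const[of m 1] show ?thesis unfolding Suc by (metis n_diff.simps(2))
qed simp

lemma n_diff_add: "n_diff n f \<Longrightarrow> n_diff n g \<Longrightarrow> n_diff n (\<lambda>x. f x + g x)"
proof (induction n arbitrary: f g)
  case (Suc n)
  then obtain f' g' where "\<forall>x. (f has_real_derivative f' x) (at x)" "n_diff n f'"
    "\<forall>x. (g has_real_derivative g' x) (at x)" "n_diff n g'" by auto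
  moreover from this have "\<forall>x. ((\<lambda>x. f x + g x) has_real_derivative f' x + g' x) (at x)"
    by (auto intro!: derivative_intros)
  ultimately show ?case using Suc.IH[of f' g'] by auto
qed simp

lemma n_diff_mult: "n_diff n f \<Longrightarrow> n_diff n g \<Longrightarrow> n_diff n (\<lambda>x. f x * g x)"
proof (induction n arbitrary: f g)
  case (Suc n)
  then obtain f' g' where *: "\<forall>x. (f has_real_derivative f' x) (at x)" "n_diff n f'"
    "\<forall>x. (g has_real_derivative g' x) (at x)" "n_diff n g'" by auto
  then have "\<forall>x. ((\<lambda>x. f x * g x) has_real_derivative f' x * g x + f x * g' x) (at x)"
    by (auto intro!: derivative_eq_intros)
  moreover have "n_diff n (\<lambda>x. f' x * g x + f x * g' x)"
    using Suc.IH * n_diff_SucD Suc.prems by (intro n_diff_add) auto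
  ultimately show ?case by (metis (no_types, lifting) n_diff.simps(2))
qed simp

lemma n_diff_inverse: "n_diff n f \<Longrightarrow> (\<And>x. f x \<noteq> 0) \<Longrightarrow> n_diff n (\<lambda>x. inverse (f x))"
proof (induction n arbitrary: f)
  case (Suc n)
  then obtain f' where *: "\<forall>x. (f has_real_derivative f' x) (at x)" "n_diff n f'" by auto
  \<comment> \<open>Written as a product of \<open>f'\<close> with two copies of the reciprocal, the
    derivative is covered by the induction hypothesis and \<open>n_diff_mult\<close>.\<close>
  have "\<forall>x. ((\<lambda>x. inverse (f x)) has_real_derivative
          (-1) * (f' x * (inverse (f x) * inverse (f x)))) (at x)"
    using * Suc.prems by (auto intro!: derivative_eq_intros)
  moreover have "n_diff n (\<lambda>x. (-1) * (f' x * (inverse (f x) * inverse (f x))))"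
    using Suc.IH[of f] Suc.prems * n_diff_SucD by (intro n_diff_mult n_diff_const) auto
  ultimately show ?case by (metis (no_types, lifting) n_diff.simps(2))
qed simp

lemma n_diff_compose: "n_diff n f \<Longrightarrow> n_diff n g \<Longrightarrow> n_diff n (\<lambda>x. f (g x))"
proof (induction n arbitrary: f g)
  case (Suc n)
  then obtain f' g' where *: "\<forall>x. (f has_real_derivative f' x) (at x)" "n_diff n f'"
    "\<forall>x. (g has_real_derivative g' x) (at x)" "n_diff n g'" by auto
  then have "\<forall>x. ((\<lambda>x. f (g x)) has_real_derivative f' (g x) * g' x) (at x)"
    using DERIV_chain2 by blast
  moreover have "n_diff n (\<lambda>x. f' (g x) * g' x)"
    using Suc.IH[of f' g] Suc.prems * n_diff_SucD by (intro n_diff_mult) auto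
  ultimately show ?case by (metis (no_types, lifting) n_diff.simps(2))
qed simp

text \<open>The power in front of the flat function exp (-1/x) makes the family closed under
  differentiation up to linear combinations, so a single induction over all \<open>k\<close> gives
  smoothness.\<close>

definition exp_recip :: "nat \<Rightarrow> real \<Rightarrow> real" where
  "exp_recip k x = (if x > 0 then (1/x)^k * exp (- (1/x)) else 0)"

text \<open>With y = 1/x this is the decay of y^k / exp y at infinity.\<close>

lemma exp_recip_tendsto_0: "(exp_recip k \<longlongrightarrow> 0) (at 0)"
proof -
  have "((\<lambda>x. (1/x)^k / exp (1/x)) \<longlongrightarrow> (0::real)) (at_right 0)"
    using filterlim_compose[OF tendsto_power_div_exp_0 filterlim_inverse_at_top_right]
    by (simp add: inverse_eq_divide)
  then have "(exp_recip k \<longlongrightarrow> 0) (at_right 0)"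
    by (rule Lim_transform_eventually)
       (auto simp: eventually_at_filter exp_recip_def exp_minus field_simps)
  moreover have "(exp_recip k \<longlongrightarrow> 0) (at_left 0)"
    by (rule Lim_transform_eventually[OF tendsto_const])
       (auto simp: eventually_at_filter exp_recip_def)
  ultimately show ?thesis by (simp add: filterlim_split_at)
qed

lemma has_derivative_transform_ev:
  fixes f g :: "real \<Rightarrow> real"
  assumes "(f has_real_derivative d) (at x)" "\<forall>\<^sub>F y in nhds x. f y = g y"
  shows "(g has_real_derivative d) (at x)"
  using DERIV_cong_ev[OF refl assms(2) refl] assms(1) by blast

lemma exp_recip_deriv:
  "(exp_recip k has_real_derivative exp_recip (k+2) x - k * exp_recip (k+1) x) (at x)"
proof -
  consider "x > 0" | "x < 0" | "x = 0" by linarith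
  then show ?thesis
  proof cases
    case 1
    have "((\<lambda>x. (1/x)^k * exp (- (1/x))) has_real_derivative
       exp_recip (k+2) x - k * exp_recip (k+1) x) (at x)"
    proof -
      have "((\<lambda>x. (1/x)^k * exp (- (1/x))) has_real_derivative
         real k * (1/x)^(k-1) * (- ((1/x)^2)) * exp (- (1/x)) + (1/x)^k * (exp (- (1/x)) * (1/x)^2)) (at x)"
        using 1 by (auto intro!: derivative_eq_intros simp: power2_eq_square)
      moreover have "real k * (1/x)^(k-1) * (- ((1/x)^2)) * exp (- (1/x)) + (1/x)^k * (exp (- (1/x)) * (1/x)^2)
         = exp_recip (k+2) x - k * exp_recip (k+1) x"
        using 1 by (cases k) (simp_all add: exp_recip_def power_add power2_eq_square)
      ultimately show ?thesis by (simp only:)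
    qed
    moreover have "\<forall>\<^sub>F y in nhds x. (1/y)^k * exp (- (1/y)) = exp_recip k y"
      using eventually_nhds_in_open[of "{0<..}" x] 1 by (auto simp: exp_recip_def elim!: eventually_mono)
    ultimately show ?thesis by (rule has_derivative_transform_ev)
  next
    case 2
    have "((\<lambda>x. 0) has_real_derivative exp_recip (k+2) x - k * exp_recip (k+1) x) (at x)"
      using 2 by (auto simp: exp_recip_def)
    moreover have "\<forall>\<^sub>F y in nhds x. 0 = exp_recip k y"
      using eventually_nhds_in_open[of "{..<0}" x] 2 by (auto simp: exp_recip_def elim!: eventually_mono)
    ultimately show ?thesis by (rule has_derivative_transform_ev)
  next
    case 3
    \<comment> \<open>Dividing by h raises the exponent: the difference quotient at 0 is the next
      member of the family, whose limit is known.\<close>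
    have "(\<lambda>h. (exp_recip k (0 + h) - exp_recip k 0) / h) = exp_recip (Suc k)"
      by (rule ext) (simp add: exp_recip_def)
    then show ?thesis using exp_recip_tendsto_0[of "Suc k"] unfolding 3 DERIV_def
      by (simp add: exp_recip_def)
  qed
qed

lemma n_diff_exp_recip: "n_diff n (exp_recip k)"
proof (induction n arbitrary: k)
  case (Suc n)
  have "n_diff n (\<lambda>x. exp_recip (k+2) x + (- real k) * exp_recip (k+1) x)"
    by (intro n_diff_add n_diff_mult n_diff_const Suc)
  moreover have "\<forall>x. (exp_recip k has_real_derivative exp_recip (k+2) x + (- real k) * exp_recip (k+1) x) (at x)"
    using exp_recip_deriv by auto
  ultimately show ?case by (metis (no_types, lifting) n_diff.simps(2))
qed simp

lemma smooth_bump: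
  obtains \<phi> where "smooth_fun \<phi>" "\<And>x. \<bar>x\<bar> \<ge> 1 \<Longrightarrow> \<phi> x = 0" "\<And>x. \<bar>x\<bar> \<le> 1/2 \<Longrightarrow> \<phi> x = 1"
    "\<And>x. 0 \<le> \<phi> x" "\<And>x. \<phi> x \<le> 1"
proof -
  \<comment> \<open>A smooth step from 0 (for x <= 0) to 1 (for x >= 1). The denominator is positive
    because x and 1 - x are never both nonpositive; 1 - x is spelled as a sum with a product to
    match the closure rules.\<close>
  define s where "s = (\<lambda>x. exp_recip 0 x * inverse (exp_recip 0 x + exp_recip 0 (1 + (-1) * x)))"
  have pos: "exp_recip 0 x + exp_recip 0 (1 + (-1) * x) > 0" for x
    by (auto simp: exp_recip_def add_pos_nonneg add_nonneg_pos)
  have lin: "n_diff n (\<lambda>x. a + b * g x)" if "n_diff n g" for n a b g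
    by (intro n_diff_add n_diff_mult n_diff_const that)
  have s: "n_diff n s" for n
    unfolding s_def
  proof (rule n_diff_mult[OF n_diff_exp_recip n_diff_inverse[OF n_diff_add]])
    show "n_diff n (\<lambda>x. exp_recip 0 (1 + (-1) * x))"
      by (rule n_diff_compose[OF n_diff_exp_recip lin[OF n_diff_id]])
      show "exp_recip 0 x + exp_recip 0 (1 + (-1) * x) \<noteq> 0" for x
      using pos[of x] by linarith
  qed (rule n_diff_exp_recip)
  have range: "0 \<le> s x" "s x \<le> 1" for x
  proof -
    have "exp_recip 0 x \<ge> 0" "exp_recip 0 (1 + (-1) * x) \<ge> 0" by (simp_all add: exp_recip_def)
    with pos[of x] show "0 \<le> s x" "s x \<le> 1"
      unfolding s_def divide_inverse[symmetric] by (simp_all add: divide_le_eq_1)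
  qed
  \<comment> \<open>The argument 2 - 2 x^2 is at most 0 for |x| >= 1 and at least 3/2 for |x| <=
    1/2.\<close>
  define \<phi> where "\<phi> = (\<lambda>x. s (2 + (-2) * (x * x)))"
  show ?thesis
  proof (rule that[of \<phi>])
    show "smooth_fun \<phi>" unfolding smooth_fun_def \<phi>_def
      by (rule allI, rule n_diff_compose[OF s], rule lin, rule n_diff_mult) (rule n_diff_id)+
    show "\<phi> x = 0" if "\<bar>x\<bar> \<ge> 1" for x
    proof -
      have "x * x \<ge> 1" using that abs_le_square_iff[of 1 x] by (simp add: power2_eq_square)
      then show ?thesis by (simp add: \<phi>_def s_def exp_recip_def)
    qed
    show "\<phi> x = 1" if "\<bar>x\<bar> \<le> 1/2" for x
    proof -
      have "x * x \<le> 1/4" using that abs_le_square_iff[of x "1/2"] by (simp add: power2_eq_square)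
      then show ?thesis by (simp add: \<phi>_def s_def exp_recip_def)
    qed
  qed (auto simp: \<phi>_def range)
qed

text \<open>By uniqueness of derivatives the witnesses at all orders are \<open>deriv\<close>
  itself, so iterating \<open>deriv\<close> gives one sequence that serves every order.\<close>

lemma smooth_fun_derivs:
  assumes "smooth_fun f"
  obtains d :: "nat \<Rightarrow> real \<Rightarrow> real" where "d 0 = f" "\<And>k x. (d k has_real_derivative d (Suc k) x) (at x)"
proof -
  have step: "smooth_fun (deriv g) \<and> (\<forall>x. (g has_real_derivative deriv g x) (at x))"
    if sm_g: "smooth_fun g" for g
  proof -
    have "n_diff n (deriv g) \<and> (\<forall>x. (g has_real_derivative deriv g x) (at x))" for n
    proof -
      obtain g' where "\<forall>x. (g has_real_derivative g' x) (at x)" "n_diff n g'"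
        using sm_g[unfolded smooth_fun_def, THEN spec, of "Suc n"] by auto
      moreover from this have "deriv g = g'" by (auto intro: DERIV_imp_deriv)
      ultimately show ?thesis by simp
    qed
    then show ?thesis by (auto simp: smooth_fun_def)
  qed
  have sm: "smooth_fun ((deriv ^^ k) f)" for k
    by (induction k) (use assms step in auto)
  show ?thesis
    by (rule that[of "\<lambda>k. (deriv ^^ k) f"]) (use sm step in auto)
qed

text \<open>On the open set |x| > 1 the function is locally zero, hence all derivatives vanish
  there; on the compact rest they are bounded by continuity. The bounds, one per order, control the
  rescaled bumps of \<open>smooth_curve_flat_sum\<close>.\<close>

lemma compactly_supported_derivs:
  assumes "smooth_fun f" "\<And>x. \<bar>x\<bar> \<ge> 1 \<Longrightarrow> f x = 0"
  obtains d :: "nat \<Rightarrow> real \<Rightarrow> real" and C where "d 0 = f"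
    "\<And>k x. (d k has_real_derivative d (Suc k) x) (at x)"
    "\<And>k x. \<bar>x\<bar> > 1 \<Longrightarrow> d k x = 0" "\<And>k x. \<bar>d k x\<bar> \<le> C k"
proof -
  obtain d :: "nat \<Rightarrow> real \<Rightarrow> real" where d: "d 0 = f" "\<And>k x. (d k has_real_derivative d (Suc k) x) (at x)"
    using smooth_fun_derivs[OF assms(1)] by blast
  have z: "d k x = 0" if "\<bar>x\<bar> > 1" for k x
    using that
  proof (induction k arbitrary: x)
    case 0
    then show ?case using assms d by auto
  next
    case (Suc k)
    have "open {x::real. \<bar>x\<bar> > 1}" by (intro open_Collect_less continuous_intros)
    then have "\<forall>\<^sub>F y in nhds x. y \<in> {x::real. \<bar>x\<bar> > 1}"
      using Suc.prems by (intro eventually_nhds_in_open) auto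
    then have "\<forall>\<^sub>F y in nhds x. d k y = 0"
      by (rule eventually_mono) (use Suc.IH in auto)
    then have "(d k has_real_derivative 0) (at x)"
      using DERIV_cong_ev[of x x "d k" "\<lambda>x. 0" 0 0] by simp
    then show ?case using d(2) DERIV_unique by blast
  qed
  have "\<exists>C. \<forall>x. \<bar>d k x\<bar> \<le> C" for k
  proof -
    have "continuous_on {-1..1} (d k)"
      using d(2) by (meson DERIV_continuous continuous_at_imp_continuous_on)
    then have "bounded (d k ` {-1..1})"
      using compact_continuous_image compact_imp_bounded compact_Icc by blast
    then obtain C where C: "\<forall>x\<in>{-1..1}. \<bar>d k x\<bar> \<le> C" by (auto simp: bounded_iff)
    have "\<bar>d k x\<bar> \<le> max C 0" for x
      using bspec[OF C, of x] z[of x k] by (cases "\<bar>x\<bar> > 1") (auto simp: abs_if split: if_splits)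
    then show ?thesis by blast
  qed
  then obtain C where "\<And>k x. \<bar>d k x\<bar> \<le> C k" by metis
  with d z that show ?thesis by blast
qed

section \<open>The Hahn--Banach theorem for sublinear functionals\<close>

text \<open>Scaling is an inequality for positive factors, a form that passes easily to infima;
  equality follows by scaling back, see \<open>sublinear_scale\<close>.\<close>

definition sublinear :: "('a::real_vector \<Rightarrow> real) \<Rightarrow> bool" where
  "sublinear p \<longleftrightarrow> (\<forall>x y. p (x + y) \<le> p x + p y) \<and> (\<forall>a>0. \<forall>x. p (a *\<^sub>R x) \<le> a * p x)"

lemma sublinear_add: "sublinear p \<Longrightarrow> p (x + y) \<le> p x + p y"
  by (simp add: sublinear_def)

lemma sublinear_scale:
  assumes "sublinear p" "0 < a"
  shows "p (a *\<^sub>R x) = a * p x"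
proof (rule antisym)
  show "p (a *\<^sub>R x) \<le> a * p x" using assms by (simp add: sublinear_def)
  have "p (inverse a *\<^sub>R (a *\<^sub>R x)) \<le> inverse a * p (a *\<^sub>R x)"
    using assms unfolding sublinear_def by (metis positive_imp_inverse_positive)
  then show "a * p x \<le> p (a *\<^sub>R x)" using assms by (simp add: field_simps)
qed

lemma sublinear_0: "sublinear p \<Longrightarrow> p 0 = 0"
  using sublinear_scale[of p 2 0] by simp

lemma sublinear_scale_nonneg: "sublinear p \<Longrightarrow> 0 \<le> a \<Longrightarrow> p (a *\<^sub>R x) = a * p x"
  using sublinear_scale[of p a x] sublinear_0[of p] by (cases "a = 0") auto

lemma sublinear_ge: "sublinear p \<Longrightarrow> - p (- x) \<le> p x"
  using sublinear_add[of p x "- x"] sublinear_0[of p] by simp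

text \<open>The reduction that pushes a sublinear functional towards additivity in direction
  \<open>y\<close>. Choosing t = 0 shows that it lies below \<open>p\<close>; at the point - y, t =
  1 gives the upper bound - p y.\<close>

definition lower_along :: "('a::real_vector \<Rightarrow> real) \<Rightarrow> 'a \<Rightarrow> 'a \<Rightarrow> real" where
  "lower_along p y x = (INF t\<in>{0..}. p (x + t *\<^sub>R y) - t * p y)"

lemma lower_along_bdd:
  assumes "sublinear p"
  shows "bdd_below ((\<lambda>t. p (x + t *\<^sub>R y) - t * p y) ` {0..})"
proof (rule bdd_belowI2)
  fix t :: real assume "t \<in> {0..}"
  then show "- p (- x) \<le> p (x + t *\<^sub>R y) - t * p y"
    using sublinear_add[OF assms, of "x + t *\<^sub>R y" "- x"] sublinear_scale_nonneg[OF assms, of t y]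
    by simp
qed

lemma lower_along_le:
  assumes "sublinear p" "0 \<le> t"
  shows "lower_along p y x \<le> p (x + t *\<^sub>R y) - t * p y"
  unfolding lower_along_def using assms by (intro cINF_lower lower_along_bdd) auto

lemma lower_along_greatest:
  assumes "\<And>t. 0 \<le> t \<Longrightarrow> c \<le> p (x + t *\<^sub>R y) - t * p y"
  shows "c \<le> lower_along p y x"
  unfolding lower_along_def using assms by (intro cINF_greatest) auto

text \<open>Parameters t and s for the two summands combine to t + s for the sum, and t for x
  becomes a t for a x; infima are then taken in each parameter separately.\<close>

lemma sublinear_lower_along:
  assumes p: "sublinear p"
  shows "sublinear (lower_along p y)"
  unfolding sublinear_def
proof (intro conjI allI impI)
  fix x x'
  have "lower_along p y (x + x') \<le> (p (x + t *\<^sub>R y) - t * p y) + (p (x' + s *\<^sub>R y) - s * p y)"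
    if "0 \<le> t" "0 \<le> s" for s t
  proof -
    have "p (x + x' + (t + s) *\<^sub>R y) \<le> p (x + t *\<^sub>R y) + p (x' + s *\<^sub>R y)"
      using sublinear_add[OF p, of "x + t *\<^sub>R y" "x' + s *\<^sub>R y"] by (simp add: algebra_simps)
    then show ?thesis
      using lower_along_le[OF p, of "t + s" y "x + x'"] that by (simp add: algebra_simps)
  qed
  then have "lower_along p y (x + x') - (p (x + t *\<^sub>R y) - t * p y) \<le> lower_along p y x'"
    if "0 \<le> t" for t
    using that by (intro lower_along_greatest) (simp add: diff_le_eq add.commute)
  then have "lower_along p y (x + x') - lower_along p y x' \<le> lower_along p y x"
    by (intro lower_along_greatest) (simp add: diff_le_eq add.commute)
  then show "lower_along p y (x + x') \<le> lower_along p y x + lower_along p y x'" by simp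
next
  fix a :: real and x assume a: "0 < a"
  have "lower_along p y (a *\<^sub>R x) / a \<le> lower_along p y x"
  proof (rule lower_along_greatest)
    fix t :: real assume t: "0 \<le> t"
    have "p (a *\<^sub>R x + (a * t) *\<^sub>R y) = a * p (x + t *\<^sub>R y)"
      using sublinear_scale[OF p a, of "x + t *\<^sub>R y"] by (simp add: algebra_simps)
    then show "lower_along p y (a *\<^sub>R x) / a \<le> p (x + t *\<^sub>R y) - t * p y"
      using lower_along_le[OF p, of "a * t" y "a *\<^sub>R x"] a t
      by (simp add: field_simps)
  qed
  then show "lower_along p y (a *\<^sub>R x) \<le> a * lower_along p y x" using a by (simp add: field_simps)
qed

text \<open>Zorn's lemma with the order reversed. The pointwise infimum over a chain exists because
  every member is at least - p (- x), and it is subadditive because the smaller of two members of a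
  chain serves for both summands.\<close>

lemma minimal_sublinear:
  assumes p: "sublinear p"
  obtains m where "sublinear m" "m \<le> p" "\<And>m'. sublinear m' \<Longrightarrow> m' \<le> m \<Longrightarrow> m' = m"
proof -
  define A where "A = {m. sublinear m \<and> m \<le> p}"
  define P where "P = (\<lambda>a b :: 'a \<Rightarrow> real. b \<le> a)"
  have "\<exists>m\<in>A. \<forall>a\<in>A. P m a \<longrightarrow> a = m"
  proof (rule predicate_Zorn)
    show "partial_order_on A (relation_of P A)"
      by (rule partial_order_on_relation_ofI) (auto simp: P_def)
    fix C assume "C \<in> Chains (relation_of P A)"
    then have CA: "C \<subseteq> A" and tot: "\<And>a b. a \<in> C \<Longrightarrow> b \<in> C \<Longrightarrow> a \<le> b \<or> b \<le> a"
      by (auto simp: Chains_def relation_of_def P_def)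
    show "\<exists>u\<in>A. \<forall>a\<in>C. P a u"
    proof (cases "C = {}")
      case True
      have "p \<in> A" using p by (simp add: A_def)
      then show ?thesis using True by blast
    next
      case False
      define u where "u = (\<lambda>x. INF m\<in>C. m x)"
      have sub: "sublinear m" "m \<le> p" if "m \<in> C" for m using that CA by (auto simp: A_def)
      have bdd: "bdd_below ((\<lambda>m. m x) ` C)" for x
      proof (rule bdd_belowI2)
        fix m assume "m \<in> C"
        then show "- p (- x) \<le> m x"
          using sub[of m] sublinear_ge[of m x] by (auto simp: le_fun_def intro: order_trans[rotated])
      qed
      have low: "u x \<le> m x" if "m \<in> C" for m x
        unfolding u_def using that by (intro cINF_lower bdd)
      have gr: "c \<le> u x" if "\<And>m. m \<in> C \<Longrightarrow> c \<le> m x" for c x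
        unfolding u_def using that False by (intro cINF_greatest) auto
      have "sublinear u" unfolding sublinear_def
      proof (intro conjI allI impI)
        fix x y
        have *: "u (x + y) \<le> m x + m' y" if m: "m \<in> C" "m' \<in> C" for m m'
          using tot[OF m]
        proof
          assume "m \<le> m'"
          then show ?thesis using low[OF m(1), of "x + y"] sublinear_add[OF sub(1)[OF m(1)], of x y]
            le_funD[of m m' y] by linarith
        next
          assume "m' \<le> m"
          then show ?thesis using low[OF m(2), of "x + y"] sublinear_add[OF sub(1)[OF m(2)], of x y]
            le_funD[of m' m x] by linarith
        qed
        have "u (x + y) - m x \<le> u y" if "m \<in> C" for m
          by (rule gr) (use *[OF that] in \<open>simp add: diff_le_eq add.commute\<close>)
        then have "u (x + y) - u y \<le> u x" by (intro gr) (simp add: diff_le_eq add.commute)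
        then show "u (x + y) \<le> u x + u y" by simp
      next
        fix a :: real and x assume a: "0 < a"
        have "u (a *\<^sub>R x) / a \<le> u x"
        proof (rule gr)
          fix m assume m: "m \<in> C"
          show "u (a *\<^sub>R x) / a \<le> m x"
            using low[OF m, of "a *\<^sub>R x"] sublinear_scale[OF sub(1)[OF m] a, of x] a
            by (simp add: field_simps)
        qed
        then show "u (a *\<^sub>R x) \<le> a * u x" using a by (simp add: field_simps)
      qed
      moreover have "u \<le> p"
        using False sub(2) low by (auto simp: le_fun_def) (meson order_trans)
      ultimately show ?thesis using low by (auto simp: A_def P_def le_fun_def)
    qed
  qed
  then obtain m where "m \<in> A" and "\<And>a. a \<in> A \<Longrightarrow> a \<le> m \<Longrightarrow> a = m" by (auto simp: P_def)
  then show ?thesis by (intro that[of m]) (auto simp: A_def)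
qed

text \<open>A minimal \<open>m\<close> coincides with \<open>lower_along m z\<close> for every z,
  and t = 1 there gives the missing half of additivity. Minimising below
  \<open>lower_along p y\<close> instead of \<open>p\<close> pins the value at \<open>y\<close>,
  since it forces m (- y) <= - p y.\<close>

lemma hahn_banach:
  fixes p :: "'a::real_vector \<Rightarrow> real"
  assumes p: "sublinear p"
  obtains l where "linear l" "\<And>x. l x \<le> p x" "l y = p y"
proof -
  obtain m where m: "sublinear m" "m \<le> lower_along p y" and
    min: "\<And>m'. sublinear m' \<Longrightarrow> m' \<le> m \<Longrightarrow> m' = m"
    using minimal_sublinear[OF sublinear_lower_along[OF p, of y]] by blast
  have "lower_along m z = m" for z
    using lower_along_le[OF m(1), of 0 z]
    by (intro min sublinear_lower_along m(1)) (simp add: le_fun_def)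
  then have "m x \<le> m (x + z) - m z" for x z
    using lower_along_le[OF m(1), of 1 z x] by simp
  then have add: "m (x + z) = m x + m z" for x z
    using sublinear_add[OF m(1), of x z] by (intro antisym) (simp_all add: algebra_simps)
  have neg: "m (- x) = - m x" for x
    using add[of x "- x"] sublinear_0[OF m(1)] by simp
  have scale: "m (a *\<^sub>R x) = a * m x" for a x
  proof (cases "0 \<le> a")
    case True
    then show ?thesis by (rule sublinear_scale_nonneg[OF m(1)])
  next
    case False
    then show ?thesis using sublinear_scale_nonneg[OF m(1), of "- a" x] neg[of "a *\<^sub>R x"] by simp
  qed
  have low: "m x \<le> lower_along p y x" for x using m(2) by (simp add: le_fun_def)
  have le: "m x \<le> p x" for x
    using low[of x] lower_along_le[OF p, of 0 y x] by simp
  have "m (- y) \<le> - p y"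
    using low[of "- y"] lower_along_le[OF p, of 1 y "- y"] sublinear_0[OF p] by simp
  with neg[of y] le[of y] have "m y = p y" by simp
  moreover have "linear m" using add scale by (intro linearI) auto
  ultimately show ?thesis using le that by blast
qed

section \<open>Metrizable locally convex spaces\<close>

text \<open>
  The seminorms are increasing and defined on the whole type, which removes membership side
  conditions from all estimates; completeness plays no role in the calculus below.
\<close>

locale seminormed_space =
  fixes T :: "'a::real_vector topology" and q :: "nat \<Rightarrow> 'a \<Rightarrow> real"
  assumes subspace_carrier: "subspace (topspace T)"
    and q_triangle: "q k (x + y) \<le> q k x + q k y"
    and q_scale: "q k (a *\<^sub>R x) = \<bar>a\<bar> * q k x"
    and q_mono: "k \<le> l \<Longrightarrow> q k x \<le> q l x"
    and q_separates: "x \<in> topspace T \<Longrightarrow> (\<And>k. q k x = 0) \<Longrightarrow> x = 0"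
    and openin_iff: "openin T G \<longleftrightarrow> G \<subseteq> topspace T \<and>
      (\<forall>x\<in>G. \<exists>N. \<exists>e>0. \<forall>y\<in>topspace T. q N (y - x) < e \<longrightarrow> y \<in> G)"
begin

lemma carrier_add [simp, intro]: "x \<in> topspace T \<Longrightarrow> y \<in> topspace T \<Longrightarrow> x + y \<in> topspace T"
  and carrier_scale [simp, intro]: "x \<in> topspace T \<Longrightarrow> a *\<^sub>R x \<in> topspace T"
  and carrier_0 [simp, intro]: "0 \<in> topspace T"
  and carrier_diff [simp, intro]: "x \<in> topspace T \<Longrightarrow> y \<in> topspace T \<Longrightarrow> x - y \<in> topspace T"
  and carrier_minus [simp, intro]: "x \<in> topspace T \<Longrightarrow> - x \<in> topspace T"
  and carrier_sum [intro]: "(\<And>i. i \<in> A \<Longrightarrow> f i \<in> topspace T) \<Longrightarrow> sum f A \<in> topspace T"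
  using subspace_carrier
  by (auto intro: subspace_add subspace_scale subspace_0 subspace_diff subspace_neg subspace_sum)

lemma q_0 [simp]: "q k 0 = 0"
  using q_scale[of k 0 0] by simp

lemma q_minus [simp]: "q k (- x) = q k x"
  using q_scale[of k "-1" x] by simp

lemma q_commute: "q k (x - y) = q k (y - x)"
  using q_minus[of k "x - y"] by simp

lemma q_nonneg [simp]: "0 \<le> q k x"
  using q_triangle[of k x "- x"] by simp

lemma q_triangle_diff: "q k (x - z) \<le> q k (x - y) + q k (y - z)"
  using q_triangle[of k "x - y" "y - z"] by simp

lemma q_diff_le: "q k (x - y) \<le> q k x + q k y"
  using q_triangle[of k x "- y"] by simp

lemma sublinear_q: "sublinear (q k)"
  by (simp add: sublinear_def q_triangle q_scale)

lemma openin_ball: "x \<in> topspace T \<Longrightarrow> openin T {y \<in> topspace T. q N (y - x) < e}"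
  unfolding openin_iff
proof (intro conjI ballI)
  fix y assume y: "y \<in> {y \<in> topspace T. q N (y - x) < e}"
  have "q N (z - x) < e" if "q N (z - y) < e - q N (y - x)" for z
    using q_triangle_diff[of N z x y] that by simp
  then show "\<exists>M. \<exists>d>0. \<forall>z\<in>topspace T. q M (z - y) < d \<longrightarrow> z \<in> {y \<in> topspace T. q N (y - x) < e}"
    using y by (intro exI[of _ N] exI[of _ "e - q N (y - x)"]) auto
qed auto

lemma openin_ballE:
  assumes "openin T G" "x \<in> G"
  obtains N e where "e > 0" "\<And>y. y \<in> topspace T \<Longrightarrow> q N (y - x) < e \<Longrightarrow> y \<in> G"
  using assms openin_iff[of G] by blast

lemma limitin_iff:
  "limitin T f l F \<longleftrightarrow> l \<in> topspace T \<and> (\<forall>\<^sub>F x in F. f x \<in> topspace T) \<and>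
     (\<forall>k. ((\<lambda>x. q k (f x - l)) \<longlongrightarrow> 0) F)" (is "?L \<longleftrightarrow> ?R")
proof
  assume L: ?L
  then have l: "l \<in> topspace T" by (simp add: limitin_def)
  have "((\<lambda>x. q k (f x - l)) \<longlongrightarrow> 0) F" for k
  proof (rule tendstoI)
    fix e :: real assume "e > 0"
    then have "\<forall>\<^sub>F x in F. f x \<in> {y \<in> topspace T. q k (y - l) < e}"
      using L openin_ball[OF l, of k e] l by (auto simp: limitin_def)
    then show "\<forall>\<^sub>F x in F. dist (q k (f x - l)) 0 < e"
      by (rule eventually_mono) auto
  qed
  then show ?R using L l by (auto simp: limitin_def)
next
  assume R: ?R
  show ?L unfolding limitin_def
  proof (intro conjI allI impI)
    fix U assume U: "openin T U \<and> l \<in> U"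
    then obtain N e where e: "e > 0" "\<And>y. y \<in> topspace T \<Longrightarrow> q N (y - l) < e \<Longrightarrow> y \<in> U"
      using openin_ballE by metis
    have "\<forall>\<^sub>F x in F. q N (f x - l) < e"
      using R e(1) order_tendstoD(2)[of "\<lambda>x. q N (f x - l)" 0 F e] by blast
    then show "\<forall>\<^sub>F x in F. f x \<in> U"
      using conjunct1[OF conjunct2[OF R]] by eventually_elim (auto intro: e)
  qed (use R in auto)
qed

lemma limitin_carrier: "limitin T f l F \<Longrightarrow> l \<in> topspace T"
  by (simp add: limitin_iff)

lemma limitin_carrier_ev: "limitin T f l F \<Longrightarrow> \<forall>\<^sub>F x in F. f x \<in> topspace T"
  by (simp add: limitin_iff)

lemma limitinD: "limitin T f l F \<Longrightarrow> ((\<lambda>x. q k (f x - l)) \<longlongrightarrow> 0) F"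
  by (simp add: limitin_iff)

lemma limitin_small: "limitin T f l F \<Longrightarrow> e > 0 \<Longrightarrow> \<forall>\<^sub>F x in F. q k (f x - l) < e"
  using limitinD[of f l F k] by (auto dest: order_tendstoD)

lemma limitinI_le:
  assumes "l \<in> topspace T" "\<forall>\<^sub>F x in F. f x \<in> topspace T"
    and "\<And>k. \<forall>\<^sub>F x in F. q k (f x - l) \<le> g k x" "\<And>k. (g k \<longlongrightarrow> 0) F"
  shows "limitin T f l F"
  unfolding limitin_iff
  using assms by (simp add: tendsto_sandwich[OF always_eventually assms(3) tendsto_const assms(4)])

lemma limitin_konst: "l \<in> topspace T \<Longrightarrow> limitin T (\<lambda>_. l) l F"
  by (simp add: limitin_iff)

lemma limitin_plus:
  assumes "limitin T f l F" "limitin T g m F"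
  shows "limitin T (\<lambda>x. f x + g x) (l + m) F"
proof (rule limitinI_le)
  show "\<forall>\<^sub>F x in F. q k ((f x + g x) - (l + m)) \<le> q k (f x - l) + q k (g x - m)" for k
    using q_triangle[of k] by (auto simp: add_diff_add)
  show "((\<lambda>x. q k (f x - l) + q k (g x - m)) \<longlongrightarrow> 0) F" for k
    using tendsto_add[OF limitinD[OF assms(1), of k] limitinD[OF assms(2), of k]] by simp
qed (use assms[THEN limitin_carrier] assms[THEN limitin_carrier_ev] in \<open>auto elim: eventually_elim2\<close>)

lemma limitin_scale:
  assumes "(a \<longlongrightarrow> \<alpha>) F" "limitin T f l F"
  shows "limitin T (\<lambda>x. a x *\<^sub>R f x) (\<alpha> *\<^sub>R l) F"
proof (rule limitinI_le)
  show "\<forall>\<^sub>F x in F. q k (a x *\<^sub>R f x - \<alpha> *\<^sub>R l) \<le> \<bar>a x\<bar> * q k (f x - l) + \<bar>a x - \<alpha>\<bar> * q k l" for k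
  proof (rule always_eventually, rule allI)
    fix x
    have "a x *\<^sub>R f x - \<alpha> *\<^sub>R l = a x *\<^sub>R (f x - l) + (a x - \<alpha>) *\<^sub>R l" by (simp add: algebra_simps)
    then show "q k (a x *\<^sub>R f x - \<alpha> *\<^sub>R l) \<le> \<bar>a x\<bar> * q k (f x - l) + \<bar>a x - \<alpha>\<bar> * q k l"
      using q_triangle[of k "a x *\<^sub>R (f x - l)" "(a x - \<alpha>) *\<^sub>R l"] by (simp add: q_scale)
  qed
  show "((\<lambda>x. \<bar>a x\<bar> * q k (f x - l) + \<bar>a x - \<alpha>\<bar> * q k l) \<longlongrightarrow> 0) F" for k
  proof -
    have "((\<lambda>x. \<bar>a x\<bar> * q k (f x - l) + \<bar>a x - \<alpha>\<bar> * q k l) \<longlongrightarrow> \<bar>\<alpha>\<bar> * 0 + \<bar>\<alpha> - \<alpha>\<bar> * q k l) F"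
      by (intro tendsto_intros assms(1) limitinD[OF assms(2)])
    then show ?thesis by simp
  qed
qed (use assms(2)[THEN limitin_carrier] assms(2)[THEN limitin_carrier_ev] in \<open>auto elim: eventually_mono\<close>)

lemma limitin_minus: "limitin T f l F \<Longrightarrow> limitin T g m F \<Longrightarrow> limitin T (\<lambda>x. f x - g x) (l - m) F"
  using limitin_plus[of f l F "\<lambda>x. (-1) *\<^sub>R g x" "(-1) *\<^sub>R m"] limitin_scale[OF tendsto_const, of g m F "-1"]
  by simp

lemma limitin_sums:
  assumes "\<And>i. i \<in> A \<Longrightarrow> limitin T (f i) (l i) F"
  shows "limitin T (\<lambda>x. \<Sum>i\<in>A. f i x) (\<Sum>i\<in>A. l i) F"
  using assms
proof (induction A rule: infinite_finite_induct)
  case (insert i A)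
  then show ?case by (simp add: limitin_plus)
qed (simp_all add: limitin_konst)

lemma limitin_cong_ev:
  assumes "limitin T f l F" "\<forall>\<^sub>F x in F. f x = g x"
  shows "limitin T g l F"
  by (rule limitin_transform_eventually[OF assms(2,1)])

lemma limitin_unique:
  assumes "limitin T f l F" "limitin T f m F" "F \<noteq> bot"
  shows "l = m"
proof -
  have "limitin T (\<lambda>x. f x - f x) (l - m) F" by (rule limitin_minus) fact+
  then have "((\<lambda>x. q k (0 - (l - m))) \<longlongrightarrow> 0) F" for k
    by (auto simp: limitin_iff)
  then have "q k (l - m) = 0" for k
    using tendsto_unique[OF assms(3) tendsto_const, of "q k (0 - (l - m))" 0] by (simp add: q_commute)
  then show ?thesis using q_separates[of "l - m"] assms(1,2)[THEN limitin_carrier] by auto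
qed

lemma limitin_filtermap: "limitin T f l (filtermap g F) \<longleftrightarrow> limitin T (\<lambda>x. f (g x)) l F"
  by (simp add: limitin_def eventually_filtermap)

lemma limitin_compose_filterlim:
  assumes "limitin T f l G" "filterlim g G F"
  shows "limitin T (\<lambda>x. f (g x)) l F"
  using assms by (auto simp: limitin_def filterlim_iff)

lemma limitin_subfilter: "limitin T f l G \<Longrightarrow> F \<le> G \<Longrightarrow> limitin T f l F"
  by (auto simp: limitin_def le_filter_def)

lemma tendsto_functional:
  assumes "linear l" "\<And>x. \<bar>l x\<bar> \<le> C * q k x" "limitin T f m F"
  shows "((\<lambda>x. l (f x)) \<longlongrightarrow> l m) F"
proof -
  have "((\<lambda>x. l (f x) - l m) \<longlongrightarrow> 0) F"
  proof (rule Lim_null_comparison)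
    show "\<forall>\<^sub>F x in F. norm (l (f x) - l m) \<le> C * q k (f x - m)"
      using assms(2) by (auto simp: linear_diff[OF assms(1), symmetric])
    show "((\<lambda>x. C * q k (f x - m)) \<longlongrightarrow> 0) F"
      using tendsto_mult[OF tendsto_const limitinD[OF assms(3)], of C k] by simp
  qed
  then show ?thesis by (simp add: LIM_zero_iff)
qed

text \<open>A linear functional below a seminorm is also bounded by it in absolute value, as
  evaluation at - x shows. This reduces vector estimates to real ones.\<close>

lemma norming_functional:
  obtains l where "linear l" "\<And>x. \<bar>l x\<bar> \<le> q k x" "l y = q k y"
proof -
  obtain l where l: "linear l" "\<And>x. l x \<le> q k x" "l y = q k y"
    using hahn_banach[OF sublinear_q] by blast
  have "\<bar>l x\<bar> \<le> q k x" for x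
    using l(2)[of x] l(2)[of "- x"] by (simp add: linear_neg[OF l(1)])
  then show ?thesis using l that by blast
qed

text \<open>The limit is taken within \<open>I\<close>, so the same notion covers the one-sided
  derivative of a semiflow at time 0.\<close>

definition has_vderiv :: "(real \<Rightarrow> 'a) \<Rightarrow> 'a \<Rightarrow> real \<Rightarrow> real set \<Rightarrow> bool" where
  "has_vderiv c d t I \<longleftrightarrow> limitin T (\<lambda>s. (c s - c t) /\<^sub>R (s - t)) d (at t within I)"

lemma has_vderiv_functional:
  assumes "has_vderiv c d t I" "linear l" "\<And>x. \<bar>l x\<bar> \<le> C * q k x"
  shows "((\<lambda>t. l (c t)) has_real_derivative l d) (at t within I)"
proof -
  have "((\<lambda>s. l ((c s - c t) /\<^sub>R (s - t))) \<longlongrightarrow> l d) (at t within I)"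
    using tendsto_functional[OF assms(2,3)] assms(1) unfolding has_vderiv_def by blast
  then show ?thesis
    by (simp add: has_field_derivative_iff linear_scale[OF assms(2)] linear_diff[OF assms(2)]
        divide_inverse mult.commute)
qed

lemma has_vderiv_subset: "has_vderiv c d t J \<Longrightarrow> I \<subseteq> J \<Longrightarrow> has_vderiv c d t I"
  unfolding has_vderiv_def by (erule limitin_subfilter) (rule at_le)

text \<open>The real mean value theorem is applied to c followed by a functional that norms
  precisely the vector to be estimated; the intermediate time depends on the functional, which does
  no harm. The free slope \<open>w\<close> serves estimates of first-order remainders.\<close>

lemma mean_value_bound:
  assumes I: "is_interval I" "a \<in> I" "b \<in> I"
    and d: "\<And>t. t \<in> I \<Longrightarrow> has_vderiv c (c' t) t I"
    and B: "\<And>t. t \<in> I \<Longrightarrow> q k (c' t - w) \<le> B"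
  shows "q k (c b - c a - (b - a) *\<^sub>R w) \<le> \<bar>b - a\<bar> * B"
proof -
  have *: "q k (c b - c a - (b - a) *\<^sub>R w) \<le> \<bar>b - a\<bar> * B" if ab: "a \<in> I" "b \<in> I" "a \<le> b" for a b
  proof -
    have sub: "{a..b} \<subseteq> I" using I(1) ab by (meson atLeastAtMost_iff mem_is_interval_1_I subsetI)
    obtain l where l: "linear l" "\<And>x. \<bar>l x\<bar> \<le> q k x"
      "l (c b - c a - (b - a) *\<^sub>R w) = q k (c b - c a - (b - a) *\<^sub>R w)"
      using norming_functional by blast
    have "((\<lambda>t. l (c t)) has_derivative (\<lambda>h. l (c' t) * h)) (at t within {a..b})"
      if "t \<in> {a..b}" for t
      using has_vderiv_functional[OF has_vderiv_subset[OF d sub] l(1), of t 1 k] l(2) that sub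
      by (auto simp: has_field_derivative_def)
    then obtain t where t: "t \<in> {a..b}" "l (c b) - l (c a) = l (c' t) * (b - a)"
      using mvt_very_simple[OF ab(3), of "\<lambda>t. l (c t)" "\<lambda>t h. l (c' t) * h"] by auto
    have "l (c b - c a - (b - a) *\<^sub>R w) = (b - a) * l (c' t - w)"
      using t(2) by (simp only: linear_diff[OF l(1)] linear_scale[OF l(1)]) (simp add: algebra_simps)
    also have "\<dots> \<le> (b - a) * B"
      using l(2)[of "c' t - w"] B[of t] t(1) sub ab(3) by (intro mult_left_mono) auto
    finally show ?thesis using l(3) ab(3) by simp
  qed
  show ?thesis
  proof (cases "a \<le> b")
    case True
    then show ?thesis using *[of a b] I by blast
  next
    case False
    have "c b - c a - (b - a) *\<^sub>R w = - (c a - c b - (a - b) *\<^sub>R w)" by (simp add: algebra_simps)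
    then have "q k (c b - c a - (b - a) *\<^sub>R w) = q k (c a - c b - (a - b) *\<^sub>R w)"
      by (simp only: q_minus)
    then show ?thesis using *[of b a] I False by (simp add: abs_minus_commute)
  qed
qed

end

section \<open>Special smooth curves\<close>

context seminormed_space
begin

lemma has_vderiv_shift:
  "has_vderiv c d t UNIV \<longleftrightarrow> limitin T (\<lambda>h. (c (t + h) - c t) /\<^sub>R h) d (at 0)"
  unfolding has_vderiv_def by (subst at_to_0) (simp add: limitin_filtermap add.commute)

lemma has_vderiv_const: "has_vderiv (\<lambda>_. x) 0 t I"
  by (simp add: has_vderiv_def limitin_konst)

lemma has_vderiv_plus:
  "has_vderiv c d t I \<Longrightarrow> has_vderiv c' d' t I \<Longrightarrow> has_vderiv (\<lambda>s. c s + c' s) (d + d') t I"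
  unfolding has_vderiv_def
  by (drule (1) limitin_plus) (simp add: algebra_simps)

lemma has_vderiv_sum:
  "(\<And>i. i \<in> A \<Longrightarrow> has_vderiv (c i) (d i) t I) \<Longrightarrow>
     has_vderiv (\<lambda>s. \<Sum>i\<in>A. c i s) (\<Sum>i\<in>A. d i) t I"
proof (induction A rule: infinite_finite_induct)
  case (insert i A)
  then show ?case by (simp add: has_vderiv_plus)
qed (simp_all add: has_vderiv_const)

lemma has_vderiv_scale:
  assumes "(g has_real_derivative g') (at t within I)" "w \<in> topspace T"
  shows "has_vderiv (\<lambda>s. g s *\<^sub>R w) (g' *\<^sub>R w) t I"
proof -
  have "limitin T (\<lambda>s. ((g s - g t) / (s - t)) *\<^sub>R w) (g' *\<^sub>R w) (at t within I)"
    using assms by (intro limitin_scale limitin_konst) (simp_all add: has_field_derivative_iff)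
  then show ?thesis
    by (simp add: has_vderiv_def scaleR_diff_left[symmetric] divide_inverse mult.commute)
qed

lemma has_vderiv_cong_ev:
  assumes "has_vderiv c d t I" "\<forall>\<^sub>F s in nhds t. c s = c' s"
  shows "has_vderiv c' d t I"
proof -
  have "c t = c' t" using assms(2) by (rule eventually_nhds_x_imp_x)
  then show ?thesis
    using assms unfolding has_vderiv_def
    by (elim limitin_cong_ev) (auto simp: eventually_at_filter elim: eventually_mono)
qed

lemma has_vderiv_limitin:
  assumes "has_vderiv c d t I" "c t \<in> topspace T"
  shows "limitin T c (c t) (at t within I)"
proof -
  have "((\<lambda>s. s - t) \<longlongrightarrow> 0) (at t within I)"
    by (rule tendsto_eq_intros refl | simp)+
  then have "limitin T (\<lambda>s. (s - t) *\<^sub>R ((c s - c t) /\<^sub>R (s - t)) + c t) (0 *\<^sub>R d + c t) (at t within I)"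
    using assms unfolding has_vderiv_def by (intro limitin_plus limitin_scale limitin_konst)
  then show ?thesis
    by (simp, elim limitin_cong_ev) (auto simp: eventually_at_filter)
qed

lemma smooth_curve_iff:
  "smooth_curve T c \<longleftrightarrow> range c \<subseteq> topspace T \<and>
     (\<exists>d. d 0 = c \<and> (\<forall>k t. has_vderiv (d k) (d (Suc k) t) t UNIV))"
  unfolding smooth_curve_def has_vderiv_shift by blast

lemma smooth_curveE:
  assumes "smooth_curve T c"
  obtains d where "d 0 = c" "\<And>k t. has_vderiv (d k) (d (Suc k) t) t UNIV" "\<And>k t. d k t \<in> topspace T"
    "\<And>k t. limitin T (d k) (d k t) (at t)"
proof -
  obtain d where d: "d 0 = c" "\<And>k t. has_vderiv (d k) (d (Suc k) t) t UNIV" "range c \<subseteq> topspace T"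
    using assms unfolding smooth_curve_iff by blast
  have "d k t \<in> topspace T" for k t
    using d limitin_carrier unfolding has_vderiv_def by (cases k) (auto, blast)
  moreover from this d(2) have "limitin T (d k) (d k t) (at t)" for k t
    using has_vderiv_limitin by blast
  ultimately show ?thesis using d that by blast
qed

lemma smooth_curve_const: "x \<in> topspace T \<Longrightarrow> smooth_curve T (\<lambda>_. x)"
  unfolding smooth_curve_iff
  by (auto intro!: exI[of _ "\<lambda>k t. if k = 0 then x else 0"] simp: has_vderiv_const)

lemma smooth_curve_plus:
  assumes "smooth_curve T c" "smooth_curve T c'"
  shows "smooth_curve T (\<lambda>t. c t + c' t)"
proof -
  obtain d where d: "d 0 = c" "\<And>k t. has_vderiv (d k) (d (Suc k) t) t UNIV"
    using smooth_curveE[OF assms(1)] by metis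
  obtain d' where d': "d' 0 = c'" "\<And>k t. has_vderiv (d' k) (d' (Suc k) t) t UNIV"
    using smooth_curveE[OF assms(2)] by metis
  show ?thesis
    unfolding smooth_curve_iff
  proof (intro conjI exI)
    show "range (\<lambda>t. c t + c' t) \<subseteq> topspace T" using assms unfolding smooth_curve_iff by blast
    show "(\<lambda>k t. d k t + d' k t) 0 = (\<lambda>t. c t + c' t)" using d(1) d'(1) by simp
  qed (intro allI has_vderiv_plus d(2) d'(2))
qed

lemma smooth_curve_scale:
  assumes "smooth_fun g" "w \<in> topspace T"
  shows "smooth_curve T (\<lambda>t. g t *\<^sub>R w)"
proof -
  obtain d :: "nat \<Rightarrow> real \<Rightarrow> real" where
    "d 0 = g" "\<And>k x. (d k has_real_derivative d (Suc k) x) (at x)"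
    using smooth_fun_derivs[OF assms(1)] by blast
  then show ?thesis
    using assms(2) unfolding smooth_curve_iff
    by (auto intro!: exI[of _ "\<lambda>k t. d k t *\<^sub>R w"] has_vderiv_scale)
qed

end

section \<open>Disjoint dyadic time windows\<close>

lemma dyadic_window_pos: "\<bar>2 ^ n * t - 4\<bar> \<le> 1 \<Longrightarrow> 0 < (t::real)"
  by (rule ccontr) (auto simp: not_less abs_le_iff dest!: mult_nonneg_nonpos[of "2 ^ n" t, rotated])

text \<open>The n-th window is [3/2^n, 5/2^n]. Doubling the scale moves 3 to 6, beyond 5, so centre
  4 and radius 1 make the windows disjoint even as closed intervals.\<close>

lemma dyadic_window_unique:
  assumes "\<bar>2 ^ n * t - 4\<bar> \<le> 1" "\<bar>2 ^ m * (t::real) - 4\<bar> \<le> 1"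
  shows "n = m"
proof -
  have *: False if "a < b" "\<bar>2 ^ a * t - 4\<bar> \<le> 1" "\<bar>2 ^ b * t - 4\<bar> \<le> 1" for a b :: nat
  proof -
    have "(2::real) ^ Suc a \<le> 2 ^ b" using that(1) by (intro power_increasing) auto
    then have "2 ^ Suc a * t \<le> 2 ^ b * t" using dyadic_window_pos[OF that(2)] by (intro mult_right_mono) auto
    then show False using that(2,3) by (simp add: abs_le_iff)
  qed
  show ?thesis using *[of n m] *[of m n] assms by (metis linorder_neqE_nat)
qed

lemma dyadic_window_eventually:
  assumes "(t0::real) \<noteq> 0"
  obtains N where "\<forall>\<^sub>F t in nhds t0. {n. \<bar>2 ^ n * t - 4\<bar> \<le> 1} \<subseteq> {..<N}"
proof (cases "t0 > 0")
  case False
  have "\<forall>\<^sub>F t in nhds t0. t \<in> {..<0}" using False assms by (intro eventually_nhds_in_open) auto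
  then have "\<forall>\<^sub>F t in nhds t0. {n. \<bar>2 ^ n * t - 4\<bar> \<le> 1} \<subseteq> {..<0}"
    by (rule eventually_mono) (use dyadic_window_pos in fastforce)
  then show ?thesis using that by blast
next
  case True
  \<comment> \<open>For t > t0/2 the n-th window contains t only if 2^n t0/2 <= 5, that is 2^n <=
    10/t0.\<close>
  obtain N :: nat where N: "10 / t0 < 2 ^ N" using real_arch_pow[of 2] by auto
  have "\<forall>\<^sub>F t in nhds t0. t \<in> {t0/2<..}" using True by (intro eventually_nhds_in_open) auto
  then have "\<forall>\<^sub>F t in nhds t0. {n. \<bar>2 ^ n * t - 4\<bar> \<le> 1} \<subseteq> {..<N}"
  proof (rule eventually_mono, intro subsetI)
    fix t n assume t: "t \<in> {t0/2<..}" and "n \<in> {n. \<bar>2 ^ n * t - 4\<bar> \<le> 1}"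
    then have "2 ^ n * t \<le> 5" by (simp add: abs_le_iff)
    moreover have "2 ^ n * (t0/2) \<le> 2 ^ n * t" using t by (intro mult_left_mono) auto
    ultimately have "2 ^ n * (t0/2) \<le> 5" by linarith
    then have "(2::real) ^ n \<le> 10 / t0" using True by (simp add: field_simps)
    with N have "(2::real) ^ n < 2 ^ N" by linarith
    then show "n \<in> {..<N}" by simp
  qed
  then show ?thesis using that by blast
qed

context seminormed_space
begin

text \<open>At most one summand is present at any time. Away from 0 the sum is locally finite; at 0
  every derivative vanishes, because t has the size of 2^-n on the n-th window and the factor 2^(n
  k) that the k-th derivative costs is absorbed by the decay 2^-(n^2) of \<open>w n\<close>.
  Measuring \<open>w n\<close> by the seminorm of index n controls each fixed seminorm
  eventually.\<close>

lemma smooth_curve_flat_sum: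
  assumes d: "\<And>k x. (d k has_real_derivative d (Suc k) x) (at x)"
    and supp: "\<And>k x. \<bar>x\<bar> > 1 \<Longrightarrow> d k x = 0" and C: "\<And>k x. \<bar>d k x\<bar> \<le> C k"
    and w: "\<And>n. w n \<in> topspace T" "\<And>n. q n (w n) \<le> (1/2)^(n^2)"
  shows "smooth_curve T (\<lambda>t. \<Sum>n | \<bar>2 ^ n * t - 4\<bar> \<le> 1. d 0 (2 ^ n * t - 4) *\<^sub>R w n)"
proof -
  \<comment> \<open>The termwise k-th derivative; the chain rule contributes 2^(n k).\<close>
  define D where "D = (\<lambda>k t. \<Sum>n | \<bar>2 ^ n * t - 4\<bar> \<le> 1. (2^(n*k) * d k (2 ^ n * t - 4)) *\<^sub>R w n)"
  have C0: "0 \<le> C k" for k using C[of k 0] by linarith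
  have D_in: "D k t \<in> topspace T" for k t
    unfolding D_def using w by (intro carrier_sum) auto
  have "has_vderiv (D k) (D (Suc k) t0) t0 UNIV" for k t0
  proof (cases "t0 = 0")
    case False
    obtain N where N: "\<forall>\<^sub>F t in nhds t0. {n. \<bar>2 ^ n * t - 4\<bar> \<le> 1} \<subseteq> {..<N}"
      using dyadic_window_eventually[OF False] by blast
    have eq: "D k t = (\<Sum>n<N. (2^(n*k) * d k (2 ^ n * t - 4)) *\<^sub>R w n)"
      if "{n. \<bar>2 ^ n * t - 4\<bar> \<le> 1} \<subseteq> {..<N}" for t k
      unfolding D_def using that by (intro sum.mono_neutral_left) (auto simp: supp)
    have "((\<lambda>t. 2^(n*k) * d k (2 ^ n * t - 4)) has_real_derivative
            2^(n*Suc k) * d (Suc k) (2 ^ n * t0 - 4)) (at t0)" for n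
    proof -
      have "((\<lambda>t. d k (2 ^ n * t - 4)) has_real_derivative d (Suc k) (2 ^ n * t0 - 4) * 2 ^ n) (at t0)"
        by (rule DERIV_chain2[OF d]) (auto intro!: derivative_eq_intros)
      from DERIV_cmult[OF this, of "2^(n*k)"] show ?thesis
        by (simp add: power_add mult_ac)
    qed
    then have "has_vderiv (\<lambda>t. \<Sum>n<N. (2^(n*k) * d k (2 ^ n * t - 4)) *\<^sub>R w n)
       (\<Sum>n<N. (2^(n*Suc k) * d (Suc k) (2 ^ n * t0 - 4)) *\<^sub>R w n) t0 UNIV"
      by (intro has_vderiv_sum has_vderiv_scale w)
    then have "has_vderiv (D k) (\<Sum>n<N. (2^(n*Suc k) * d (Suc k) (2 ^ n * t0 - 4)) *\<^sub>R w n) t0 UNIV"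
      by (rule has_vderiv_cong_ev) (use N in \<open>auto elim!: eventually_mono simp: eq\<close>)
    then show ?thesis using eq[OF eventually_nhds_x_imp_x[OF N], of "Suc k"] by simp
  next
    case True
    have D0: "D k 0 = 0" for k by (simp add: D_def)
    have "limitin T (\<lambda>t. (D k t) /\<^sub>R t) 0 (at 0)"
    proof (rule limitinI_le)
      fix j
      \<comment> \<open>Below 3/2^j only windows of index n >= j occur, where \<open>q j\<close> is
        dominated by \<open>q n\<close>.\<close>
      have "\<forall>\<^sub>F t in at (0::real). t \<in> {-(3 / 2^j) <..< 3 / 2^j}"
        using eventually_nhds_in_open[of "{-(3 / 2^j) <..< 3 / 2^j}" "0::real"]
        by (simp add: eventually_at_filter eventually_mono)
      moreover have "\<forall>\<^sub>F t in at (0::real). t \<noteq> 0" by (simp add: eventually_at_filter)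
      ultimately show "\<forall>\<^sub>F t in at 0. q j ((D k t) /\<^sub>R t - 0) \<le> C k * 2^((k+2)^2) * \<bar>t\<bar>"
      proof eventually_elim
        case (elim t)
        show ?case
        proof (cases "{n. \<bar>2 ^ n * t - 4\<bar> \<le> 1} = {}")
          case True
          then have "D k t = 0" unfolding D_def True by simp
          then show ?thesis using C0[of k] by simp
        next
          case False
          then obtain n where n: "\<bar>2 ^ n * t - 4\<bar> \<le> 1" by blast
          then have A: "{n. \<bar>2 ^ n * t - 4\<bar> \<le> 1} = {n}" using dyadic_window_unique by blast
          have t: "t > 0" using dyadic_window_pos[OF n] .
          have n3: "3 \<le> 2 ^ n * t" using n by (simp add: abs_le_iff)
          have "j \<le> n"
          proof (rule ccontr)
            assume "\<not> j \<le> n"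
            then have "(2::real) ^ n * t \<le> 2 ^ j * t" using t by (intro mult_right_mono power_increasing) auto
            also have "\<dots> < 3" using elim by (simp add: field_simps)
            finally show False using n3 by simp
          qed
          then have "q j (w n) \<le> (1/2)^(n^2)" using q_mono[of j n "w n"] w(2)[of n] by linarith
          then have "q j (D k t) \<le> 2^(n*k) * C k * (1/2)^(n^2)"
            unfolding D_def A using C[of k "2 ^ n * t - 4"] C0[of k]
            by (simp add: q_scale abs_mult) (intro mult_mono mult_left_mono, auto)
          also have "\<dots> \<le> C k * 2^((k+2)^2) * (1/2)^(2*n)"
          proof -
            \<comment> \<open>Besides 2^(n k) a factor 2^(2 n) has to be absorbed: it stands for
              t^-2, one power for the division by t and one for the convergence to 0.\<close>
            have "n * (k + 2) \<le> (k+2)^2 + n^2"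
              using mult_le_mono1[of n "k+2" "k+2"] mult_le_mono2[of "k+2" n n]
              by (cases "n \<le> k + 2") (auto simp: power2_eq_square)
            then have "(2::real)^(n*k + 2*n) \<le> 2^((k+2)^2 + n^2)"
              by (intro power_increasing) (auto simp: algebra_simps)
            then have "(2::real)^(n*k) * (1/2)^(n^2) \<le> 2^((k+2)^2) * (1/2)^(2*n)"
              by (simp add: power_add power_divide field_simps)
            from mult_left_mono[OF this C0[of k]] show ?thesis by (simp only: mult_ac)
          qed
          also have "\<dots> \<le> C k * 2^((k+2)^2) * t^2"
          proof -
            have "(1/2)^n \<le> t" using n3 by (simp add: power_divide field_simps) 
            then have "((1/2)^n)^2 \<le> t^2" by (intro power_mono) auto
            then show ?thesis using C0[of k] by (intro mult_left_mono) (auto simp: power_mult[symmetric] mult.commute)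
          qed
          finally show ?thesis using t by (simp add: q_scale field_simps power2_eq_square)
        qed
      qed
    next
      show "((\<lambda>t. C k * 2^((k+2)^2) * \<bar>t\<bar>) \<longlongrightarrow> 0) (at 0)"
        by (rule tendsto_eq_intros refl | simp)+
    qed (use D_in in auto)
    then show ?thesis unfolding True has_vderiv_def by (simp add: D0)
  qed
  then have "smooth_curve T (D 0)" unfolding smooth_curve_iff using D_in by blast
  then show ?thesis by (simp add: D_def)
qed

text \<open>
  The curve visits \<open>p + a n\<close> with velocity proportional to \<open>b n\<close> at the time \<open>4 / 2 ^ n\<close>;
  it is smooth at \<open>0\<close> because the two sequences decay faster than all powers of \<open>2 ^ n\<close>.
\<close>

lemma special_curve:
  assumes p: "p \<in> topspace T"
    and a: "\<And>n. a n \<in> topspace T" "\<And>n. q n (a n) \<le> (1/2)^(n^2)"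
    and b: "\<And>n. b n \<in> topspace T" "\<And>n. q n (b n) \<le> (1/2)^(n^2)"
  obtains c where "smooth_curve T c" "c 0 = p"
    "\<And>n s. \<bar>s\<bar> \<le> 1/2 \<Longrightarrow> c ((4 + s) / 2^n) = p + a n + s *\<^sub>R b n"
    "\<And>t. c t = p \<or> (\<exists>n \<alpha> \<beta>. 0 \<le> \<alpha> \<and> \<alpha> \<le> 1 \<and> \<bar>\<beta>\<bar> \<le> 1 \<and> c t = p + \<alpha> *\<^sub>R a n + \<beta> *\<^sub>R b n)"
proof -
  obtain \<phi> where \<phi>: "smooth_fun \<phi>" "\<And>x. \<bar>x\<bar> \<ge> 1 \<Longrightarrow> \<phi> x = 0" "\<And>x. \<bar>x\<bar> \<le> 1/2 \<Longrightarrow> \<phi> x = 1"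
    "\<And>x. 0 \<le> \<phi> x" "\<And>x. \<phi> x \<le> 1" using smooth_bump by blast
  \<comment> \<open>Equal to x for |x| <= 1/2, hence it produces the affine piece with velocity
    proportional to \<open>b n\<close>.\<close>
  define \<eta> where "\<eta> = (\<lambda>x. x * \<phi> x)"
  have \<eta>: "smooth_fun \<eta>" "\<And>x. \<bar>x\<bar> \<ge> 1 \<Longrightarrow> \<eta> x = 0"
    using \<phi>(1,2) n_diff_id by (auto simp: \<eta>_def smooth_fun_def intro: n_diff_mult)
  obtain d C where d: "d 0 = \<phi>" "\<And>k x. (d k has_real_derivative d (Suc k) x) (at x)"
    "\<And>k x. \<bar>x\<bar> > 1 \<Longrightarrow> d k x = 0" "\<And>k x. \<bar>d k x\<bar> \<le> C k"
    using compactly_supported_derivs[OF \<phi>(1,2)] by metis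
  obtain d' C' where d': "d' 0 = \<eta>" "\<And>k x. (d' k has_real_derivative d' (Suc k) x) (at x)"
    "\<And>k x. \<bar>x\<bar> > 1 \<Longrightarrow> d' k x = 0" "\<And>k x. \<bar>d' k x\<bar> \<le> C' k"
    using compactly_supported_derivs[OF \<eta>(1,2)] by metis
  define c where "c = (\<lambda>t. p + (\<Sum>n | \<bar>2 ^ n * t - 4\<bar> \<le> 1. \<phi> (2 ^ n * t - 4) *\<^sub>R a n) +
     (\<Sum>n | \<bar>2 ^ n * t - 4\<bar> \<le> 1. \<eta> (2 ^ n * t - 4) *\<^sub>R b n))"
  have single: "c t = p + \<phi> (2 ^ n * t - 4) *\<^sub>R a n + \<eta> (2 ^ n * t - 4) *\<^sub>R b n"
    if n: "\<bar>2 ^ n * t - 4\<bar> \<le> 1" for n t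
  proof -
    have "{n. \<bar>2 ^ n * t - 4\<bar> \<le> 1} = {n}" using dyadic_window_unique n by blast
    then show ?thesis by (simp add: c_def)
  qed
  show ?thesis
  proof (rule that[of c])
    have "smooth_curve T (\<lambda>t. (\<Sum>n | \<bar>2 ^ n * t - 4\<bar> \<le> 1. \<phi> (2 ^ n * t - 4) *\<^sub>R a n))"
      using smooth_curve_flat_sum[where d=d and C=C and w=a] d a by simp
    moreover have "smooth_curve T (\<lambda>t. (\<Sum>n | \<bar>2 ^ n * t - 4\<bar> \<le> 1. \<eta> (2 ^ n * t - 4) *\<^sub>R b n))"
      using smooth_curve_flat_sum[where d=d' and C=C' and w=b] d' b by simp
    ultimately show "smooth_curve T c"
      unfolding c_def by (intro smooth_curve_plus smooth_curve_const p)
    show "c 0 = p" by (simp add: c_def)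
    show "c ((4 + s) / 2^n) = p + a n + s *\<^sub>R b n" if "\<bar>s\<bar> \<le> 1/2" for n s
      using single[of n "(4 + s) / 2^n"] that \<phi>(3)[of s] by (simp add: \<eta>_def)
    show "c t = p \<or> (\<exists>n \<alpha> \<beta>. 0 \<le> \<alpha> \<and> \<alpha> \<le> 1 \<and> \<bar>\<beta>\<bar> \<le> 1 \<and> c t = p + \<alpha> *\<^sub>R a n + \<beta> *\<^sub>R b n)" for t
    proof (cases "{n. \<bar>2 ^ n * t - 4\<bar> \<le> 1} = {}")
      case True
      then show ?thesis unfolding c_def True by simp
    next
      case False
      then obtain n where n: "\<bar>2 ^ n * t - 4\<bar> \<le> 1" by blast
      have "\<bar>\<eta> (2 ^ n * t - 4)\<bar> \<le> 1"
        using mult_le_one[OF n _ \<phi>(5)[of "2 ^ n * t - 4"]] \<phi>(4) by (simp add: \<eta>_def abs_mult)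
      then show ?thesis using single[OF n] \<phi>(4,5) by blast
    qed
  qed
qed

text \<open>\<open>smooth_map\<close> tests only curves that stay in the domain for all times.
  Replacing t by t times a bump keeps the line in a segment without changing it near time 0.\<close>

lemma confined_line_curve:
  assumes "x \<in> topspace T" "v \<in> topspace T" "r > 0"
  obtains c where "smooth_curve T c" "\<And>t. \<bar>t\<bar> \<le> r/2 \<Longrightarrow> c t = x + t *\<^sub>R v"
    "\<And>t. \<exists>s. \<bar>s\<bar> \<le> r \<and> c t = x + s *\<^sub>R v"
proof -
  obtain \<phi> where \<phi>: "smooth_fun \<phi>" "\<And>x. \<bar>x\<bar> \<ge> 1 \<Longrightarrow> \<phi> x = 0" "\<And>x. \<bar>x\<bar> \<le> 1/2 \<Longrightarrow> \<phi> x = 1"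
    "\<And>x. 0 \<le> \<phi> x" "\<And>x. \<phi> x \<le> 1" using smooth_bump by blast
  define \<theta> where "\<theta> = (\<lambda>t. t * \<phi> ((1/r) * t))"
  have "n_diff n \<phi>" for n using \<phi>(1) by (simp add: smooth_fun_def)
  then have "smooth_fun \<theta>" unfolding smooth_fun_def \<theta>_def
    using n_diff_compose[OF _ n_diff_mult[OF n_diff_const n_diff_id]] n_diff_mult[OF n_diff_id] by blast
  then have curve: "smooth_curve T (\<lambda>t. x + \<theta> t *\<^sub>R v)"
    by (intro smooth_curve_plus smooth_curve_const smooth_curve_scale assms)
  have near: "x + \<theta> t *\<^sub>R v = x + t *\<^sub>R v" if "\<bar>t\<bar> \<le> r/2" for t
    using \<phi>(3)[of "(1/r) * t"] that assms(3) by (simp add: \<theta>_def abs_mult field_simps)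
  have \<theta>_le: "\<bar>\<theta> t\<bar> \<le> r" for t
  proof (cases "\<bar>t\<bar> \<le> r")
    case True
    then show ?thesis using mult_mono[OF True \<phi>(5)[of "(1/r) * t"]] \<phi>(4) assms(3)
      by (simp add: \<theta>_def abs_mult)
  next
    case False
    then have "\<theta> t = 0" using \<phi>(2)[of "(1/r) * t"] assms(3) by (simp add: \<theta>_def abs_mult field_simps)
    then show ?thesis using assms(3) by simp
  qed
  have "\<exists>s. \<bar>s\<bar> \<le> r \<and> x + \<theta> t *\<^sub>R v = x + s *\<^sub>R v" for t using \<theta>_le by blast
  with curve near show ?thesis by (rule that)
qed

end

section \<open>Smooth maps are continuously differentiable\<close>

lemma dyadic_times: "filterlim (\<lambda>n. 4 / 2 ^ n :: real) (at 0) sequentially"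
  unfolding filterlim_at
  by (auto intro: LIMSEQ_divide_realpow_zero)

lemma dyadic_times_eventually:
  "\<forall>\<^sub>F t in at (0::real). P t \<Longrightarrow> \<forall>\<^sub>F n in sequentially. P (4 / 2 ^ n)"
  using dyadic_times unfolding filterlim_iff by blast

lemma eventually_at_0_abs_less: "r > 0 \<Longrightarrow> \<forall>\<^sub>F h in at (0::real). \<bar>h\<bar> < r"
  by (auto simp: eventually_at)

locale seminormed_pair = dom: seminormed_space S p + cod: seminormed_space T q
  for S :: "'a::real_vector topology" and p :: "nat \<Rightarrow> 'a \<Rightarrow> real"
    and T :: "'b::real_vector topology" and q :: "nat \<Rightarrow> 'b \<Rightarrow> real"
begin

text \<open>A sequence violating continuity can be chosen to converge so fast that a smooth curve
  passes through it at times tending to 0; the image of that curve would be discontinuous at 0. The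
  star condition keeps the curve in \<open>A\<close> also when \<open>A\<close> is not open, as for
  the time interval of a semiflow, which contains its end point 0.\<close>

lemma smooth_map_continuous:
  assumes smooth: "smooth_map S A T f" and x0: "x0 \<in> A" and e: "e > 0"
    and star: "\<delta>0 > 0" "\<And>x s. x \<in> A \<Longrightarrow> p M0 (x - x0) < \<delta>0 \<Longrightarrow> 0 \<le> s \<Longrightarrow> s \<le> 1 \<Longrightarrow> x0 + s *\<^sub>R (x - x0) \<in> A"
  obtains M \<delta> where "\<delta> > 0" "\<And>x. x \<in> A \<Longrightarrow> p M (x - x0) < \<delta> \<Longrightarrow> q N (f x - f x0) < e"
proof (rule ccontr)
  assume "\<not> thesis"
  note obt = that
  have neg: "\<exists>x. x \<in> A \<and> p M (x - x0) < \<delta> \<and> \<not> q N (f x - f x0) < e" if "\<delta> > 0" for M \<delta>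
    using obt[OF that, of M] \<open>\<not> thesis\<close> by blast
  have AS: "A \<subseteq> topspace S" and fA: "f ` A \<subseteq> topspace T" using smooth by (auto simp: smooth_map_def)
  \<comment> \<open>One seminorm of index max n M0 yields both the flatness required by
    \<open>special_curve\<close> and the closeness required by the star condition.\<close>
  have "\<exists>x. x \<in> A \<and> p (max n M0) (x - x0) < min \<delta>0 ((1/2)^(n^2)) \<and> \<not> q N (f x - f x0) < e" for n
    using star(1) by (intro neg) simp
  then obtain x where x: "\<And>n. x n \<in> A" "\<And>n. p (max n M0) (x n - x0) < min \<delta>0 ((1/2)^(n^2))"
    "\<And>n. \<not> q N (f (x n) - f x0) < e" by metis
  have small: "p n (x n - x0) \<le> (1/2)^(n^2)" "p M0 (x n - x0) < \<delta>0" for n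
    using x(2)[of n] dom.q_mono[of n "max n M0" "x n - x0"] dom.q_mono[of M0 "max n M0" "x n - x0"]
    by linarith+
  obtain c where c: "smooth_curve S c" "c 0 = x0"
    "\<And>n s. \<bar>s\<bar> \<le> 1/2 \<Longrightarrow> c ((4 + s) / 2^n) = x0 + (x n - x0) + s *\<^sub>R 0"
    "\<And>t. c t = x0 \<or> (\<exists>n \<alpha> \<beta>. 0 \<le> \<alpha> \<and> \<alpha> \<le> 1 \<and> \<bar>\<beta>\<bar> \<le> 1 \<and> c t = x0 + \<alpha> *\<^sub>R (x n - x0) + \<beta> *\<^sub>R 0)"
    by (rule dom.special_curve[of x0 "\<lambda>n. x n - x0" "\<lambda>n. 0"]) (use x(1) x0 AS small(1) that in auto)
  have "c t \<in> A" for t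
    using c(4)[of t] x0 star(2)[OF x(1) small(2)] by auto
  then have "smooth_curve T (f \<circ> c)" using smooth c(1) by (auto simp: smooth_map_def)
  then have "limitin T (f \<circ> c) ((f \<circ> c) 0) (at 0)" using cod.smooth_curveE by metis
  from cod.limitin_small[OF this e] have "\<forall>\<^sub>F t in at 0. q N (f (c t) - f x0) < e" using c(2) by simp
  then have "\<forall>\<^sub>F n in sequentially. q N (f (c (4 / 2 ^ n)) - f x0) < e"
    by (rule dyadic_times_eventually)
  then obtain n where "q N (f (c (4 / 2 ^ n)) - f x0) < e"
    using eventually_happens trivial_limit_sequentially by blast
  moreover have "c (4 / 2 ^ n) = x n" using c(3)[of 0 n] by simp
  ultimately show False using x(3) by simp
qed

lemma smooth_map_limitin:
  assumes "smooth_map S A T f" "x0 \<in> A" "limitin S z x0 F" "\<forall>\<^sub>F i in F. z i \<in> A"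
    and star: "\<delta>0 > 0" "\<And>x s. x \<in> A \<Longrightarrow> p M0 (x - x0) < \<delta>0 \<Longrightarrow> 0 \<le> s \<Longrightarrow> s \<le> 1 \<Longrightarrow> x0 + s *\<^sub>R (x - x0) \<in> A"
  shows "limitin T (\<lambda>i. f (z i)) (f x0) F"
  unfolding cod.limitin_iff
proof (intro conjI allI)
  have fA: "f ` A \<subseteq> topspace T" using assms(1) by (auto simp: smooth_map_def)
  show "f x0 \<in> topspace T" using fA assms(2) by auto
  show "\<forall>\<^sub>F i in F. f (z i) \<in> topspace T" using assms(4) by eventually_elim (use fA in auto)
  fix N
  show "((\<lambda>i. q N (f (z i) - f x0)) \<longlongrightarrow> 0) F"
  proof (rule tendstoI)
    fix e :: real assume "e > 0"
    then obtain M \<delta> where "\<delta> > 0" "\<And>x. x \<in> A \<Longrightarrow> p M (x - x0) < \<delta> \<Longrightarrow> q N (f x - f x0) < e"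
      by (rule smooth_map_continuous[OF assms(1,2) _ star(1), where ?M0.0=M0 and N=N]) (auto intro: star(2))
    then show "\<forall>\<^sub>F i in F. dist (q N (f (z i) - f x0)) 0 < e"
      using dom.limitin_small[OF assms(3), of \<delta> M] assms(4) by (auto elim: eventually_elim2)
  qed
qed

end

locale open_smooth_map = seminormed_pair S p T q
  for S :: "'a::real_vector topology" and p :: "nat \<Rightarrow> 'a \<Rightarrow> real"
    and T :: "'b::real_vector topology" and q :: "nat \<Rightarrow> 'b \<Rightarrow> real" +
  fixes A :: "'a set" and f :: "'a \<Rightarrow> 'b"
  assumes opn: "openin S A" and smooth: "smooth_map S A T f"
begin

lemma A_carrier: "x \<in> A \<Longrightarrow> x \<in> topspace S"
  using smooth by (auto simp: smooth_map_def)

lemma f_carrier: "x \<in> A \<Longrightarrow> f x \<in> topspace T"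
  using smooth by (auto simp: smooth_map_def)

lemma continuous:
  assumes x0: "x0 \<in> A" and z: "limitin S z x0 F"
  shows "limitin T (\<lambda>i. f (z i)) (f x0) F"
proof -
  obtain M0 \<delta>0 where b: "\<delta>0 > 0" "\<And>y. y \<in> topspace S \<Longrightarrow> p M0 (y - x0) < \<delta>0 \<Longrightarrow> y \<in> A"
    using dom.openin_ballE[OF opn x0] by blast
  show ?thesis
  proof (rule smooth_map_limitin[OF smooth x0 z _ b(1)])
    show "\<forall>\<^sub>F i in F. z i \<in> A" using z opn x0 by (simp add: limitin_def)
    fix x and s :: real assume x: "x \<in> A" "p M0 (x - x0) < \<delta>0" "0 \<le> s" "s \<le> 1"
    have "s * p M0 (x - x0) \<le> p M0 (x - x0)" using x by (intro mult_left_le_one_le) auto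
    then show "x0 + s *\<^sub>R (x - x0) \<in> A"
      using x x0 A_carrier by (intro b(2)) (auto simp: dom.q_scale)
  qed
qed

lemma segment_in:
  assumes x: "x \<in> A" and v: "v \<in> topspace S"
  obtains r where "r > 0" "\<And>s. \<bar>s\<bar> \<le> r \<Longrightarrow> x + s *\<^sub>R v \<in> A"
proof -
  obtain M0 \<delta>0 where b: "\<delta>0 > 0" "\<And>y. y \<in> topspace S \<Longrightarrow> p M0 (y - x) < \<delta>0 \<Longrightarrow> y \<in> A"
    using dom.openin_ballE[OF opn x] by blast
  have pos: "p M0 v + 1 > 0" using dom.q_nonneg[of M0 v] by linarith
  show ?thesis
  proof (rule that[of "\<delta>0 / (p M0 v + 1)"])
    show "\<delta>0 / (p M0 v + 1) > 0" using b(1) pos by simp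
    fix s assume "\<bar>s\<bar> \<le> \<delta>0 / (p M0 v + 1)"
    then have "\<bar>s\<bar> * (p M0 v + 1) \<le> \<delta>0" using pos by (simp add: field_simps)
    then have "\<bar>s\<bar> * p M0 v < \<delta>0" using b(1) by (cases "s = 0") (auto simp: distrib_left)
    then show "x + s *\<^sub>R v \<in> A"
      using x v A_carrier by (intro b(2)) (auto simp: dom.q_scale)
  qed
qed

text \<open>For equal domain and codomain this is literally \<open>dir_deriv\<close>, so Lie
  brackets unfold into differences of such differentials.\<close>

definition df :: "'a \<Rightarrow> 'a \<Rightarrow> 'b" where
  "df x v = (THE w. limitin T (\<lambda>h. (f (x + h *\<^sub>R v) - f x) /\<^sub>R h) w (at 0))"

text \<open>Only the repeated derivative in one direction is formed: it is the second derivative of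
  \<open>f\<close> along a line, which a smooth curve can detect.\<close>

definition d2f :: "'a \<Rightarrow> 'a \<Rightarrow> 'b" where
  "d2f x v = (THE w. limitin T (\<lambda>h. (df (x + h *\<^sub>R v) v - df x v) /\<^sub>R h) w (at 0))"

lemma df_unique:
  "limitin T (\<lambda>h. (f (x + h *\<^sub>R v) - f x) /\<^sub>R h) w (at 0) \<Longrightarrow> df x v = w"
  unfolding df_def by (rule the_equality) (auto intro: cod.limitin_unique)

lemma d2f_unique:
  "limitin T (\<lambda>h. (df (x + h *\<^sub>R v) v - df x v) /\<^sub>R h) w (at 0) \<Longrightarrow> d2f x v = w"
  unfolding d2f_def by (rule the_equality) (auto intro: cod.limitin_unique)

text \<open>A straight line confined to \<open>A\<close> is a smooth curve, so its image has
  derivatives of all orders. The first derivative at all small times has to be identified with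
  \<open>df\<close> before the second one at 0 can be read off.\<close>

lemma df_d2f_limits:
  assumes x: "x \<in> A" and v: "v \<in> topspace S"
  shows "limitin T (\<lambda>h. (f (x + h *\<^sub>R v) - f x) /\<^sub>R h) (df x v) (at 0)"
    and "limitin T (\<lambda>h. (df (x + h *\<^sub>R v) v - df x v) /\<^sub>R h) (d2f x v) (at 0)"
proof -
  obtain r where r: "r > 0" "\<And>s. \<bar>s\<bar> \<le> r \<Longrightarrow> x + s *\<^sub>R v \<in> A" using segment_in[OF x v] by blast
  obtain c where c: "smooth_curve S c" "\<And>t. \<bar>t\<bar> \<le> r/2 \<Longrightarrow> c t = x + t *\<^sub>R v"
    "\<And>t. \<exists>s. \<bar>s\<bar> \<le> r \<and> c t = x + s *\<^sub>R v"
    using dom.confined_line_curve[OF A_carrier[OF x] v r(1)] by blast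
  have "c t \<in> A" for t using c(3)[of t] r(2) by auto
  then have "smooth_curve T (f \<circ> c)" using smooth c(1) by (auto simp: smooth_map_def)
  then obtain d where d: "d 0 = f \<circ> c" "\<And>k t. cod.has_vderiv (d k) (d (Suc k) t) t UNIV"
    using cod.smooth_curveE by metis
  have lim1: "limitin T (\<lambda>h. (f (x + t *\<^sub>R v + h *\<^sub>R v) - f (x + t *\<^sub>R v)) /\<^sub>R h) (d 1 t) (at 0)"
    if t: "\<bar>t\<bar> < r/2" for t
  proof -
    have L: "limitin T (\<lambda>h. (d 0 (t + h) - d 0 t) /\<^sub>R h) (d 1 t) (at 0)"
      using d(2)[of 0 t] unfolding cod.has_vderiv_shift by simp
    have "\<forall>\<^sub>F h in at (0::real). \<bar>h\<bar> < r/2 - \<bar>t\<bar>"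
      by (rule eventually_at_0_abs_less) (use t in simp)
    then have "\<forall>\<^sub>F h in at 0. (d 0 (t + h) - d 0 t) /\<^sub>R h =
       (f (x + t *\<^sub>R v + h *\<^sub>R v) - f (x + t *\<^sub>R v)) /\<^sub>R h"
    proof eventually_elim
      case (elim h)
      then have "\<bar>t + h\<bar> \<le> r/2" using abs_triangle_ineq[of t h] by linarith
      then show ?case using c(2)[of "t + h"] c(2)[of t] t by (simp add: d(1) algebra_simps)
    qed
    with L show ?thesis by (rule cod.limitin_cong_ev)
  qed
  have df_eq: "df (x + t *\<^sub>R v) v = d 1 t" if "\<bar>t\<bar> < r/2" for t
    using lim1[OF that] by (rule df_unique)
  show "limitin T (\<lambda>h. (f (x + h *\<^sub>R v) - f x) /\<^sub>R h) (df x v) (at 0)"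
    using lim1[of 0] df_eq[of 0] r(1) by simp
  have L: "limitin T (\<lambda>h. (d 1 (0 + h) - d 1 0) /\<^sub>R h) (d 2 0) (at 0)"
    using d(2)[of 1 0] unfolding cod.has_vderiv_shift by (simp add: numeral_2_eq_2)
  have "\<forall>\<^sub>F h in at (0::real). \<bar>h\<bar> < r/2"
    by (rule eventually_at_0_abs_less) (use r in simp)
  then have "\<forall>\<^sub>F h in at 0. (d 1 (0 + h) - d 1 0) /\<^sub>R h = (df (x + h *\<^sub>R v) v - df x v) /\<^sub>R h"
    by eventually_elim (use df_eq df_eq[of 0] r(1) in simp)
  with L have L2: "limitin T (\<lambda>h. (df (x + h *\<^sub>R v) v - df x v) /\<^sub>R h) (d 2 0) (at 0)"
    by (rule cod.limitin_cong_ev)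
  then show "limitin T (\<lambda>h. (df (x + h *\<^sub>R v) v - df x v) /\<^sub>R h) (d2f x v) (at 0)"
    unfolding d2f_unique[OF L2] .
qed

lemma df_carrier: "x \<in> A \<Longrightarrow> v \<in> topspace S \<Longrightarrow> df x v \<in> topspace T"
  using df_d2f_limits(1) cod.limitin_carrier by blast

lemma has_vderiv_line:
  assumes "x + t *\<^sub>R v \<in> A" "v \<in> topspace S"
  shows "cod.has_vderiv (\<lambda>s. f (x + s *\<^sub>R v)) (df (x + t *\<^sub>R v) v) t I"
    and "cod.has_vderiv (\<lambda>s. df (x + s *\<^sub>R v) v) (d2f (x + t *\<^sub>R v) v) t I"
  using df_d2f_limits[OF assms]
  by (auto intro!: cod.has_vderiv_subset[of _ _ _ UNIV I] simp: cod.has_vderiv_shift algebra_simps)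

lemma filterlim_scale_at_0: "a \<noteq> 0 \<Longrightarrow> filterlim (\<lambda>h. h * a) (at 0) (at (0::real))"
  by (auto simp: filterlim_at eventually_at_filter intro!: tendsto_eq_intros)

lemma df_scale:
  assumes x: "x \<in> A" and v: "v \<in> topspace S"
  shows "df x (a *\<^sub>R v) = a *\<^sub>R df x v"
proof (cases "a = 0")
  case True
  then show ?thesis by (auto intro!: df_unique cod.limitin_konst)
next
  case False
  have "limitin T (\<lambda>h. a *\<^sub>R ((f (x + (h * a) *\<^sub>R v) - f x) /\<^sub>R (h * a))) (a *\<^sub>R df x v) (at 0)"
    by (intro cod.limitin_scale tendsto_const
        cod.limitin_compose_filterlim[OF df_d2f_limits(1)[OF x v] filterlim_scale_at_0[OF False]])
  moreover have "a * inverse (h * a) = inverse h" for h using False by (cases "h = 0") (auto simp: field_simps)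
  ultimately show ?thesis by (intro df_unique) (simp only: scaleR_scaleR)
qed

text \<open>Rescaling the direction costs exactly the square of the factor; this accounts for the
  small velocities in \<open>d2f_locally_bounded\<close>.\<close>

lemma d2f_scale:
  assumes x: "x \<in> A" and v: "v \<in> topspace S" and a: "a \<noteq> 0"
  shows "d2f x (a *\<^sub>R v) = a\<^sup>2 *\<^sub>R d2f x v"
proof (rule d2f_unique)
  have L: "limitin T (\<lambda>h. a\<^sup>2 *\<^sub>R ((df (x + (h * a) *\<^sub>R v) v - df x v) /\<^sub>R (h * a))) (a\<^sup>2 *\<^sub>R d2f x v) (at 0)"
    by (intro cod.limitin_scale tendsto_const
        cod.limitin_compose_filterlim[OF df_d2f_limits(2)[OF x v] filterlim_scale_at_0[OF a]])
  obtain r where r: "r > 0" "\<And>s. \<bar>s\<bar> \<le> r \<Longrightarrow> x + s *\<^sub>R (a *\<^sub>R v) \<in> A"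
    using segment_in[OF x dom.carrier_scale[OF v]] by blast
  have "\<forall>\<^sub>F h in at (0::real). \<bar>h\<bar> < r"
    by (rule eventually_at_0_abs_less) (use r in simp)
  then have "\<forall>\<^sub>F h in at 0. a\<^sup>2 *\<^sub>R ((df (x + (h * a) *\<^sub>R v) v - df x v) /\<^sub>R (h * a)) =
     (df (x + h *\<^sub>R a *\<^sub>R v) (a *\<^sub>R v) - df x (a *\<^sub>R v)) /\<^sub>R h"
  proof eventually_elim
    case (elim h)
    then have "x + (h * a) *\<^sub>R v \<in> A" using r(2)[of h] by simp
    then show ?case using a
      by (simp add: df_scale x v scaleR_diff_right[symmetric] power2_eq_square)
  qed
  with L show "limitin T (\<lambda>h. (df (x + h *\<^sub>R a *\<^sub>R v) (a *\<^sub>R v) - df x (a *\<^sub>R v)) /\<^sub>R h) (a\<^sup>2 *\<^sub>R d2f x v) (at 0)"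
    by (rule cod.limitin_cong_ev)
qed

text \<open>If boundedness fails, a smooth curve can be led through points \<open>x n\<close> with
  velocities along \<open>v n\<close> so that the second derivative of its image exceeds n at time
  4/2^n, against the continuity of that derivative at 0. The velocities have to decay rapidly, but
  the bound to be violated may be chosen after the rate of decay.\<close>

lemma d2f_locally_bounded:
  assumes x0: "x0 \<in> A" and v0: "v0 \<in> topspace S"
  obtains M \<delta> B where "\<delta> > 0"
    "\<And>x v. x \<in> A \<Longrightarrow> v \<in> topspace S \<Longrightarrow> p M (x - x0) < \<delta> \<Longrightarrow> p M (v - v0) < \<delta> \<Longrightarrow> q N (d2f x v) \<le> B"
proof (rule ccontr)
  assume "\<not> thesis"
  note obt = that
  have neg: "\<exists>x v. x \<in> A \<and> v \<in> topspace S \<and> p M (x - x0) < \<delta> \<and> p M (v - v0) < \<delta> \<and> \<not> q N (d2f x v) \<le> B"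
    if "\<delta> > 0" for M \<delta> B
    using obt[OF that, of M B] \<open>\<not> thesis\<close> by blast
  obtain M0 e0 where e0: "e0 > 0" "\<And>y. y \<in> topspace S \<Longrightarrow> p M0 (y - x0) < e0 \<Longrightarrow> y \<in> A"
    using dom.openin_ballE[OF opn x0] by blast
  define K where "K = (\<lambda>n. p (max n M0) v0 + 1)"
  have K: "K n > 0" for n using dom.q_nonneg[of "max n M0" v0] unfolding K_def by linarith
  \<comment> \<open>Half of \<open>e0\<close> for the position and half for the velocity part keep
    the whole curve in \<open>A\<close>; the other bound is the flatness demanded by
    \<open>special_curve\<close>.\<close>
  define m where "m = (\<lambda>n. min (e0/2) ((1/2)^(n^2)))"
  have m: "m n > 0" for n using e0(1) by (simp add: m_def)
  define \<epsilon> where "\<epsilon> = (\<lambda>n. m n / K n)"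
  have \<epsilon>: "\<epsilon> n > 0" for n using m K by (simp add: \<epsilon>_def)
  define \<delta> where "\<delta> = (\<lambda>n. min 1 (m n))"
  \<comment> \<open>At its n-th visit the curve moves with velocity
    \<open>(2^n * \<epsilon> n) *\<^sub>R v n\<close>; dividing n by the square of this factor makes
    the second derivative there exceed n.\<close>
  have "\<exists>x v. x \<in> A \<and> v \<in> topspace S \<and> p (max n M0) (x - x0) < \<delta> n \<and> p (max n M0) (v - v0) < \<delta> n \<and>
     \<not> q N (d2f x v) \<le> real n / (2^n * \<epsilon> n)^2" for n
    using m by (intro neg) (simp add: \<delta>_def)
  then obtain x v where xv: "\<And>n. x n \<in> A" "\<And>n. v n \<in> topspace S" "\<And>n. p (max n M0) (x n - x0) < \<delta> n"
    "\<And>n. p (max n M0) (v n - v0) < \<delta> n" "\<And>n. \<not> q N (d2f (x n) (v n)) \<le> real n / (2^n * \<epsilon> n)^2" by metis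
  have px: "p (max n M0) (x n - x0) < m n" for n using xv(3)[of n] by (simp add: \<delta>_def)
  have pv: "p (max n M0) (\<epsilon> n *\<^sub>R v n) \<le> m n" for n
  proof -
    have "p (max n M0) (v n) \<le> K n"
      using dom.q_triangle[of "max n M0" "v n - v0" v0] xv(4)[of n] by (simp add: K_def \<delta>_def)
    then show ?thesis using K[of n] m[of n] by (simp add: dom.q_scale \<epsilon>_def field_simps)
  qed
  have mono: "p n y \<le> p (max n M0) y" "p M0 y \<le> p (max n M0) y" for n y by (auto intro: dom.q_mono)
  obtain c where c: "smooth_curve S c" "c 0 = x0"
    "\<And>n s. \<bar>s\<bar> \<le> 1/2 \<Longrightarrow> c ((4 + s) / 2^n) = x0 + (x n - x0) + s *\<^sub>R (\<epsilon> n *\<^sub>R v n)"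
    "\<And>t. c t = x0 \<or> (\<exists>n \<alpha> \<beta>. 0 \<le> \<alpha> \<and> \<alpha> \<le> 1 \<and> \<bar>\<beta>\<bar> \<le> 1 \<and> c t = x0 + \<alpha> *\<^sub>R (x n - x0) + \<beta> *\<^sub>R (\<epsilon> n *\<^sub>R v n))"
  proof (rule dom.special_curve[of x0 "\<lambda>n. x n - x0" "\<lambda>n. \<epsilon> n *\<^sub>R v n"])
    show "p n (x n - x0) \<le> (1/2)^(n^2)" for n
      using mono(1)[of n "x n - x0"] px[of n] by (simp add: m_def)
    show "p n (\<epsilon> n *\<^sub>R v n) \<le> (1/2)^(n^2)" for n
      using mono(1)[of n "\<epsilon> n *\<^sub>R v n"] pv[of n] by (simp add: m_def)
  qed (use xv x0 A_carrier in auto)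
  have cA: "c t \<in> A" for t
    using c(4)[of t]
  proof (elim disjE exE conjE)
    fix n \<alpha> \<beta> assume *: "0 \<le> \<alpha>" "\<alpha> \<le> 1" "\<bar>\<beta>\<bar> \<le> 1" "c t = x0 + \<alpha> *\<^sub>R (x n - x0) + \<beta> *\<^sub>R (\<epsilon> n *\<^sub>R v n)"
    have "p M0 (\<alpha> *\<^sub>R (x n - x0)) < e0/2"
      using mult_left_le_one_le[of "p M0 (x n - x0)" \<alpha>] mono(2)[where n=n and y="x n - x0"] px[of n] *
      by (simp add: dom.q_scale m_def)
    moreover have "p M0 (\<beta> *\<^sub>R (\<epsilon> n *\<^sub>R v n)) \<le> e0/2"
      using mult_left_le_one_le[of "p M0 (\<epsilon> n *\<^sub>R v n)" "\<bar>\<beta>\<bar>"] mono(2)[where n=n and y="\<epsilon> n *\<^sub>R v n"] pv[of n] *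
      unfolding dom.q_scale[of M0 \<beta>] m_def by simp
    ultimately have "p M0 (\<alpha> *\<^sub>R (x n - x0) + \<beta> *\<^sub>R (\<epsilon> n *\<^sub>R v n)) < e0"
      using dom.q_triangle[of M0 "\<alpha> *\<^sub>R (x n - x0)" "\<beta> *\<^sub>R (\<epsilon> n *\<^sub>R v n)"] by linarith
    then show ?thesis using * xv x0 A_carrier by (intro e0(2)) (auto simp: add.assoc)
  qed (use x0 in simp)
  then have "smooth_curve T (f \<circ> c)" using smooth c(1) by (auto simp: smooth_map_def)
  then obtain d where d: "d 0 = f \<circ> c" "\<And>k t. cod.has_vderiv (d k) (d (Suc k) t) t UNIV"
     "\<And>k t. limitin T (d k) (d k t) (at t)"
    using cod.smooth_curveE by metis
  have big: "q N (d 2 (4 / 2^n)) > real n" for n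
  proof -
    \<comment> \<open>On the inner part of this window the curve is the affine line z + t u in the
      original time, passing through \<open>x n\<close> at 4/2^n.\<close>
    define u where "u = (2^n * \<epsilon> n) *\<^sub>R v n"
    define z where "z = x n - (4 / 2^n) *\<^sub>R u"
    have u: "u \<in> topspace S" using xv(2) by (auto simp: u_def)
    define J where "J = ball (4 / 2^n :: real) ((1/2) / 2^n)"
    have J: "open J" "4 / 2^n \<in> J" by (auto simp: J_def)
    have cO: "c t = z + t *\<^sub>R u" if "t \<in> J" for t
    proof -
      have "\<bar>4 / 2^n - t\<bar> < (1/2) / 2^n" using that by (simp add: J_def dist_real_def)
      then have "\<bar>4 / 2^n - t\<bar> * 2^n < 1/2" by (simp add: field_simps)
      moreover have "\<bar>4 / 2^n - t\<bar> * 2^n = \<bar>(4 / 2^n - t) * 2^n\<bar>" by (simp add: abs_mult)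
      moreover have "(4 / 2^n - t) * 2^n = 4 - 2^n * t" by (simp add: field_simps)
      ultimately have "\<bar>2 ^ n * t - 4\<bar> \<le> 1/2" by (simp add: abs_minus_commute)
      from c(3)[OF this, of n] show ?thesis
        by (simp add: z_def u_def algebra_simps)
    qed
    have in_A: "z + t *\<^sub>R u \<in> A" if "t \<in> J" for t using cO[OF that] cA[of t] by simp
    have d1: "d 1 t = df (z + t *\<^sub>R u) u" if t: "t \<in> J" for t
    proof -
      have "\<forall>\<^sub>F s in nhds t. d 0 s = f (z + s *\<^sub>R u)"
        using eventually_nhds_in_open[OF J(1) t] by eventually_elim (simp add: d(1) cO)
      from cod.has_vderiv_cong_ev[OF d(2)[of 0 t] this] has_vderiv_line(1)[OF in_A[OF t] u, of UNIV]
      show ?thesis unfolding cod.has_vderiv_def by (auto intro: cod.limitin_unique)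
    qed
    have "\<forall>\<^sub>F s in nhds (4 / 2^n). d 1 s = df (z + s *\<^sub>R u) u"
      using eventually_nhds_in_open[OF J] by eventually_elim (rule d1)
    moreover have "cod.has_vderiv (d 1) (d 2 (4 / 2^n)) (4 / 2^n) UNIV"
      using d(2)[of 1 "4/2^n"] by (simp add: numeral_2_eq_2)
    ultimately have "cod.has_vderiv (\<lambda>s. df (z + s *\<^sub>R u) u) (d 2 (4 / 2^n)) (4 / 2^n) UNIV"
      by (rule cod.has_vderiv_cong_ev[rotated])
    with has_vderiv_line(2)[OF in_A[OF J(2)] u, of UNIV]
    have "d 2 (4 / 2^n) = d2f (z + (4 / 2^n) *\<^sub>R u) u"
      unfolding cod.has_vderiv_def by (auto intro: cod.limitin_unique)
    also have "\<dots> = (2^n * \<epsilon> n)^2 *\<^sub>R d2f (x n) (v n)"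
      using d2f_scale[OF xv(1)[of n] xv(2)[of n], of "2^n * \<epsilon> n"] \<epsilon>[of n] by (simp add: z_def u_def)
    finally have "q N (d 2 (4 / 2^n)) = (2^n * \<epsilon> n)^2 * q N (d2f (x n) (v n))"
      by (simp add: cod.q_scale)
    moreover have "(2^n * \<epsilon> n)^2 * q N (d2f (x n) (v n)) > real n"
      using xv(5)[of n] \<epsilon>[of n] by (simp add: field_simps not_le)
    ultimately show ?thesis by simp
  qed
  have "\<forall>\<^sub>F t in at 0. q N (d 2 t - d 2 0) < 1" using cod.limitin_small[OF d(3)] by simp
  then have "\<forall>\<^sub>F n in sequentially. q N (d 2 (4 / 2 ^ n) - d 2 0) < 1"
    by (rule dyadic_times_eventually)
  moreover have "\<forall>\<^sub>F n in sequentially. real n > q N (d 2 0) + 1"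
  proof -
    obtain n0 where n0: "real n0 > q N (d 2 0) + 1" using reals_Archimedean2 by blast
    show ?thesis using eventually_ge_at_top[of n0] by eventually_elim (use n0 in linarith)
  qed
  ultimately have "\<forall>\<^sub>F n in sequentially. False"
  proof eventually_elim
    case (elim n)
    then show ?case using big[of n] cod.q_triangle[of N "d 2 (4 / 2 ^ n) - d 2 0" "d 2 0"] by simp
  qed
  then show False by simp
qed

text \<open>Two applications of the mean value inequality turn the bound on second derivatives into
  a first-order remainder bound that is uniform for points and directions near the given
  ones.\<close>

lemma difference_quotient_uniform:
  assumes x0: "x0 \<in> A" and v0: "v0 \<in> topspace S"
  obtains M \<delta> B where "\<delta> > 0"
    "\<And>x v t. x \<in> A \<Longrightarrow> v \<in> topspace S \<Longrightarrow> p M (x - x0) < \<delta> \<Longrightarrow> p M (v - v0) < \<delta> \<Longrightarrow> \<bar>t\<bar> < \<delta> \<Longrightarrow>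
       x + t *\<^sub>R v \<in> A \<and> q N (f (x + t *\<^sub>R v) - f x - t *\<^sub>R df x v) \<le> B * t\<^sup>2"
proof -
  obtain M1 \<delta>1 B where B: "\<delta>1 > 0"
    "\<And>x v. x \<in> A \<Longrightarrow> v \<in> topspace S \<Longrightarrow> p M1 (x - x0) < \<delta>1 \<Longrightarrow> p M1 (v - v0) < \<delta>1 \<Longrightarrow> q N (d2f x v) \<le> B"
    using d2f_locally_bounded[OF assms] by metis
  obtain M0 e0 where e0: "e0 > 0" "\<And>y. y \<in> topspace S \<Longrightarrow> p M0 (y - x0) < e0 \<Longrightarrow> y \<in> A"
    using dom.openin_ballE[OF opn x0] by blast
  define M where "M = max M0 M1"
  have mono: "p M0 y \<le> p M y" "p M1 y \<le> p M y" for y by (auto intro: dom.q_mono simp: M_def)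
  define m where "m = min \<delta>1 e0"
  have m: "m > 0" using B(1) e0(1) by (simp add: m_def)
  define K where "K = p M v0 + 2"
  have K: "K \<ge> 2" by (simp add: K_def)
  \<comment> \<open>Since p M v <= K - 1 for the directions considered, the displacement stays below
    delta + delta (K - 1) = delta K <= m.\<close>
  define \<delta> where "\<delta> = min 1 (m / K)"
  have \<delta>: "\<delta> > 0" "\<delta> \<le> 1" "\<delta> * K \<le> m" "\<delta> \<le> m"
  proof -
    show "\<delta> > 0" "\<delta> \<le> 1" using m K by (auto simp: \<delta>_def)
    have "\<delta> \<le> m / K" by (simp add: \<delta>_def)
    then show *: "\<delta> * K \<le> m" using K by (simp add: field_simps)
    have "\<delta> * 1 \<le> \<delta> * K" using \<open>\<delta> > 0\<close> K by (intro mult_left_mono) auto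
    with * show "\<delta> \<le> m" by simp
  qed
  show ?thesis
  proof (rule that[OF \<delta>(1)])
    fix x v and t :: real
    assume x: "x \<in> A" "p M (x - x0) < \<delta>" and v: "v \<in> topspace S" "p M (v - v0) < \<delta>" and t: "\<bar>t\<bar> < \<delta>"
    have pv: "p M v \<le> K - 1"
      using dom.q_triangle[of M "v - v0" v0] v(2) \<delta>(2) by (simp add: K_def)
    have close: "p M (x + s *\<^sub>R v - x0) < m" if s: "\<bar>s\<bar> < \<delta>" for s
    proof -
      have "p M (s *\<^sub>R v) \<le> \<delta> * (K - 1)"
        unfolding dom.q_scale using s pv by (intro mult_mono) auto
      then show ?thesis using dom.q_triangle[of M "x - x0" "s *\<^sub>R v"] x(2) \<delta>(3)
        by (simp add: algebra_simps)
    qed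
    have in_A: "x + s *\<^sub>R v \<in> A" if s: "\<bar>s\<bar> < \<delta>" for s
      using close[OF s] mono(1)[of "x + s *\<^sub>R v - x0"] x v A_carrier by (intro e0(2)) (auto simp: m_def)
    define I where "I = {min 0 t..max 0 t}"
    have I: "is_interval I" "0 \<in> I" "t \<in> I" and I_le: "\<And>s. s \<in> I \<Longrightarrow> \<bar>s\<bar> \<le> \<bar>t\<bar>"
      by (auto simp: I_def is_interval_cc)
    have d2: "q N (d2f (x + s *\<^sub>R v) v - 0) \<le> B" if "s \<in> I" for s
    proof -
      have s: "\<bar>s\<bar> < \<delta>" using I_le[OF that] t by linarith
      show ?thesis
        using B(2)[OF in_A[OF s] v(1)] close[OF s] mono(2)[of "x + s *\<^sub>R v - x0"] v(2) mono(2)[of "v - v0"] \<delta>(4)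
        by (simp add: m_def)
    qed
    have d1: "q N (df (x + s *\<^sub>R v) v - df x v) \<le> \<bar>t\<bar> * B" if s: "s \<in> I" for s
    proof -
      have "q N (df (x + s *\<^sub>R v) v - df (x + 0 *\<^sub>R v) v - (s - 0) *\<^sub>R 0) \<le> \<bar>s - 0\<bar> * B"
      proof (rule cod.mean_value_bound[OF I(1,2) s _ d2])
        fix r assume "r \<in> I"
        then show "cod.has_vderiv (\<lambda>s. df (x + s *\<^sub>R v) v) (d2f (x + r *\<^sub>R v) v) r I"
          using I_le[of r] t by (intro has_vderiv_line in_A v) auto
      qed
      also have "\<dots> \<le> \<bar>t\<bar> * B"
        using I_le[OF s] order_trans[OF cod.q_nonneg d2[OF s]] by (intro mult_right_mono) auto
      finally show ?thesis by simp
    qed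
    have "q N (f (x + t *\<^sub>R v) - f (x + 0 *\<^sub>R v) - (t - 0) *\<^sub>R df x v) \<le> \<bar>t - 0\<bar> * (\<bar>t\<bar> * B)"
    proof (rule cod.mean_value_bound[OF I _ d1])
      fix r assume "r \<in> I"
      then show "cod.has_vderiv (\<lambda>s. f (x + s *\<^sub>R v)) (df (x + r *\<^sub>R v) v) r I"
        using I_le[of r] t by (intro has_vderiv_line in_A v) auto
    qed
    then show "x + t *\<^sub>R v \<in> A \<and> q N (f (x + t *\<^sub>R v) - f x - t *\<^sub>R df x v) \<le> B * t\<^sup>2"
      using in_A[OF t] by (simp add: power2_eq_square mult_ac flip: abs_mult)
  qed
qed

text \<open>For a fixed small t the difference quotient is continuous in point and direction, and
  \<open>difference_quotient_uniform\<close> bounds its distance from \<open>df\<close> on a whole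
  neighbourhood: a uniform limit argument.\<close>

lemma df_continuous:
  assumes x0: "x0 \<in> A" and z: "limitin S z x0 F" and w: "limitin S w v0 F"
  shows "limitin T (\<lambda>i. df (z i) (w i)) (df x0 v0) F"
  unfolding cod.limitin_iff
proof (intro conjI allI)
  have v0: "v0 \<in> topspace S" using w dom.limitin_carrier by blast
  show "df x0 v0 \<in> topspace T" by (rule df_carrier[OF x0 v0])
  have zA: "\<forall>\<^sub>F i in F. z i \<in> A" using z opn x0 by (simp add: limitin_def)
  have wS: "\<forall>\<^sub>F i in F. w i \<in> topspace S" using w dom.limitin_carrier_ev by blast
  show "\<forall>\<^sub>F i in F. df (z i) (w i) \<in> topspace T"
    using zA wS by eventually_elim (rule df_carrier)
  fix N
  obtain M \<delta> B where B: "\<delta> > 0"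
    "\<And>x v t. x \<in> A \<Longrightarrow> v \<in> topspace S \<Longrightarrow> p M (x - x0) < \<delta> \<Longrightarrow> p M (v - v0) < \<delta> \<Longrightarrow> \<bar>t\<bar> < \<delta> \<Longrightarrow>
       x + t *\<^sub>R v \<in> A \<and> q N (f (x + t *\<^sub>R v) - f x - t *\<^sub>R df x v) \<le> B * t\<^sup>2"
    by (rule difference_quotient_uniform[OF x0 v0, where N=N]) (rule that)
  show "((\<lambda>i. q N (df (z i) (w i) - df x0 v0)) \<longlongrightarrow> 0) F"
  proof (rule tendstoI)
    fix e :: real assume e: "e > 0"
    \<comment> \<open>Makes the remainder B t^2 smaller than t e / 4; two remainders and two
      differences of values then add up to less than t e.\<close>
    define t where "t = min (\<delta>/2) (e / (4 * (\<bar>B\<bar> + 1)))"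
    have t: "t > 0" "t < \<delta>" "\<bar>B\<bar> * t < e/4"
    proof -
      show "t > 0" "t < \<delta>" using B(1) e by (auto simp: t_def)
      have "t \<le> e / (4 * (\<bar>B\<bar> + 1))" by (simp add: t_def)
      then have "t * (\<bar>B\<bar> + 1) \<le> e/4" by (simp add: field_simps add_pos_nonneg)
      then show "\<bar>B\<bar> * t < e/4" using \<open>t > 0\<close> by (simp add: algebra_simps)
    qed
    have in_A: "x0 + t *\<^sub>R v0 \<in> A" using B(2)[OF x0 v0, of t] B(1) t by simp
    have "limitin S (\<lambda>i. z i + t *\<^sub>R w i) (x0 + t *\<^sub>R v0) F"
      by (intro dom.limitin_plus dom.limitin_scale tendsto_const z w)
    from cod.limitin_small[OF continuous[OF in_A this], of "t * e/4" N]
    have c1: "\<forall>\<^sub>F i in F. q N (f (z i + t *\<^sub>R w i) - f (x0 + t *\<^sub>R v0)) < t * e/4" using t e by simp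
    have c2: "\<forall>\<^sub>F i in F. q N (f (z i) - f x0) < t * e/4"
      using cod.limitin_small[OF continuous[OF x0 z], of "t * e/4" N] t e by simp
    have c3: "\<forall>\<^sub>F i in F. p M (z i - x0) < \<delta>" "\<forall>\<^sub>F i in F. p M (w i - v0) < \<delta>"
      using dom.limitin_small[OF z B(1)] dom.limitin_small[OF w B(1)] by auto
    from c1 c2 c3 zA wS show "\<forall>\<^sub>F i in F. dist (q N (df (z i) (w i) - df x0 v0)) 0 < e"
    proof eventually_elim
      case (elim i)
      define R where "R = (\<lambda>x v. f (x + t *\<^sub>R v) - f x - t *\<^sub>R df x v)"
      have Bt: "B * t\<^sup>2 < t * e/4"
      proof -
        have "B * t\<^sup>2 \<le> (\<bar>B\<bar> * t) * t" using t(1) by (simp add: power2_eq_square mult_right_mono)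
        also have "\<dots> < (e/4) * t" using t by (intro mult_strict_right_mono)
        finally show ?thesis by (simp add: mult.commute)
      qed
      have R1: "q N (R (z i) (w i)) < t * e/4" using B(2)[of "z i" "w i" t] elim t Bt by (simp add: R_def)
      have R2: "q N (R x0 v0) < t * e/4" using B(2)[OF x0 v0, of t] B(1) t Bt by (simp add: R_def)
      have "t *\<^sub>R (df (z i) (w i) - df x0 v0) =
        (f (z i + t *\<^sub>R w i) - f (x0 + t *\<^sub>R v0)) - (f (z i) - f x0) - (R (z i) (w i) - R x0 v0)"
        by (simp add: R_def algebra_simps)
      then have "q N (t *\<^sub>R (df (z i) (w i) - df x0 v0)) \<le> q N (f (z i + t *\<^sub>R w i) - f (x0 + t *\<^sub>R v0))
         + q N (f (z i) - f x0) + (q N (R (z i) (w i)) + q N (R x0 v0))"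
        using cod.q_diff_le[of N "(f (z i + t *\<^sub>R w i) - f (x0 + t *\<^sub>R v0)) - (f (z i) - f x0)" "R (z i) (w i) - R x0 v0"]
          cod.q_diff_le[of N "f (z i + t *\<^sub>R w i) - f (x0 + t *\<^sub>R v0)" "f (z i) - f x0"]
          cod.q_diff_le[of N "R (z i) (w i)" "R x0 v0"] by simp
      also have "\<dots> < t * e" using R1 R2 elim by simp
      finally show ?case using t(1) by (simp add: cod.q_scale)
    qed
  qed
qed

text \<open>With countably many increasing seminorms, a failure in every neighbourhood yields a
  convergent sequence to which \<open>df_continuous\<close> applies.\<close>

lemma df_continuous_bound:
  assumes x0: "x0 \<in> A" and v0: "v0 \<in> topspace S" and e: "e > 0"
  obtains M \<delta> where "\<delta> > 0"
    "\<And>x. x \<in> topspace S \<Longrightarrow> p M (x - x0) < \<delta> \<Longrightarrow> x \<in> A"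
    "\<And>x v. x \<in> topspace S \<Longrightarrow> v \<in> topspace S \<Longrightarrow> p M (x - x0) < \<delta> \<Longrightarrow> p M (v - v0) < \<delta> \<Longrightarrow>
       q N (df x v - df x0 v0) < e"
proof (rule ccontr)
  assume neg: "\<not> thesis"
  obtain M0 e0 where e0: "e0 > 0" "\<And>y. y \<in> topspace S \<Longrightarrow> p M0 (y - x0) < e0 \<Longrightarrow> y \<in> A"
    using dom.openin_ballE[OF opn x0] by blast
  have "\<exists>x v. x \<in> topspace S \<and> v \<in> topspace S \<and> p (max n M0) (x - x0) < min e0 (inverse (Suc n)) \<and>
     p (max n M0) (v - v0) < min e0 (inverse (Suc n)) \<and> \<not> q N (df x v - df x0 v0) < e" for n
  proof (rule ccontr)
    assume *: "\<not> ?thesis"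
    show False
    proof (rule neg[THEN notE], rule that[of "min e0 (inverse (Suc n))" "max n M0"])
      show "min e0 (inverse (Suc n)) > 0" using e0(1) by simp
      fix x assume "x \<in> topspace S" "p (max n M0) (x - x0) < min e0 (inverse (Suc n))"
      then show "x \<in> A" using dom.q_mono[of M0 "max n M0" "x - x0"] by (intro e0(2)) auto
    qed (use * in blast)
  qed
  then obtain x v where xv: "\<And>n. x n \<in> topspace S" "\<And>n. v n \<in> topspace S"
    "\<And>n. p (max n M0) (x n - x0) < min e0 (inverse (Suc n))"
    "\<And>n. p (max n M0) (v n - v0) < min e0 (inverse (Suc n))" "\<And>n. \<not> q N (df (x n) (v n) - df x0 v0) < e"
    by metis
  have L: "limitin S y y0 sequentially"
    if "y0 \<in> topspace S" "\<And>n. y n \<in> topspace S" "\<And>n. p (max n M0) (y n - y0) < min e0 (inverse (Suc n))" for y y0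
  proof (rule dom.limitinI_le)
    show "\<forall>\<^sub>F n in sequentially. p k (y n - y0) \<le> inverse (Suc n)" for k
      using eventually_ge_at_top[of k]
    proof eventually_elim
      case (elim n)
      then have "p k (y n - y0) \<le> p (max n M0) (y n - y0)" by (intro dom.q_mono) simp
      moreover have "p (max n M0) (y n - y0) < inverse (Suc n)" using that(3)[of n] by (simp only: min_less_iff_conj)
      ultimately show ?case by linarith
    qed
  qed (use that LIMSEQ_inverse_real_of_nat in auto)
  have "limitin T (\<lambda>n. df (x n) (v n)) (df x0 v0) sequentially"
    by (intro df_continuous x0 L v0 A_carrier xv)
  from cod.limitin_small[OF this e, of N] have "\<forall>\<^sub>F n in sequentially. False"
    using xv(5) by simp
  then show False by simp
qed

text \<open>The mean value inequality on the segment starting at \<open>z i\<close>, compared with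
  the constant slope \<open>df x0 v\<close>. Letting the base point move gives additivity of the
  differential; letting the direction move gives derivatives of compositions.\<close>

lemma chain_rule:
  assumes x0: "x0 \<in> A" and z: "limitin S z x0 F" and w: "limitin S w v F"
    and r: "(r \<longlongrightarrow> 0) F" "\<forall>\<^sub>F i in F. r i \<noteq> 0"
  shows "limitin T (\<lambda>i. (f (z i + r i *\<^sub>R w i) - f (z i)) /\<^sub>R r i) (df x0 v) F"
  unfolding cod.limitin_iff
proof (intro conjI allI)
  have v: "v \<in> topspace S" using w dom.limitin_carrier by blast
  show "df x0 v \<in> topspace T" by (rule df_carrier[OF x0 v])
  have zA: "\<forall>\<^sub>F i in F. z i \<in> A" using z opn x0 by (simp add: limitin_def)
  have wS: "\<forall>\<^sub>F i in F. w i \<in> topspace S" using w dom.limitin_carrier_ev by blast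
  have "limitin S (\<lambda>i. z i + r i *\<^sub>R w i) (x0 + 0 *\<^sub>R v) F"
    by (intro dom.limitin_plus dom.limitin_scale z w r)
  then have zrA: "\<forall>\<^sub>F i in F. z i + r i *\<^sub>R w i \<in> A" using opn x0 by (simp add: limitin_def)
  show "\<forall>\<^sub>F i in F. (f (z i + r i *\<^sub>R w i) - f (z i)) /\<^sub>R r i \<in> topspace T"
    using zA zrA by eventually_elim (intro cod.carrier_scale cod.carrier_diff f_carrier)
  fix N
  show "((\<lambda>i. q N ((f (z i + r i *\<^sub>R w i) - f (z i)) /\<^sub>R r i - df x0 v)) \<longlongrightarrow> 0) F"
  proof (rule tendstoI)
    fix e :: real assume e: "e > 0"
    then obtain M \<delta> where M: "\<delta> > 0"
      "\<And>x. x \<in> topspace S \<Longrightarrow> p M (x - x0) < \<delta> \<Longrightarrow> x \<in> A"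
      "\<And>x u. x \<in> topspace S \<Longrightarrow> u \<in> topspace S \<Longrightarrow> p M (x - x0) < \<delta> \<Longrightarrow> p M (u - v) < \<delta> \<Longrightarrow>
         q N (df x u - df x0 v) < e/2"
      using df_continuous_bound[OF x0 v, of "e/2"] by (metis half_gt_zero)
    have c1: "\<forall>\<^sub>F i in F. p M (z i - x0) < \<delta>/2" using dom.limitin_small[OF z, of "\<delta>/2"] M(1) by simp
    have c2: "\<forall>\<^sub>F i in F. p M (w i - v) < \<delta>" using dom.limitin_small[OF w M(1)] .
    have "limitin S (\<lambda>i. r i *\<^sub>R w i) (0 *\<^sub>R v) F"
      by (intro dom.limitin_scale w r)
    then have c3: "\<forall>\<^sub>F i in F. p M (r i *\<^sub>R w i) < \<delta>/2"
      using dom.limitin_small[of "\<lambda>i. r i *\<^sub>R w i" 0 F "\<delta>/2" M] M(1) by simp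
    from c1 c2 c3 r(2) zA wS
    show "\<forall>\<^sub>F i in F. dist (q N ((f (z i + r i *\<^sub>R w i) - f (z i)) /\<^sub>R r i - df x0 v)) 0 < e"
    proof eventually_elim
      case (elim i)
      define I where "I = {min 0 (r i)..max 0 (r i)}"
      have I: "is_interval I" "0 \<in> I" "r i \<in> I" and I_le: "\<And>s. s \<in> I \<Longrightarrow> \<bar>s\<bar> \<le> \<bar>r i\<bar>"
        by (auto simp: I_def is_interval_cc)
      have close: "p M (z i + s *\<^sub>R w i - x0) < \<delta>" if "s \<in> I" for s
      proof -
        have "p M (s *\<^sub>R w i) \<le> p M (r i *\<^sub>R w i)"
          unfolding dom.q_scale using I_le[OF that] by (intro mult_right_mono) auto
        then show ?thesis using dom.q_triangle[of M "z i - x0" "s *\<^sub>R w i"] elim by (simp add: algebra_simps)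
      qed
      have in_S: "z i + s *\<^sub>R w i \<in> topspace S" for s using elim A_carrier by auto
      have "q N (f (z i + r i *\<^sub>R w i) - f (z i + 0 *\<^sub>R w i) - (r i - 0) *\<^sub>R df x0 v) \<le> \<bar>r i - 0\<bar> * (e/2)"
      proof (rule cod.mean_value_bound[OF I])
        fix s assume s: "s \<in> I"
        show "cod.has_vderiv (\<lambda>s. f (z i + s *\<^sub>R w i)) (df (z i + s *\<^sub>R w i) (w i)) s I"
          using M(2)[OF in_S close[OF s]] elim by (intro has_vderiv_line)
        show "q N (df (z i + s *\<^sub>R w i) (w i) - df x0 v) \<le> e/2"
          using M(3)[OF in_S _ close[OF s]] elim by (intro less_imp_le) auto
      qed
      then have "q N (f (z i + r i *\<^sub>R w i) - f (z i) - r i *\<^sub>R df x0 v) \<le> \<bar>r i\<bar> * (e/2)" by simp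
      moreover have "(f (z i + r i *\<^sub>R w i) - f (z i)) /\<^sub>R r i - df x0 v =
         (f (z i + r i *\<^sub>R w i) - f (z i) - r i *\<^sub>R df x0 v) /\<^sub>R r i"
        using elim by (simp add: scaleR_diff_right)
      ultimately have "q N ((f (z i + r i *\<^sub>R w i) - f (z i)) /\<^sub>R r i - df x0 v) \<le> e/2"
        using elim by (simp add: cod.q_scale divide_inverse[symmetric] mult.commute[of "inverse _"] pos_divide_le_eq del: times_divide_eq_right) (simp add: mult.commute)
      then show ?case using e by simp
    qed
  qed
qed

text \<open>The increment along v + w is an increment along \<open>v\<close> followed by one along
  \<open>w\<close> from the moving point x + h v.\<close>

lemma df_add:
  assumes x: "x \<in> A" and v: "v \<in> topspace S" "w \<in> topspace S"
  shows "df x (v + w) = df x v + df x w"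
proof (rule df_unique)
  have xS: "x \<in> topspace S" by (rule A_carrier[OF x])
  have id: "((\<lambda>h. h) \<longlongrightarrow> 0) (at (0::real))" by simp
  have ne: "\<forall>\<^sub>F h in at (0::real). h \<noteq> 0" by (simp add: eventually_at_filter)
  have "limitin S (\<lambda>h. x + h *\<^sub>R v) (x + 0 *\<^sub>R v) (at 0)"
    by (intro dom.limitin_plus dom.limitin_scale dom.limitin_konst xS v id)
  then have "limitin S (\<lambda>h. x + h *\<^sub>R v) x (at 0)" by simp
  from cod.limitin_plus[OF df_d2f_limits(1)[OF x v(1)] chain_rule[OF x this dom.limitin_konst[OF v(2)] id ne]]
  have "limitin T (\<lambda>h. (f (x + h *\<^sub>R v) - f x) /\<^sub>R h +
     (f (x + h *\<^sub>R v + h *\<^sub>R w) - f (x + h *\<^sub>R v)) /\<^sub>R h) (df x v + df x w) (at 0)" .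
  then show "limitin T (\<lambda>h. (f (x + h *\<^sub>R (v + w)) - f x) /\<^sub>R h) (df x v + df x w) (at 0)"
    by (simp add: algebra_simps)
qed

lemma df_sum:
  assumes x: "x \<in> A" and v: "\<And>i. i \<in> B \<Longrightarrow> v i \<in> topspace S"
  shows "df x (\<Sum>i\<in>B. v i) = (\<Sum>i\<in>B. df x (v i))"
  using v
proof (induction B rule: infinite_finite_induct)
  case (insert i B)
  then show ?case by (simp add: df_add[OF x] dom.carrier_sum)
qed (use df_scale[OF x dom.carrier_0, of 0] in simp_all)

end

section \<open>Frechet spaces, products and continuous functionals\<close>

lemma frechet_spaceE:
  fixes T :: "'a::real_vector topology"
  assumes "frechet_space T"
  obtains p :: "nat \<Rightarrow> 'a \<Rightarrow> real" where "subspace (topspace T)"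
    "\<And>k. seminorm_on (topspace T) (p k)"
    "\<And>x. x \<in> topspace T \<Longrightarrow> (\<forall>k. p k x = 0) \<Longrightarrow> x = 0"
    "\<And>G. openin T G \<longleftrightarrow> G \<subseteq> topspace T \<and>
       (\<forall>x\<in>G. \<exists>N. \<exists>e>0. \<forall>y\<in>topspace T. (\<forall>k\<le>N. p k (y - x) < e) \<longrightarrow> y \<in> G)"
    "\<And>s :: nat \<Rightarrow> 'a. range s \<subseteq> topspace T \<Longrightarrow>
       (\<forall>k. \<forall>e>0. \<exists>M. \<forall>i\<ge>M. \<forall>j\<ge>M. p k (s i - s j) < e) \<Longrightarrow>
       (\<exists>x\<in>topspace T. \<forall>k. (\<lambda>i. p k (s i - x)) \<longlonglongrightarrow> 0)"
proof -
  from conjunct2[OF assms[unfolded frechet_space_def]] obtain p :: "nat \<Rightarrow> 'a \<Rightarrow> real" where P: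
    "(\<forall>k. seminorm_on (topspace T) (p k)) \<and> (\<forall>x\<in>topspace T. (\<forall>k. p k x = 0) \<longrightarrow> x = 0) \<and>
     (\<forall>G. openin T G \<longleftrightarrow> G \<subseteq> topspace T \<and>
       (\<forall>x\<in>G. \<exists>N. \<exists>e>0. \<forall>y\<in>topspace T. (\<forall>k\<le>N. p k (y - x) < e) \<longrightarrow> y \<in> G)) \<and>
     (\<forall>s :: nat \<Rightarrow> 'a. range s \<subseteq> topspace T \<and>
       (\<forall>k. \<forall>e>0. \<exists>M. \<forall>i\<ge>M. \<forall>j\<ge>M. p k (s i - s j) < e) \<longrightarrow>
       (\<exists>x\<in>topspace T. \<forall>k. (\<lambda>i. p k (s i - x)) \<longlonglongrightarrow> 0))" by (rule exE)
  show ?thesis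
  proof (rule that[of p])
    show "subspace (topspace T)" using assms[unfolded frechet_space_def] by (rule conjunct1)
    show "seminorm_on (topspace T) (p k)" for k using conjunct1[OF P] by (rule spec)
    show "x = 0" if "x \<in> topspace T" "\<forall>k. p k x = 0" for x
      using conjunct1[OF conjunct2[OF P]] that by blast
    show "openin T G \<longleftrightarrow> G \<subseteq> topspace T \<and>
       (\<forall>x\<in>G. \<exists>N. \<exists>e>0. \<forall>y\<in>topspace T. (\<forall>k\<le>N. p k (y - x) < e) \<longrightarrow> y \<in> G)" for G
      using conjunct1[OF conjunct2[OF conjunct2[OF P]]] by (rule spec)
    show "\<exists>x\<in>topspace T. \<forall>k. (\<lambda>i. p k (s i - x)) \<longlonglongrightarrow> 0"
      if "range s \<subseteq> topspace T" "\<forall>k. \<forall>e>0. \<exists>M. \<forall>i\<ge>M. \<forall>j\<ge>M. p k (s i - s j) < e" for s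
      by (rule conjunct2[OF conjunct2[OF conjunct2[OF P]], THEN spec, THEN mp, OF conjI]) fact+
  qed
qed

text \<open>The given seminorms behave well only on the carrier, so they are composed with a linear
  projection of the whole type onto it; partial sums make them increasing.\<close>

lemma frechet_space_seminormed:
  assumes "frechet_space T"
  obtains q where "seminormed_space T q"
proof -
  obtain p :: "nat \<Rightarrow> 'a \<Rightarrow> real" where sub: "subspace (topspace T)"
    and p: "\<And>k. seminorm_on (topspace T) (p k)"
    and sep: "\<And>x. x \<in> topspace T \<Longrightarrow> (\<forall>k. p k x = 0) \<Longrightarrow> x = 0"
    and op: "\<And>G. openin T G \<longleftrightarrow> G \<subseteq> topspace T \<and>
       (\<forall>x\<in>G. \<exists>N. \<exists>e>0. \<forall>y\<in>topspace T. (\<forall>k\<le>N. p k (y - x) < e) \<longrightarrow> y \<in> G)"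
    by (rule frechet_spaceE[OF assms]) (rule that)
  have "linear (\<lambda>x::'a. x)" by (rule linear_ident)
  then obtain g where g: "range g \<subseteq> topspace T" "linear g" "\<And>x. x \<in> topspace T \<Longrightarrow> g x = x"
    using linear_exists_left_inverse_on[OF _ sub, of "\<lambda>x. x"] by (auto simp: inj_on_def)
  then have gT: "g x \<in> topspace T" for x by auto
  have p_nonneg: "0 \<le> p k (g x)" and p_add: "p k (g (x + y)) \<le> p k (g x) + p k (g y)"
    and p_scale: "p k (g (a *\<^sub>R x)) = \<bar>a\<bar> * p k (g x)" for k a x y
    using p[of k] gT by (auto simp: seminorm_on_def linear_add[OF g(2)] linear_scale[OF g(2)])
  define q where "q = (\<lambda>k x. \<Sum>j\<le>k. p j (g x))"
  have single: "p j (g x) \<le> q k x" if "j \<le> k" for j k x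
    unfolding q_def using that p_nonneg by (intro member_le_sum) auto
  have "seminormed_space T q"
  proof
    show "subspace (topspace T)" by (rule sub)
    show "q k (x + y) \<le> q k x + q k y" for k x y
      unfolding q_def sum.distrib[symmetric] by (intro sum_mono p_add)
    show "q k (a *\<^sub>R x) = \<bar>a\<bar> * q k x" for k a x
      unfolding q_def sum_distrib_left by (intro sum.cong refl p_scale)
    show "q k x \<le> q l x" if "k \<le> l" for k l x
      unfolding q_def using that p_nonneg by (intro sum_mono2) auto
    show "x = 0" if x: "x \<in> topspace T" "\<And>k. q k x = 0" for x
    proof (rule sep[OF x(1)], intro allI)
      show "p k x = 0" for k
        using single[of k k x] p_nonneg[of k x] x g(3) by simp
    qed
    fix G
    show "openin T G \<longleftrightarrow> G \<subseteq> topspace T \<and>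
      (\<forall>x\<in>G. \<exists>N. \<exists>e>0. \<forall>y\<in>topspace T. q N (y - x) < e \<longrightarrow> y \<in> G)"
    proof (cases "G \<subseteq> topspace T")
      case True
      have eq: "(\<exists>N. \<exists>e>0. \<forall>y\<in>topspace T. (\<forall>k\<le>N. p k (y - x) < e) \<longrightarrow> y \<in> G) \<longleftrightarrow>
        (\<exists>N. \<exists>e>0. \<forall>y\<in>topspace T. q N (y - x) < e \<longrightarrow> y \<in> G)" (is "?L \<longleftrightarrow> ?R") if "x \<in> G" for x
      proof
        assume ?L
        then obtain N e where e: "e > 0" "\<And>y. y \<in> topspace T \<Longrightarrow> (\<And>k. k \<le> N \<Longrightarrow> p k (y - x) < e) \<Longrightarrow> y \<in> G"
          by blast
        have "y \<in> G" if "y \<in> topspace T" "q N (y - x) < e" for y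
        proof (rule e(2)[OF that(1)])
          fix k assume "k \<le> N"
          have "g (y - x) = y - x"
            using that(1) \<open>x \<in> G\<close> True by (intro g(3) subspace_diff[OF sub]) auto
          then show "p k (y - x) < e" using single[OF \<open>k \<le> N\<close>, of "y - x"] that(2) by simp
        qed
        then show ?R using e(1) by blast
      next
        assume ?R
        then obtain N e where e: "e > 0" "\<And>y. y \<in> topspace T \<Longrightarrow> q N (y - x) < e \<Longrightarrow> y \<in> G"
          by blast
        \<comment> \<open>The sum defining \<open>q N\<close> has N + 1 terms.\<close>
        have "y \<in> G" if y: "y \<in> topspace T" "\<forall>k\<le>N. p k (y - x) < e / (N + 1)" for y
        proof (rule e(2)[OF y(1)])
          have "g (y - x) = y - x"
            using y(1) \<open>x \<in> G\<close> True by (intro g(3) subspace_diff[OF sub]) auto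
          then have "q N (y - x) < (\<Sum>j\<le>N. e / (N + 1))"
            unfolding q_def using y(2) by (intro sum_strict_mono) auto
          also have "\<dots> = e" by (simp add: field_simps)
          finally show "q N (y - x) < e" .
        qed
        moreover have "e / (N + 1) > 0" using e(1) by simp
        ultimately show ?L by blast
      qed
      show ?thesis unfolding op using eq by blast
    next
      case False
      then show ?thesis unfolding op by blast
    qed
  qed
  then show ?thesis using that by blast
qed

text \<open>A closed complement of \<open>D x0\<close> becomes the parameter space of a chart.
  Closedness is what keeps limits of Cauchy sequences inside.\<close>

lemma frechet_space_closed_subspace:
  assumes "frechet_space T" "subspace K" "closedin T K"
  shows "frechet_space (subtopology T K)"
proof -
  obtain p :: "nat \<Rightarrow> 'a \<Rightarrow> real" where sub: "subspace (topspace T)"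
    and p: "\<And>k. seminorm_on (topspace T) (p k)"
    and sep: "\<And>x. x \<in> topspace T \<Longrightarrow> (\<forall>k. p k x = 0) \<Longrightarrow> x = 0"
    and op: "\<And>G. openin T G \<longleftrightarrow> G \<subseteq> topspace T \<and>
       (\<forall>x\<in>G. \<exists>N. \<exists>e>0. \<forall>y\<in>topspace T. (\<forall>k\<le>N. p k (y - x) < e) \<longrightarrow> y \<in> G)"
    and comp: "\<And>s :: nat \<Rightarrow> 'a. range s \<subseteq> topspace T \<Longrightarrow>
       (\<forall>k. \<forall>e>0. \<exists>M. \<forall>i\<ge>M. \<forall>j\<ge>M. p k (s i - s j) < e) \<Longrightarrow>
       (\<exists>x\<in>topspace T. \<forall>k. (\<lambda>i. p k (s i - x)) \<longlonglongrightarrow> 0)"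
    by (rule frechet_spaceE[OF assms(1)]) (rule that)
  have KT: "K \<subseteq> topspace T" using assms(3) closedin_subset by blast
  then have top: "topspace (subtopology T K) = K" by auto
  have ball: "openin T {y \<in> topspace T. \<forall>k\<le>N. p k (y - x) < e}" if x: "x \<in> topspace T" for x N e
    unfolding op
  proof (intro conjI ballI)
    fix y assume y: "y \<in> {y \<in> topspace T. \<forall>k\<le>N. p k (y - x) < e}"
    define d where "d = Min ((\<lambda>k. e - p k (y - x)) ` {..N})"
    have "d > 0" unfolding d_def using y by (subst Min_gr_iff) auto
    moreover have "z \<in> {y \<in> topspace T. \<forall>k\<le>N. p k (y - x) < e}"
      if z: "z \<in> topspace T" "\<forall>k\<le>N. p k (z - y) < d" for z
    proof -
      have "p k (z - x) < e" if k: "k \<le> N" for k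
      proof -
        have "p k ((z - y) + (y - x)) \<le> p k (z - y) + p k (y - x)"
          by (rule p[of k, unfolded seminorm_on_def, THEN conjunct2, THEN conjunct1, rule_format])
            (use x y z(1) in \<open>simp_all add: subspace_diff[OF sub]\<close>)
        moreover have "d \<le> e - p k (y - x)" unfolding d_def using k by (intro Min_le) auto
        moreover have "p k (z - y) < d" using z(2) k by simp
        moreover have "z - y + (y - x) = z - x" by simp
        ultimately show ?thesis by simp
      qed
      then show ?thesis using z(1) by simp
    qed
    ultimately show "\<exists>N'. \<exists>d>0. \<forall>z\<in>topspace T. (\<forall>k\<le>N'. p k (z - y) < d) \<longrightarrow>
      z \<in> {y \<in> topspace T. \<forall>k\<le>N. p k (y - x) < e}" by blast
  qed auto
  show ?thesis unfolding frechet_space_def top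
  proof (intro conjI exI[of _ p] allI ballI impI)
    show "subspace K" by (rule assms(2))
    show "seminorm_on K (p k)" for k
      using p[of k] KT unfolding seminorm_on_def by blast
    show "x = 0" if "x \<in> K" "\<forall>k. p k x = 0" for x
      using sep that KT by blast
    show "openin (subtopology T K) G \<longleftrightarrow> G \<subseteq> K \<and>
       (\<forall>x\<in>G. \<exists>N. \<exists>e>0. \<forall>y\<in>K. (\<forall>k\<le>N. p k (y - x) < e) \<longrightarrow> y \<in> G)" (is "?L \<longleftrightarrow> ?R") for G
    proof
      assume ?L
      then obtain G' where G': "openin T G'" "G = G' \<inter> K" by (auto simp: openin_subtopology)
      then show ?R using op[of G'] KT by (auto, meson subsetD)
    next
      assume R: ?R
      \<comment> \<open>The largest open set whose trace lies in \<open>G\<close>; taking the union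
        of all such sets avoids a choice of radii.\<close>
      define G' where "G' = \<Union>{B. openin T B \<and> B \<inter> K \<subseteq> G}"
      have "x \<in> G'" if x: "x \<in> G" for x
      proof -
        obtain N e where e: "e > 0" "\<And>y. y \<in> K \<Longrightarrow> (\<forall>k\<le>N. p k (y - x) < e) \<Longrightarrow> y \<in> G"
          using R x by blast
        have xT: "x \<in> topspace T" using x R KT by blast
        then have "p k (x - x) = 0" for k
          using p[of k] unfolding seminorm_on_def by (metis abs_zero mult_zero_left scaleR_zero_left diff_self)
        then have "x \<in> {y \<in> topspace T. \<forall>k\<le>N. p k (y - x) < e}" using xT e(1) by simp
        then show ?thesis unfolding G'_def using ball[OF xT, of N e] e(2) by blast
      qed
      moreover have "openin T G'" unfolding G'_def by (intro openin_Union) auto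
      ultimately have "openin T G'" "G = G' \<inter> K" using R by (auto simp: G'_def)
      then show ?L unfolding openin_subtopology by blast
    qed
    fix s :: "nat \<Rightarrow> 'a"
    assume s: "range s \<subseteq> K \<and> (\<forall>k. \<forall>e>0. \<exists>M. \<forall>i\<ge>M. \<forall>j\<ge>M. p k (s i - s j) < e)"
    then obtain x where x: "x \<in> topspace T" "\<And>k. (\<lambda>i. p k (s i - x)) \<longlonglongrightarrow> 0"
      using comp[of s] KT by blast
    have "x \<in> K"
    proof (rule ccontr)
      assume "x \<notin> K"
      then have "x \<in> topspace T - K" using x by simp
      moreover have "openin T (topspace T - K)" using assms(3) by (simp add: closedin_def)
      ultimately obtain N e where e: "e > 0"
        "\<And>y. y \<in> topspace T \<Longrightarrow> (\<forall>k\<le>N. p k (y - x) < e) \<Longrightarrow> y \<in> topspace T - K"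
        unfolding op by blast
      have "\<forall>k\<in>{..N}. \<forall>\<^sub>F i in sequentially. p k (s i - x) < e"
        using order_tendstoD(2)[OF x(2) e(1)] by blast
      then have "\<forall>\<^sub>F i in sequentially. \<forall>k\<in>{..N}. p k (s i - x) < e"
        by (intro eventually_ball_finite) auto
      then obtain i where "\<forall>k\<in>{..N}. p k (s i - x) < e"
        using eventually_happens trivial_limit_sequentially by blast
      moreover have "s i \<in> K" using s by auto
      ultimately have "s i \<in> topspace T - K" using KT by (intro e(2)) auto
      then show False using \<open>s i \<in> K\<close> by blast
    qed
    then show "\<exists>x\<in>K. \<forall>k. (\<lambda>i. p k (s i - x)) \<longlonglongrightarrow> 0" using x by blast
  qed
qed

section \<open>Products with the time axis, continuous functionals, dual bases\<close>

context seminormed_space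
begin

lemma seminormed_space_prod_real:
  "seminormed_space (prod_topology euclideanreal T) (\<lambda>k z. \<bar>fst z\<bar> + q k (snd z))"
proof
  show "subspace (topspace (prod_topology euclideanreal T))"
    by (auto simp: subspace_def zero_prod_def)
  show "\<bar>fst (x + y)\<bar> + q k (snd (x + y)) \<le> \<bar>fst x\<bar> + q k (snd x) + (\<bar>fst y\<bar> + q k (snd y))" for k x y
    using q_triangle[of k "snd x" "snd y"] abs_triangle_ineq[of "fst x" "fst y"] by simp
  show "\<bar>fst (a *\<^sub>R x)\<bar> + q k (snd (a *\<^sub>R x)) = \<bar>a\<bar> * (\<bar>fst x\<bar> + q k (snd x))" for k a x
    by (simp add: q_scale abs_mult distrib_left)
  show "\<bar>fst x\<bar> + q k (snd x) \<le> \<bar>fst x\<bar> + q l (snd x)" if "k \<le> l" for k l x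
    using q_mono[OF that] by simp
  show "x = 0" if x: "x \<in> topspace (prod_topology euclideanreal T)" "\<And>k. \<bar>fst x\<bar> + q k (snd x) = 0" for x
  proof -
    have "\<bar>fst x\<bar> = 0 \<and> q k (snd x) = 0" for k using x(2)[of k] q_nonneg[of k "snd x"] by linarith
    then show ?thesis using q_separates[of "snd x"] x(1) by (auto simp: prod_eq_iff)
  qed
  fix G :: "(real \<times> 'a) set"
  show "openin (prod_topology euclideanreal T) G \<longleftrightarrow> G \<subseteq> topspace (prod_topology euclideanreal T) \<and>
    (\<forall>x\<in>G. \<exists>N. \<exists>e>0. \<forall>y\<in>topspace (prod_topology euclideanreal T).
       \<bar>fst (y - x)\<bar> + q N (snd (y - x)) < e \<longrightarrow> y \<in> G)" (is "?L \<longleftrightarrow> ?R")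
  proof
    assume L: ?L
    have "\<exists>N. \<exists>e>0. \<forall>y\<in>topspace (prod_topology euclideanreal T).
       \<bar>fst (y - x)\<bar> + q N (snd (y - x)) < e \<longrightarrow> y \<in> G" if "x \<in> G" for x
    proof -
      obtain U V where UV: "open U" "openin T V" "fst x \<in> U" "snd x \<in> V" "U \<times> V \<subseteq> G"
        using L[unfolded openin_prod_topology_alt, rule_format, of "fst x" "snd x"] \<open>x \<in> G\<close>
        by (auto simp flip: open_openin)
      obtain e1 where e1: "e1 > 0" "\<And>s. dist s (fst x) < e1 \<Longrightarrow> s \<in> U"
        using UV(1,3) open_dist by blast
      obtain N e2 where e2: "e2 > 0" "\<And>y. y \<in> topspace T \<Longrightarrow> q N (y - snd x) < e2 \<Longrightarrow> y \<in> V"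
        using openin_ballE[OF UV(2,4)] by metis
      have "y \<in> G" if y: "y \<in> topspace (prod_topology euclideanreal T)"
        "\<bar>fst (y - x)\<bar> + q N (snd (y - x)) < min e1 e2" for y
      proof -
        have "\<bar>fst y - fst x\<bar> < e1" "q N (snd y - snd x) < e2"
          using y(2) q_nonneg[of N "snd (y - x)"] by (simp_all only: fst_diff snd_diff min_less_iff_conj) linarith+
        then have "y \<in> U \<times> V" using y(1) e1(2)[of "fst y"] e2(2)[of "snd y"]
          by (auto simp: dist_real_def mem_Times_iff)
        then show ?thesis using UV(5) by blast
      qed
      then show ?thesis using e1(1) e2(1) by (intro exI[of _ N] exI[of _ "min e1 e2"]) auto
    qed
    then show ?R using openin_subset[OF L] by blast
  next
    assume R: ?R
    show ?L unfolding openin_prod_topology_alt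
    proof (intro allI impI)
      fix a b assume ab: "(a, b) \<in> G"
      then obtain N e where e: "e > 0" "\<And>y. y \<in> topspace (prod_topology euclideanreal T) \<Longrightarrow>
        \<bar>fst (y - (a, b))\<bar> + q N (snd (y - (a, b))) < e \<Longrightarrow> y \<in> G" using R by blast
      have b: "b \<in> topspace T" using R ab by auto
      have "ball a (e/2) \<times> {y \<in> topspace T. q N (y - b) < e/2} \<subseteq> G"
        by (auto intro!: e(2) simp: dist_real_def abs_minus_commute)
      moreover have "openin euclideanreal (ball a (e/2))" by (simp flip: open_openin)
      ultimately show "\<exists>U V. openin euclideanreal U \<and> openin T V \<and> a \<in> U \<and> b \<in> V \<and> U \<times> V \<subseteq> G"
        using openin_ball[OF b, of N "e/2"] b e(1)
        by (intro exI[of _ "ball a (e/2)"] exI[of _ "{y \<in> topspace T. q N (y - b) < e/2}"]) auto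
    qed
  qed
qed

text \<open>Since the seminorms increase, domination by a multiple of a single one expresses
  continuity.\<close>

definition cont_functional :: "('a \<Rightarrow> real) \<Rightarrow> bool" where
  "cont_functional l \<longleftrightarrow> linear l \<and> (\<exists>C k. \<forall>x. \<bar>l x\<bar> \<le> C * q k x)"

lemma cont_functional_linear: "cont_functional l \<Longrightarrow> linear l"
  by (simp add: cont_functional_def)

lemma cont_functional_scale:
  assumes "cont_functional l"
  shows "cont_functional (\<lambda>x. a * l x)"
proof -
  obtain C k where C: "\<And>x. \<bar>l x\<bar> \<le> C * q k x" "linear l" using assms by (auto simp: cont_functional_def)
  have "\<bar>a * l x\<bar> \<le> (\<bar>a\<bar> * C) * q k x" for x
    using mult_left_mono[OF C(1), of "\<bar>a\<bar>" x] by (simp add: abs_mult mult.assoc)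
  moreover have "linear (\<lambda>x. a * l x)"
    by (rule linearI) (simp_all add: linear_add[OF C(2)] linear_scale[OF C(2)] algebra_simps)
  ultimately show ?thesis unfolding cont_functional_def by blast
qed

lemma cont_functional_add:
  assumes "cont_functional l" "cont_functional m"
  shows "cont_functional (\<lambda>x. l x + m x)"
proof -
  obtain C k where C: "\<And>x. \<bar>l x\<bar> \<le> C * q k x" "linear l" using assms(1) by (auto simp: cont_functional_def)
  obtain C' k' where C': "\<And>x. \<bar>m x\<bar> \<le> C' * q k' x" "linear m" using assms(2) by (auto simp: cont_functional_def)
  have "\<bar>l x + m x\<bar> \<le> (\<bar>C\<bar> + \<bar>C'\<bar>) * q (max k k') x" for x
  proof -
    have "C * q k x \<le> \<bar>C\<bar> * q (max k k') x" "C' * q k' x \<le> \<bar>C'\<bar> * q (max k k') x"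
      by (intro mult_mono q_mono q_nonneg; simp)+
    then show ?thesis
      using C(1)[of x] C'(1)[of x] abs_triangle_ineq[of "l x" "m x"] unfolding distrib_right by linarith
  qed
  moreover have "linear (\<lambda>x. l x + m x)" using C(2) C'(2) by (rule linear_compose_add)
  ultimately show ?thesis unfolding cont_functional_def by blast
qed

lemma cont_functional_0: "cont_functional (\<lambda>x. 0)"
  unfolding cont_functional_def using linear_zero by (auto intro: exI[of _ 0])

lemma cont_functional_sum:
  assumes "\<And>i. i \<in> A \<Longrightarrow> cont_functional (l i)"
  shows "cont_functional (\<lambda>x. \<Sum>i\<in>A. l i x)"
  using assms
proof (induction A rule: infinite_finite_induct)
  case (insert i A)
  then show ?case using cont_functional_add[of "l i" "\<lambda>x. \<Sum>i\<in>A. l i x"] by simp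
qed (simp_all add: cont_functional_0)

lemma cont_functional_diff:
  assumes "cont_functional l" "cont_functional m"
  shows "cont_functional (\<lambda>x. l x - m x)"
  using cont_functional_add[OF assms(1) cont_functional_scale[OF assms(2), of "-1"]] by simp

lemma cont_functional_tendsto:
  assumes "cont_functional l" "limitin T f m F"
  shows "((\<lambda>x. l (f x)) \<longlongrightarrow> l m) F"
  using assms tendsto_functional unfolding cont_functional_def by blast

lemma cont_functional_separates:
  assumes "y \<in> topspace T" "y \<noteq> 0"
  obtains l where "cont_functional l" "l y = 1"
proof -
  obtain k where k: "q k y \<noteq> 0" using q_separates assms by blast
  obtain l where l: "linear l" "\<And>x. \<bar>l x\<bar> \<le> q k x" "l y = q k y" using norming_functional by blast
  have "cont_functional l" unfolding cont_functional_def using l by (metis mult_1)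
  then show ?thesis using cont_functional_scale[of l "inverse (q k y)"] l(3) k
    by (intro that[of "\<lambda>x. inverse (q k y) * l x"]) auto
qed

text \<open>Gram-Schmidt with separation of points in place of an inner product: the new vector is
  stripped of its components along the old ones, a functional is normalised on what remains, and
  then this functional and the old ones are corrected to vanish where they should.\<close>

lemma dual_basis:
  assumes "finite B" "independent B" "B \<subseteq> topspace T"
  obtains f where "\<And>b. b \<in> B \<Longrightarrow> cont_functional (f b)"
    "\<And>b c. b \<in> B \<Longrightarrow> c \<in> B \<Longrightarrow> f b c = (if b = c then 1 else 0)"
proof -
  have "\<exists>f. (\<forall>b\<in>B. cont_functional (f b)) \<and> (\<forall>b\<in>B. \<forall>c\<in>B. f b c = (if b = c then 1 else 0))"
    using assms
  proof (induction B rule: finite_induct)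
    case (insert x B)
    then have "\<exists>f. (\<forall>b\<in>B. cont_functional (f b)) \<and> (\<forall>b\<in>B. \<forall>c\<in>B. f b c = (if b = c then 1 else 0))"
      by (simp add: independent_insert)
    then obtain f where f: "\<And>b. b \<in> B \<Longrightarrow> cont_functional (f b)"
      "\<And>b c. b \<in> B \<Longrightarrow> c \<in> B \<Longrightarrow> f b c = (if b = c then 1 else 0)"
      by blast
    define y where "y = x - (\<Sum>b\<in>B. f b x *\<^sub>R b)"
    have xB: "x \<notin> span B" using insert.prems insert.hyps by (auto simp: independent_insert)
    have "y \<noteq> 0"
    proof
      assume "y = 0"
      then have "x = (\<Sum>b\<in>B. f b x *\<^sub>R b)" by (simp add: y_def)
      also have "\<dots> \<in> span B" by (intro span_sum span_scale span_base)
      finally show False using xB by simp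
    qed
    moreover have "y \<in> topspace T"
      unfolding y_def using insert.prems by (intro carrier_diff carrier_sum carrier_scale) auto
    ultimately obtain g where g: "cont_functional g" "g y = 1" using cont_functional_separates by blast
    note lin = cont_functional_linear[OF g(1)]
    \<comment> \<open>The correction makes \<open>g\<close> vanish on \<open>B\<close>, and its
      value at \<open>x\<close> becomes the value of \<open>g\<close> at \<open>y\<close>, which is
      1.\<close>
    define g' where "g' = (\<lambda>z. g z - (\<Sum>b\<in>B. g b * f b z))"
    have g'_cont: "cont_functional g'"
      unfolding g'_def by (intro cont_functional_diff cont_functional_sum cont_functional_scale f g)
    have g'B: "g' c = 0" if c: "c \<in> B" for c
    proof -
      have "(\<Sum>b\<in>B. g b * f b c) = (\<Sum>b\<in>B. if b = c then g c else 0)"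
        by (intro sum.cong refl) (use f(2) c in auto)
      then show ?thesis using c insert.hyps by (simp add: g'_def)
    qed
    have "g y = g x - (\<Sum>b\<in>B. f b x * g b)"
      by (simp add: y_def linear_diff[OF lin] linear_sum[OF lin] linear_scale[OF lin])
    then have g'x: "g' x = 1" using g(2) by (simp add: g'_def mult.commute)
    define f' where "f' = (\<lambda>b. if b = x then g' else (\<lambda>z. f b z - f b x * g' z))"
    have "\<forall>b\<in>insert x B. cont_functional (f' b)"
      using f(1) g'_cont by (auto simp: f'_def intro: cont_functional_diff cont_functional_scale)
    moreover have "\<forall>b\<in>insert x B. \<forall>c\<in>insert x B. f' b c = (if b = c then 1 else 0)"
      using f(2) g'x g'B insert.hyps(2) by (auto simp: f'_def)
    ultimately show ?case by blast
  qed simp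
  then show ?thesis using that by blast
qed

text \<open>Otherwise \<open>B\<close> with \<open>w\<close> adjoined is independent, and the dual
  functional of \<open>w\<close> annihilates \<open>B\<close> but not \<open>w\<close>. Membership
  in a fibre of \<open>D\<close> can thus be tested by functionals.\<close>

lemma separate_from_span:
  assumes "finite B" "independent B" "B \<subseteq> topspace T" "w \<in> topspace T"
    and ann: "\<And>l. cont_functional l \<Longrightarrow> (\<And>b. b \<in> B \<Longrightarrow> l b = 0) \<Longrightarrow> l w = 0"
  shows "w \<in> span B"
proof (rule ccontr)
  assume w: "w \<notin> span B"
  then have wB: "w \<notin> B" using span_base by blast
  then have "independent (insert w B)" using assms(2) w by (simp add: independent_insert)
  then obtain f where f: "\<And>b. b \<in> insert w B \<Longrightarrow> cont_functional (f b)"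
    "\<And>b c. b \<in> insert w B \<Longrightarrow> c \<in> insert w B \<Longrightarrow> f b c = (if b = c then 1 else 0)"
    using dual_basis[of "insert w B"] assms by auto
  have "f w w = 0" by (rule ann) (use f wB in auto)
  then show False using f(2)[of w w] by simp
qed

end

text \<open>In the row belonging to the largest |c k|, the n deviations of size 1/(2 n) contribute
  at most half of that maximum, so the maximum is at most twice the bound.\<close>

lemma near_identity_bound:
  fixes a :: "'n::finite \<Rightarrow> 'n \<Rightarrow> real"
  assumes a: "\<And>k l. \<bar>a k l - (if k = l then 1 else 0)\<bar> \<le> 1 / (2 * CARD('n))"
    and b: "\<And>k. \<bar>\<Sum>l\<in>UNIV. c l * a k l\<bar> \<le> b"
  shows "\<bar>c k\<bar> \<le> 2 * b"
proof -
  define m where "m = Max (range (\<lambda>k. \<bar>c k\<bar>))"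
  have le_m: "\<bar>c l\<bar> \<le> m" for l unfolding m_def by (intro Max_ge) auto
  have "m \<in> range (\<lambda>k. \<bar>c k\<bar>)" unfolding m_def by (intro Max_in) auto
  then obtain k0 where k0: "m = \<bar>c k0\<bar>" by blast
  have "(\<Sum>l\<in>UNIV. c l * a k0 l) = c k0 + (\<Sum>l\<in>UNIV. c l * (a k0 l - (if k0 = l then 1 else 0)))"
    by (simp add: right_diff_distrib sum_subtractf if_distrib[of "(*) _"] cong: if_cong)
  moreover have "\<bar>\<Sum>l\<in>UNIV. c l * (a k0 l - (if k0 = l then 1 else 0))\<bar> \<le> (\<Sum>l\<in>(UNIV::'n set). m * (1 / (2 * CARD('n))))"
    by (rule order_trans[OF sum_abs], rule sum_mono, unfold abs_mult, rule mult_mono) (use le_m a order_trans[OF abs_ge_zero le_m] in auto)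
  moreover have "(\<Sum>l\<in>(UNIV::'n set). m * (1 / (2 * CARD('n)))) = m / 2" by simp
  ultimately have "m \<le> b + m / 2" using b[of k0] k0 by linarith
  then show ?thesis using le_m[of k] by linarith
qed

text \<open>A Gronwall argument for the sum of squares s, which satisfies |s'| <= L s and is
  therefore monotone after multiplication by exp (L r) or exp (- L r). The zero is prescribed at
  \<open>t\<close>, which may lie on either side of 0; hence the two cases.\<close>

lemma linear_system_zero:
  fixes a a' :: "'n::finite \<Rightarrow> real \<Rightarrow> real"
  assumes d: "\<And>j r. r \<in> {min 0 t..max 0 t} \<Longrightarrow> (a j has_real_derivative a' j r) (at r within {min 0 t..max 0 t})"
    and K: "\<And>j r. r \<in> {min 0 t..max 0 t} \<Longrightarrow> \<bar>a' j r\<bar> \<le> K * (\<Sum>k\<in>UNIV. \<bar>a k r\<bar>)"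
    and end0: "\<And>j. a j t = 0" and K0: "0 \<le> K"
  shows "a j 0 = 0"
proof -
  define J where "J = {min 0 t..max 0 t}"
  define s where "s = (\<lambda>r. \<Sum>j\<in>UNIV. (a j r)\<^sup>2)"
  define s' where "s' = (\<lambda>r. \<Sum>j\<in>UNIV. 2 * a j r * a' j r)"
  \<comment> \<open>The factor 2 K comes from differentiating the squares, the cardinality from the
    Cauchy-Schwarz bound for the square of a sum.\<close>
  define L where "L = 2 * K * CARD('n)"
  have s_deriv: "(s has_real_derivative s' r) (at r within J)" if "r \<in> J" for r
    unfolding s_def s'_def using d[of r] that unfolding J_def
    by (auto intro!: derivative_eq_intros simp: mult_ac)
  have bound: "\<bar>s' r\<bar> \<le> L * s r" if r: "r \<in> J" for r
  proof -
    have "\<bar>s' r\<bar> \<le> (\<Sum>j\<in>UNIV. \<bar>2 * a j r * a' j r\<bar>)" unfolding s'_def by (rule sum_abs)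
    also have "\<dots> \<le> (\<Sum>j\<in>UNIV. 2 * \<bar>a j r\<bar> * (K * (\<Sum>k\<in>UNIV. \<bar>a k r\<bar>)))"
      unfolding abs_mult using K[of r] r unfolding J_def by (intro sum_mono mult_mono) auto
    also have "\<dots> = 2 * K * (\<Sum>k\<in>UNIV. \<bar>a k r\<bar>)\<^sup>2"
      by (simp add: power2_eq_square sum_distrib_left sum_distrib_right mult_ac)
    also have "\<dots> \<le> 2 * K * (CARD('n) * s r)"
      using sum_squared_le_sum_of_squares[of "\<lambda>k. \<bar>a k r\<bar>" "UNIV::'n set"] K0
      by (intro mult_left_mono) (auto simp: s_def mult.commute)
    finally show ?thesis by (simp add: L_def)
  qed
  have s0: "0 \<le> s r" for r unfolding s_def by (intro sum_nonneg) auto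
  have st: "s t = 0" using end0 by (simp add: s_def)
  have "s 0 \<le> 0"
  proof (cases "0 \<le> t")
    case True
    then have J: "J = {0..t}" by (simp add: J_def)
    have "((\<lambda>r. exp (L * r) * s r) has_derivative (\<lambda>h. (exp (L * r) * (L * s r + s' r)) * h)) (at r within {0..t})"
      if "r \<in> {0..t}" for r
      using s_deriv[of r] that unfolding J has_field_derivative_def[symmetric]
      by (auto intro!: derivative_eq_intros simp: algebra_simps)
    then obtain r where r: "r \<in> {0..t}" "exp (L * t) * s t - exp (L * 0) * s 0 = (exp (L * r) * (L * s r + s' r)) * (t - 0)"
      using mvt_very_simple[OF True, of "\<lambda>r. exp (L * r) * s r" "\<lambda>r h. (exp (L * r) * (L * s r + s' r)) * h"] by auto
    have "0 \<le> (exp (L * r) * (L * s r + s' r)) * (t - 0)"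
      using bound[of r] r(1) J True by (intro mult_nonneg_nonneg) auto
    then show ?thesis using r(2) st by simp
  next
    case False
    then have J: "J = {t..0}" by (simp add: J_def)
    have "((\<lambda>r. exp (- L * r) * s r) has_derivative (\<lambda>h. (exp (- L * r) * (s' r - L * s r)) * h)) (at r within {t..0})"
      if "r \<in> {t..0}" for r
      using s_deriv[of r] that unfolding J has_field_derivative_def[symmetric]
      by (auto intro!: derivative_eq_intros simp: algebra_simps)
    then obtain r where r: "r \<in> {t..0}" "exp (- L * 0) * s 0 - exp (- L * t) * s t = (exp (- L * r) * (s' r - L * s r)) * (0 - t)"
      using mvt_very_simple[of t 0 "\<lambda>r. exp (- L * r) * s r" "\<lambda>r h. (exp (- L * r) * (s' r - L * s r)) * h"] False by auto
    have "(exp (- L * r) * (s' r - L * s r)) * (0 - t) \<le> 0"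
      using bound[of r] r(1) J False by (intro mult_nonpos_nonneg mult_nonneg_nonpos) auto
    then show ?thesis using r(2) st by simp
  qed
  then have "s 0 = 0" using s0[of 0] by simp
  then have "\<forall>j\<in>UNIV. (a j 0)\<^sup>2 = 0" unfolding s_def by (subst (asm) sum_nonneg_eq_0_iff) auto
  then show ?thesis by simp
qed

section \<open>Smooth curves in products, subspaces and coordinates\<close>

lemma smooth_curve_prod_iff:
  "smooth_curve (prod_topology X Y) c \<longleftrightarrow> smooth_curve X (fst \<circ> c) \<and> smooth_curve Y (snd \<circ> c)"
  (is "?L \<longleftrightarrow> ?R")
proof
  assume ?L
  then obtain d where d: "range c \<subseteq> topspace (prod_topology X Y)" "d 0 = c"
    "\<And>k t. limitin (prod_topology X Y) (\<lambda>h. (d k (t + h) - d k t) /\<^sub>R h) (d (Suc k) t) (at 0)"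
    unfolding smooth_curve_def by blast
  show ?R unfolding smooth_curve_def
  proof (intro conjI exI allI)
    show "range (fst \<circ> c) \<subseteq> topspace X" "range (snd \<circ> c) \<subseteq> topspace Y" using d(1) by auto
    show "(\<lambda>k. fst \<circ> d k) 0 = fst \<circ> c" "(\<lambda>k. snd \<circ> d k) 0 = snd \<circ> c" using d(2) by auto
    show "limitin X (\<lambda>h. ((fst \<circ> d k) (t + h) - (fst \<circ> d k) t) /\<^sub>R h) ((fst \<circ> d (Suc k)) t) (at 0)"
      "limitin Y (\<lambda>h. ((snd \<circ> d k) (t + h) - (snd \<circ> d k) t) /\<^sub>R h) ((snd \<circ> d (Suc k)) t) (at 0)" for k t
      using d(3)[of k t] by (auto simp: limitin_pairwise o_def)
  qed
next
  assume ?R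
  then obtain d e where d: "range (fst \<circ> c) \<subseteq> topspace X" "d 0 = fst \<circ> c"
    "\<And>k t. limitin X (\<lambda>h. (d k (t + h) - d k t) /\<^sub>R h) (d (Suc k) t) (at 0)"
    and e: "range (snd \<circ> c) \<subseteq> topspace Y" "e 0 = snd \<circ> c"
    "\<And>k t. limitin Y (\<lambda>h. (e k (t + h) - e k t) /\<^sub>R h) (e (Suc k) t) (at 0)"
    unfolding smooth_curve_def by blast
  show ?L unfolding smooth_curve_def
  proof (intro conjI exI allI)
    show "range c \<subseteq> topspace (prod_topology X Y)" using d(1) e(1) by (simp add: image_subset_iff mem_Times_iff o_def)
    show "(\<lambda>k t. (d k t, e k t)) 0 = c" using d(2) e(2) by auto
    show "limitin (prod_topology X Y) (\<lambda>h. ((d k (t + h), e k (t + h)) - (d k t, e k t)) /\<^sub>R h) (d (Suc k) t, e (Suc k) t) (at 0)" for k t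
      using d(3)[of k t] e(3)[of k t] by (auto simp: limitin_pairwise o_def)
  qed
qed

lemma smooth_curve_subtopology:
  assumes "smooth_curve (subtopology X K) c"
  shows "smooth_curve X c"
  using assms unfolding smooth_curve_def by (auto simp: limitin_subtopology)

lemma smooth_curve_vec_nth:
  fixes u :: "real \<Rightarrow> real ^ 'n"
  assumes "smooth_curve euclidean u"
  shows "smooth_curve euclideanreal (\<lambda>t. u t $ i)"
proof -
  obtain d where d: "d 0 = u" "\<And>k t. ((\<lambda>h. (d k (t + h) - d k t) /\<^sub>R h) \<longlongrightarrow> d (Suc k) t) (at 0)"
    using assms unfolding smooth_curve_def by auto
  have "((\<lambda>h. (d k (t + h) $ i - d k t $ i) /\<^sub>R h) \<longlongrightarrow> d (Suc k) t $ i) (at 0)" for k t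
    using tendsto_vec_nth[OF d(2)[of k t], of i] by simp
  then show ?thesis unfolding smooth_curve_def using d(1)
    by (auto intro!: exI[of _ "\<lambda>k t. d k t $ i"])
qed

section \<open>Derivatives of flows\<close>

lemma limitin_pair:
  "limitin (prod_topology X Y) (\<lambda>i. (f i, g i)) (a, b) F \<longleftrightarrow> limitin X f a F \<and> limitin Y g b F"
  by (simp add: limitin_pairwise o_def)

lemma smooth_map_compose:
  assumes "smooth_map S A T f" "smooth_map T B R g" "f ` A \<subseteq> B"
  shows "smooth_map S A R (\<lambda>x. g (f x))"
  unfolding smooth_map_def
proof (intro conjI allI impI)
  show "A \<subseteq> topspace S" using assms(1) by (simp add: smooth_map_def)
  show "(\<lambda>x. g (f x)) ` A \<subseteq> topspace R" using assms(2,3) by (auto simp: smooth_map_def)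
  fix c assume c: "smooth_curve S c \<and> range c \<subseteq> A"
  then have "smooth_curve T (f \<circ> c)" using assms(1) by (auto simp: smooth_map_def)
  moreover have "range (f \<circ> c) \<subseteq> B" using c assms(3) by auto
  ultimately have "smooth_curve R (g \<circ> (f \<circ> c))" using assms(2) by (auto simp: smooth_map_def)
  then show "smooth_curve R ((\<lambda>x. g (f x)) \<circ> c)" by (simp add: o_def)
qed

lemma limitin_nhdsin_self: "x \<in> topspace X \<Longrightarrow> limitin X (\<lambda>y. y) x (nhdsin X x)"
  by (auto simp: limitin_def eventually_nhdsin)

context seminormed_space
begin

lemma q_limit_le:
  assumes "limitin T f l F" "F \<noteq> bot" "\<forall>\<^sub>F i in F. q k (f i) \<le> C"
  shows "q k l \<le> C"
proof -
  have "((\<lambda>i. C + q k (f i - l)) \<longlongrightarrow> C + 0) F"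
    by (intro tendsto_intros limitinD assms(1))
  moreover have "\<forall>\<^sub>F i in F. q k l \<le> C + q k (f i - l)"
    using assms(3)
  proof eventually_elim
    case (elim i)
    then show ?case using q_triangle[of k "f i" "l - f i"] by (simp add: q_commute)
  qed
  ultimately show ?thesis using tendsto_lowerbound assms(2) by fastforce
qed

lemma has_vderiv_minus:
  "has_vderiv c d t I \<Longrightarrow> has_vderiv c' d' t I \<Longrightarrow> has_vderiv (\<lambda>s. c s - c' s) (d - d') t I"
  unfolding has_vderiv_def
  by (drule (1) limitin_minus) (simp add: algebra_simps)

end

locale local_flow = E: seminormed_space E q
  for E :: "'a::real_vector topology" and q :: "nat \<Rightarrow> 'a \<Rightarrow> real" +
  fixes W :: "'a set" and X :: "'a \<Rightarrow> 'a" and \<epsilon> :: real and V :: "'a set" and Fl :: "real \<times> 'a \<Rightarrow> 'a"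
  assumes vf: "vector_field E W X" and eps: "\<epsilon> > 0" and V_open: "openin E V"
    and flow: "flow_on E W X {-\<epsilon><..<\<epsilon>} V Fl"
begin

abbreviation "I \<equiv> {-\<epsilon><..<\<epsilon>}"
abbreviation "P \<equiv> prod_topology euclideanreal E"
abbreviation "pq \<equiv> \<lambda>k (z::real \<times> 'a). \<bar>fst z\<bar> + q k (snd z)"

lemma W_open: "openin E W" and X_smooth: "smooth_map E W E X"
  using vf by (auto simp: vector_field_def)

lemma Fl_smooth: "smooth_map P (I \<times> V) E Fl" and Fl_W: "t \<in> I \<Longrightarrow> y \<in> V \<Longrightarrow> Fl (t, y) \<in> W"
  and Fl_0: "y \<in> V \<Longrightarrow> Fl (0, y) = y"
  and Fl_group: "s \<in> I \<Longrightarrow> t \<in> I \<Longrightarrow> y \<in> V \<Longrightarrow> s + t \<in> I \<Longrightarrow> Fl (s, y) \<in> V \<Longrightarrow> Fl (t, Fl (s, y)) = Fl (s + t, y)"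
  using flow unfolding flow_on_def by blast+

lemma Fl_vderiv: "t \<in> I \<Longrightarrow> y \<in> V \<Longrightarrow> E.has_vderiv (\<lambda>s. Fl (s, y)) (X (Fl (t, y))) t I"
  using flow unfolding flow_on_def E.has_vderiv_def by blast

lemma zero_in_I: "0 \<in> I" using eps by simp

sublocale P: seminormed_space P pq
  by (rule E.seminormed_space_prod_real)

sublocale VF: open_smooth_map E q E q W X
  by unfold_locales (use W_open X_smooth in auto)

lemma IV_open: "openin P (I \<times> V)"
  using V_open by (auto simp: openin_prod_Times_iff simp flip: open_openin)

sublocale FL: open_smooth_map P pq E q "I \<times> V" Fl
  by unfold_locales (use IV_open Fl_smooth in auto)

lemma XFl_smooth: "smooth_map P (I \<times> V) E (\<lambda>z. X (Fl z))"
  using Fl_W by (intro smooth_map_compose[OF Fl_smooth X_smooth]) auto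

sublocale KF: open_smooth_map P pq E q "I \<times> V" "\<lambda>z. X (Fl z)"
  by unfold_locales (use IV_open XFl_smooth in auto)

lemma V_carrier: "y \<in> V \<Longrightarrow> y \<in> topspace E"
  using V_open openin_subset by blast

text \<open>The spatial differential of the flow, read off from the differential in time and space
  so that it inherits joint continuity in time, point and vector.\<close>

definition push :: "real \<Rightarrow> 'a \<Rightarrow> 'a \<Rightarrow> 'a" where
  "push t y v = FL.df (t, y) (0, v)"

lemma push_carrier: "t \<in> I \<Longrightarrow> y \<in> V \<Longrightarrow> v \<in> topspace E \<Longrightarrow> push t y v \<in> topspace E"
  unfolding push_def by (intro FL.df_carrier) auto

lemma push_scale: "t \<in> I \<Longrightarrow> y \<in> V \<Longrightarrow> v \<in> topspace E \<Longrightarrow> push t y (a *\<^sub>R v) = a *\<^sub>R push t y v"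
  unfolding push_def using FL.df_scale[of "(t, y)" "(0, v)" a] by simp

lemma push_add: "t \<in> I \<Longrightarrow> y \<in> V \<Longrightarrow> v \<in> topspace E \<Longrightarrow> w \<in> topspace E \<Longrightarrow>
    push t y (v + w) = push t y v + push t y w"
  unfolding push_def using FL.df_add[of "(t, y)" "(0, v)" "(0, w)"] by simp

lemma push_diff: "t \<in> I \<Longrightarrow> y \<in> V \<Longrightarrow> v \<in> topspace E \<Longrightarrow> w \<in> topspace E \<Longrightarrow>
    push t y (v - w) = push t y v - push t y w"
  using push_add[of t y v "(-1) *\<^sub>R w"] push_scale[of t y w "-1"] by simp

lemma push_sum: "t \<in> I \<Longrightarrow> y \<in> V \<Longrightarrow> (\<And>i. i \<in> B \<Longrightarrow> v i \<in> topspace E) \<Longrightarrow>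
    push t y (\<Sum>i\<in>B. v i) = (\<Sum>i\<in>B. push t y (v i))"
proof (induction B rule: infinite_finite_induct)
  case (insert i B)
  then show ?case by (simp add: push_add E.carrier_sum)
qed (use push_scale[of t y 0 0] in simp_all)

lemma df_time:
  assumes "t \<in> I" "y \<in> V"
  shows "FL.df (t, y) (1, 0) = X (Fl (t, y))"
proof (rule FL.df_unique)
  have "at t within I = at t" using assms(1) by (intro at_within_open) auto
  then have "E.has_vderiv (\<lambda>s. Fl (s, y)) (X (Fl (t, y))) t UNIV"
    using Fl_vderiv[OF assms] unfolding E.has_vderiv_def by simp
  then show "limitin E (\<lambda>h. (Fl ((t, y) + h *\<^sub>R (1, 0)) - Fl (t, y)) /\<^sub>R h) (X (Fl (t, y))) (at 0)"
    unfolding E.has_vderiv_shift by simp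
qed

lemma df_split:
  assumes "t \<in> I" "y \<in> V" "v \<in> topspace E"
  shows "FL.df (t, y) (a, v) = a *\<^sub>R X (Fl (t, y)) + push t y v"
proof -
  have "FL.df (t, y) ((a, 0) + (0, v)) = FL.df (t, y) (a, 0) + FL.df (t, y) (0, v)"
    using assms by (intro FL.df_add) auto
  moreover have "FL.df (t, y) (a, 0) = a *\<^sub>R FL.df (t, y) (1, 0)"
    using FL.df_scale[of "(t, y)" "(1, 0)" a] assms by simp
  ultimately have "FL.df (t, y) (a, v) = a *\<^sub>R FL.df (t, y) (1, 0) + FL.df (t, y) (0, v)" by simp
  then show ?thesis using df_time[OF assms(1,2)] by (simp add: push_def)
qed

lemma eventually_V:
  assumes "y \<in> V" "v \<in> topspace E"
  shows "\<forall>\<^sub>F h in at (0::real). y + h *\<^sub>R v \<in> V"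
proof -
  have "limitin E (\<lambda>h. y + h *\<^sub>R v) (y + 0 *\<^sub>R v) (at 0)"
    using assms V_carrier by (intro E.limitin_plus E.limitin_scale E.limitin_konst) auto
  then show ?thesis using assms(1) V_open by (simp add: limitin_def)
qed

lemma push_0:
  assumes "y \<in> V" "v \<in> topspace E"
  shows "push 0 y v = v"
  unfolding push_def
proof (rule FL.df_unique)
  have ne: "\<forall>\<^sub>F h in at (0::real). h \<noteq> 0" by (simp add: eventually_at_filter)
  show "limitin E (\<lambda>h. (Fl ((0, y) + h *\<^sub>R (0, v)) - Fl (0, y)) /\<^sub>R h) v (at 0)"
  proof (rule E.limitin_cong_ev[OF E.limitin_konst[OF assms(2)]])
    show "\<forall>\<^sub>F h in at 0. v = (Fl ((0, y) + h *\<^sub>R (0, v)) - Fl (0, y)) /\<^sub>R h"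
      using eventually_V[OF assms] ne by eventually_elim (simp add: Fl_0 assms(1))
  qed
qed

text \<open>The chain rule for a composition of two flow maps. The group law is available at the
  points near \<open>y\<close> because \<open>V\<close> is open and the flow is continuous.\<close>

lemma push_cocycle:
  assumes st: "s \<in> I" "t \<in> I" "s + t \<in> I" and y: "y \<in> V" "Fl (s, y) \<in> V" and v: "v \<in> topspace E"
  shows "push (s + t) y v = push t (Fl (s, y)) (push s y v)"
  unfolding push_def[of "s + t"]
proof (rule FL.df_unique)
  let ?w = "\<lambda>h. (Fl ((s, y) + h *\<^sub>R (0, v)) - Fl (s, y)) /\<^sub>R h"
  have ne: "\<forall>\<^sub>F h in at (0::real). h \<noteq> 0" by (simp add: eventually_at_filter)
  have yS: "y \<in> topspace E" using y V_carrier by blast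
  have w: "limitin E ?w (push s y v) (at 0)"
    unfolding push_def using st y v by (intro FL.df_d2f_limits) auto
  have "limitin P (\<lambda>h. (0, ?w h)) (0, push s y v) (at 0)"
    unfolding limitin_pair using w by simp
  moreover have "limitin P (\<lambda>h. (t, Fl (s, y))) (t, Fl (s, y)) (at 0)"
    using y(2) V_carrier by (intro P.limitin_konst) auto
  ultimately have L: "limitin E (\<lambda>h. (Fl ((t, Fl (s, y)) + h *\<^sub>R (0, ?w h)) - Fl (t, Fl (s, y))) /\<^sub>R h)
     (push t (Fl (s, y)) (push s y v)) (at 0)"
    unfolding push_def using st y ne by (intro FL.chain_rule[where r="\<lambda>h. h"]) auto
  have "limitin P (\<lambda>h. (s, y + h *\<^sub>R v)) (s, y) (at 0)"
    unfolding limitin_pair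
    using E.limitin_plus[OF E.limitin_konst[OF yS] E.limitin_scale[OF tendsto_ident_at E.limitin_konst[OF v]], of 0 UNIV]
    by simp
  then have "limitin E (\<lambda>h. Fl (s, y + h *\<^sub>R v)) (Fl (s, y)) (at 0)"
    using st y by (intro FL.continuous) auto
  then have "\<forall>\<^sub>F h in at 0. Fl (s, y + h *\<^sub>R v) \<in> V" using V_open y(2) by (simp add: limitin_def)
  with eventually_V[OF y(1) v] ne
  have "\<forall>\<^sub>F h in at 0. (Fl ((t, Fl (s, y)) + h *\<^sub>R (0, ?w h)) - Fl (t, Fl (s, y))) /\<^sub>R h =
     (Fl ((s + t, y) + h *\<^sub>R (0, v)) - Fl (s + t, y)) /\<^sub>R h"
  proof eventually_elim
    case (elim h)
    then show ?case using Fl_group[OF st(1,2) _ st(3)] y by simp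
  qed
  with L show "limitin E (\<lambda>h. (Fl ((s + t, y) + h *\<^sub>R (0, v)) - Fl (s + t, y)) /\<^sub>R h)
     (push t (Fl (s, y)) (push s y v)) (at 0)"
    by (rule E.limitin_cong_ev)
qed

lemma V_subset_W: "V \<subseteq> W"
  using Fl_W[OF zero_in_I] Fl_0 by fastforce

text \<open>At time 0 the flow is the identity. Continuity of \<open>KF.df\<close> at this point is
  what \<open>push_derivative_0\<close> exploits.\<close>

lemma KF_df_0:
  assumes "y \<in> V" "v \<in> topspace E"
  shows "KF.df (0, y) (0, v) = VF.df y v"
proof (rule KF.df_unique)
  have L: "limitin E (\<lambda>h. (X (y + h *\<^sub>R v) - X y) /\<^sub>R h) (VF.df y v) (at 0)"
    using assms V_subset_W by (intro VF.df_d2f_limits) auto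
  show "limitin E (\<lambda>h. (X (Fl ((0, y) + h *\<^sub>R (0, v))) - X (Fl (0, y))) /\<^sub>R h) (VF.df y v) (at 0)"
    by (rule E.limitin_cong_ev[OF L])
      (use eventually_V[OF assms] in \<open>eventually_elim, simp add: Fl_0 assms(1)\<close>)
qed

text \<open>
  Only first derivatives are needed here: both variables of \<open>Fl (\<tau>, z + s w) - Fl (\<tau>, z)\<close> are
  estimated by the mean value inequality, and then \<open>s\<close> tends to \<open>0\<close>.
\<close>

lemma push_derivative_0:
  assumes y: "y \<in> V" and z: "limitin E z y F" and w: "limitin E w v F"
    and r: "(r \<longlongrightarrow> 0) F" "\<forall>\<^sub>F i in F. r i \<noteq> 0"
  shows "limitin E (\<lambda>i. (push (r i) (z i) (w i) - w i) /\<^sub>R r i) (VF.df y v) F"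
  unfolding E.limitin_iff
proof (intro conjI allI)
  have yS: "y \<in> topspace E" using y V_carrier by blast
  have v: "v \<in> topspace E" using w E.limitin_carrier by blast
  have yW: "y \<in> W" using y V_subset_W by blast
  define D where "D = VF.df y v"
  show D: "VF.df y v \<in> topspace E" by (rule VF.df_carrier[OF yW v])
  have zS: "\<forall>\<^sub>F i in F. z i \<in> topspace E" and wS: "\<forall>\<^sub>F i in F. w i \<in> topspace E"
    using z w E.limitin_carrier_ev by blast+
  have zV: "\<forall>\<^sub>F i in F. z i \<in> V" using z V_open y by (simp add: limitin_def)
  have rI: "\<forall>\<^sub>F i in F. r i \<in> I"
    using r(1) eps by (intro topological_tendstoD[of r 0 F]) auto
  show "\<forall>\<^sub>F i in F. (push (r i) (z i) (w i) - w i) /\<^sub>R r i \<in> topspace E"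
    using zV rI wS by eventually_elim (intro E.carrier_scale E.carrier_diff push_carrier)
  fix N
  show "((\<lambda>i. q N ((push (r i) (z i) (w i) - w i) /\<^sub>R r i - VF.df y v)) \<longlongrightarrow> 0) F"
  proof (rule tendstoI)
    fix e :: real assume e: "e > 0"
    have 1: "(0, y) \<in> I \<times> V" using y zero_in_I by simp
    have 2: "(0, v) \<in> topspace P" using v by simp
    have 3: "e / 2 > 0" using e by simp
    obtain M \<delta> where \<delta>: "\<delta> > 0" and
      MA: "\<And>x. x \<in> topspace P \<Longrightarrow> pq M (x - (0, y)) < \<delta> \<Longrightarrow> x \<in> I \<times> V" and
      Mdf: "\<And>x u. x \<in> topspace P \<Longrightarrow> u \<in> topspace P \<Longrightarrow> pq M (x - (0, y)) < \<delta> \<Longrightarrow> pq M (u - (0, v)) < \<delta> \<Longrightarrow>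
         q N (KF.df x u - KF.df (0, y) (0, v)) < e / 2"
      by (rule KF.df_continuous_bound[OF 1 2 3, where N=N]) (rule that)
    have c1: "\<forall>\<^sub>F i in F. q M (z i - y) < \<delta>/3" using E.limitin_small[OF z, of "\<delta>/3"] \<delta> by simp
    have c2: "\<forall>\<^sub>F i in F. q M (w i - v) < \<delta>" using E.limitin_small[OF w \<delta>] .
    have c3: "\<forall>\<^sub>F i in F. \<bar>r i\<bar> < \<delta>/3" using tendstoD[OF r(1), of "\<delta>/3"] \<delta> by simp
    from c1 c2 c3 zS wS zV rI r(2)
    show "\<forall>\<^sub>F i in F. dist (q N ((push (r i) (z i) (w i) - w i) /\<^sub>R r i - VF.df y v)) 0 < e"
    proof eventually_elim
      case (elim i)
      \<comment> \<open>The added 1 keeps the divisor positive. Time, base point and the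
        displacement by s times \<open>w i\<close> each take a third of delta.\<close>
      define m where "m = q M (w i) + 1"
      have m: "m > 0" "q M (w i) < m" using E.q_nonneg[of M "w i"] unfolding m_def by linarith+
      have small: "q M (s *\<^sub>R w i) < \<delta>/3" if "\<bar>s\<bar> < \<delta> / (3 * m)" for s
      proof -
        have "\<bar>s\<bar> * q M (w i) \<le> \<bar>s\<bar> * m" using m by (intro mult_left_mono) auto
        also have "\<dots> < \<delta>/3" using that m by (simp add: field_simps)
        finally show ?thesis by (simp add: E.q_scale)
      qed
      have near: "pq M ((\<tau>, z i + s *\<^sub>R w i) - (0, y)) < \<delta>" if "\<bar>\<tau>\<bar> \<le> \<bar>r i\<bar>" "\<bar>s\<bar> < \<delta> / (3 * m)" for \<tau> s
      proof -
        have "q M (z i + s *\<^sub>R w i - y) \<le> q M (z i - y) + q M (s *\<^sub>R w i)"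
          using E.q_triangle[of M "z i - y" "s *\<^sub>R w i"] by (simp add: algebra_simps)
        then show ?thesis using that(1) small[OF that(2)] elim(1,3) by simp
      qed
      have in_S: "(\<tau>, z i + s *\<^sub>R w i) \<in> topspace P" for \<tau> s using elim(4,5) by auto
      have in_IV: "\<tau> \<in> I" "z i + s *\<^sub>R w i \<in> V" if "\<bar>\<tau>\<bar> \<le> \<bar>r i\<bar>" "\<bar>s\<bar> < \<delta> / (3 * m)" for \<tau> s
        using MA[OF in_S near[OF that]] by auto
      \<comment> \<open>Space first: at each fixed small time the field along the flow has an
        increment close to s times \<open>D\<close>.\<close>
      have bnd: "q N (X (Fl (\<tau>, z i + s *\<^sub>R w i)) - X (Fl (\<tau>, z i)) - s *\<^sub>R D) \<le> \<bar>s\<bar> * (e / 2)"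
        if \<tau>: "\<bar>\<tau>\<bar> \<le> \<bar>r i\<bar>" and s: "\<bar>s\<bar> < \<delta> / (3 * m)" for \<tau> s
      proof -
        define J where "J = {min 0 s..max 0 s}"
        have J: "is_interval J" "0 \<in> J" "s \<in> J" and J_le: "\<And>\<sigma>. \<sigma> \<in> J \<Longrightarrow> \<bar>\<sigma>\<bar> < \<delta> / (3 * m)"
          using s by (auto simp: J_def is_interval_cc)
        have "q N (X (Fl ((\<tau>, z i) + s *\<^sub>R (0, w i))) - X (Fl ((\<tau>, z i) + 0 *\<^sub>R (0, w i))) - (s - 0) *\<^sub>R D) \<le> \<bar>s - 0\<bar> * (e / 2)"
        proof (rule E.mean_value_bound[OF J])
          fix \<sigma> assume \<sigma>: "\<sigma> \<in> J"
          have pt: "(\<tau>, z i) + \<sigma> *\<^sub>R (0, w i) = (\<tau>, z i + \<sigma> *\<^sub>R w i)" by simp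
          show "E.has_vderiv (\<lambda>s. X (Fl ((\<tau>, z i) + s *\<^sub>R (0, w i)))) (KF.df ((\<tau>, z i) + \<sigma> *\<^sub>R (0, w i)) (0, w i)) \<sigma> J"
            using in_IV[OF \<tau> J_le[OF \<sigma>]] elim(5) by (intro KF.has_vderiv_line) auto
          have "q N (KF.df (\<tau>, z i + \<sigma> *\<^sub>R w i) (0, w i) - KF.df (0, y) (0, v)) < e / 2"
            using elim(2,5) by (intro Mdf[OF in_S _ near[OF \<tau> J_le[OF \<sigma>]]]) auto
          then show "q N (KF.df ((\<tau>, z i) + \<sigma> *\<^sub>R (0, w i)) (0, w i) - D) \<le> e / 2"
            unfolding pt D_def KF_df_0[OF y v] by simp
        qed
        then show ?thesis by simp
      qed
      \<comment> \<open>The time derivative of the difference of two orbits is the increment just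
        estimated, and at time 0 the difference is s times \<open>w i\<close>.\<close>
      have bnd2: "q N ((Fl (r i, z i + s *\<^sub>R w i) - Fl (r i, z i)) - s *\<^sub>R w i - (r i * s) *\<^sub>R D) \<le> \<bar>r i\<bar> * (\<bar>s\<bar> * (e / 2))"
        if s: "\<bar>s\<bar> < \<delta> / (3 * m)" for s
      proof -
        define J where "J = {min 0 (r i)..max 0 (r i)}"
        have J: "is_interval J" "0 \<in> J" "r i \<in> J" and J_le: "\<And>\<tau>. \<tau> \<in> J \<Longrightarrow> \<bar>\<tau>\<bar> \<le> \<bar>r i\<bar>"
          by (auto simp: J_def is_interval_cc)
        have s0: "\<bar>0\<bar> < \<delta> / (3 * m)" using \<delta> m by simp
        have JI: "J \<subseteq> I" using in_IV(1)[OF J_le s0] by blast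
        have "q N ((Fl (r i, z i + s *\<^sub>R w i) - Fl (r i, z i)) - (Fl (0, z i + s *\<^sub>R w i) - Fl (0, z i)) - (r i - 0) *\<^sub>R s *\<^sub>R D)
           \<le> \<bar>r i - 0\<bar> * (\<bar>s\<bar> * (e / 2))"
        proof (rule E.mean_value_bound[OF J _ bnd[OF J_le s]])
          fix \<tau> assume \<tau>: "\<tau> \<in> J"
          show "E.has_vderiv (\<lambda>\<tau>. Fl (\<tau>, z i + s *\<^sub>R w i) - Fl (\<tau>, z i))
             (X (Fl (\<tau>, z i + s *\<^sub>R w i)) - X (Fl (\<tau>, z i))) \<tau> J"
            using in_IV[OF J_le[OF \<tau>] s] elim(6)
            by (intro E.has_vderiv_minus E.has_vderiv_subset[OF _ JI] Fl_vderiv) auto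
        qed
        moreover have "Fl (0, z i + s *\<^sub>R w i) - Fl (0, z i) = s *\<^sub>R w i"
          using in_IV(2)[OF J_le[OF J(2)] s] elim(6) by (simp add: Fl_0)
        ultimately show ?thesis by simp
      qed
      have "limitin E (\<lambda>s. (Fl ((r i, z i) + s *\<^sub>R (0, w i)) - Fl (r i, z i)) /\<^sub>R s - w i - r i *\<^sub>R D)
         (push (r i) (z i) (w i) - w i - r i *\<^sub>R D) (at 0)"
        unfolding push_def using elim(5-7) D
        by (intro E.limitin_minus E.limitin_konst FL.df_d2f_limits(1)) (auto simp: D_def)
      then have "q N (push (r i) (z i) (w i) - w i - r i *\<^sub>R D) \<le> \<bar>r i\<bar> * (e / 2)"
      proof (rule E.q_limit_le)
        have ne: "\<forall>\<^sub>F s in at (0::real). s \<noteq> 0" by (simp add: eventually_at_filter)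
        have "\<forall>\<^sub>F s in at (0::real). \<bar>s\<bar> < \<delta> / (3 * m)"
          using \<delta> m by (intro eventually_at_0_abs_less) auto
        with ne show "\<forall>\<^sub>F s in at 0. q N ((Fl ((r i, z i) + s *\<^sub>R (0, w i)) - Fl (r i, z i)) /\<^sub>R s - w i - r i *\<^sub>R D) \<le> \<bar>r i\<bar> * (e / 2)"
        proof eventually_elim
          case (elim s)
          have "(Fl ((r i, z i) + s *\<^sub>R (0, w i)) - Fl (r i, z i)) /\<^sub>R s - w i - r i *\<^sub>R D
            = inverse s *\<^sub>R ((Fl (r i, z i + s *\<^sub>R w i) - Fl (r i, z i)) - s *\<^sub>R w i - (r i * s) *\<^sub>R D)"
            using elim(1) by (simp add: scaleR_diff_right)
          then have "q N ((Fl ((r i, z i) + s *\<^sub>R (0, w i)) - Fl (r i, z i)) /\<^sub>R s - w i - r i *\<^sub>R D)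
            = q N ((Fl (r i, z i + s *\<^sub>R w i) - Fl (r i, z i)) - s *\<^sub>R w i - (r i * s) *\<^sub>R D) / \<bar>s\<bar>"
            by (simp only: E.q_scale) (simp add: divide_inverse mult.commute)
          also have "\<dots> \<le> (\<bar>r i\<bar> * (\<bar>s\<bar> * (e / 2))) / \<bar>s\<bar>"
            using bnd2[OF elim(2)] by (intro divide_right_mono) auto
          also have "\<dots> = \<bar>r i\<bar> * (e / 2)" using elim(1) by simp
          finally show ?case .
        qed
      qed simp
      moreover have "(push (r i) (z i) (w i) - w i) /\<^sub>R r i - VF.df y v =
         inverse (r i) *\<^sub>R (push (r i) (z i) (w i) - w i - r i *\<^sub>R D)"
        using elim(8) by (simp add: D_def scaleR_diff_right)
      then have "q N ((push (r i) (z i) (w i) - w i) /\<^sub>R r i - VF.df y v) =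
         q N (push (r i) (z i) (w i) - w i - r i *\<^sub>R D) / \<bar>r i\<bar>"
        by (simp only: E.q_scale) (simp add: divide_inverse mult.commute)
      ultimately have "q N ((push (r i) (z i) (w i) - w i) /\<^sub>R r i - VF.df y v) \<le> e / 2"
        using elim(8) by (simp add: pos_divide_le_eq mult.commute)
      then show ?case using e by simp
    qed
  qed
qed

text \<open>By the cocycle law, pushing from the orbit point at time s to the end is the push for
  time r - s followed by the fixed push for time t - r. Only a derivative at time 0 remains, namely
  DY X - DX Y, which is the bracket of \<open>Y\<close> and \<open>X\<close> in the sign convention
  used; the fixed push is linear and continuous.\<close>

lemma push_bracket_derivative:
  assumes Y: "vector_field E W Y" and t: "t \<in> I" and y: "y \<in> V"
    and orbit: "\<And>r. r \<in> {min 0 t..max 0 t} \<Longrightarrow> Fl (r, y) \<in> V"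
    and r: "r \<in> {min 0 t..max 0 t}"
  shows "E.has_vderiv (\<lambda>r. push (t - r) (Fl (r, y)) (Y (Fl (r, y))))
     (push (t - r) (Fl (r, y)) (lie_bracket E Y X (Fl (r, y)))) r {min 0 t..max 0 t}"
proof -
  interpret Y: open_smooth_map E q E q W Y
    using Y by unfold_locales (auto simp: vector_field_def)
  define J where "J = {min 0 t..max 0 t}"
  define z where "z = (\<lambda>r. Fl (r, y))"
  have JI: "J \<subseteq> I" using t eps by (auto simp: J_def)
  have tJ: "t - s \<in> I" if "s \<in> J" for s using that t by (auto simp: J_def)
  have rJ: "r \<in> J" using r by (simp add: J_def)
  have zV: "z s \<in> V" if "s \<in> J" for s using orbit that by (simp add: z_def J_def)
  have zW: "z s \<in> W" if "s \<in> J" for s using zV[OF that] V_subset_W by blast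
  define F where "F = at r within J"
  have inJ: "\<forall>\<^sub>F s in F. s \<in> J" by (simp add: F_def eventually_at_filter)
  have ne: "\<forall>\<^sub>F s in F. s - r \<noteq> 0" by (simp add: F_def eventually_at_filter)
  have lim0: "((\<lambda>s. s - r) \<longlongrightarrow> 0) F" unfolding F_def
    by (rule tendsto_eq_intros refl | simp)+
  have zdiff: "limitin E (\<lambda>s. (z s - z r) /\<^sub>R (s - r)) (X (z r)) F"
    using E.has_vderiv_subset[OF Fl_vderiv JI] rJ JI y
    unfolding E.has_vderiv_def z_def F_def by blast
  then have zlim: "limitin E z (z r) F"
    using E.has_vderiv_limitin[of z "X (z r)" r J] zV[OF rJ] V_carrier
    unfolding E.has_vderiv_def F_def by blast
  have zrS: "z r \<in> topspace E" using zV[OF rJ] V_carrier by blast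
  have "limitin E (\<lambda>s. (Y (z r + (s - r) *\<^sub>R ((z s - z r) /\<^sub>R (s - r))) - Y (z r)) /\<^sub>R (s - r)) (Y.df (z r) (X (z r))) F"
    using zW[OF rJ] zrS by (intro Y.chain_rule E.limitin_konst zdiff lim0 ne)
  then have Ydiff: "limitin E (\<lambda>s. (Y (z s) - Y (z r)) /\<^sub>R (s - r)) (Y.df (z r) (X (z r))) F"
    by (rule E.limitin_cong_ev) (use ne in \<open>eventually_elim, simp\<close>)
  have Ylim: "limitin E (\<lambda>s. Y (z s)) (Y (z r)) F"
    by (rule Y.continuous[OF zW[OF rJ] zlim])
  \<comment> \<open>The time r - s is the negative of the increment s - r, so this term enters the
    derivative with a minus sign.\<close>
  have "limitin E (\<lambda>s. (push (r - s) (z s) (Y (z s)) - Y (z s)) /\<^sub>R (r - s)) (VF.df (z r) (Y (z r))) F"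
  proof (rule push_derivative_0[OF zV[OF rJ] zlim Ylim])
    show "((\<lambda>s. r - s) \<longlongrightarrow> 0) F" using tendsto_minus[OF lim0] by simp
    show "\<forall>\<^sub>F s in F. r - s \<noteq> 0" using ne by eventually_elim simp
  qed
  from E.limitin_minus[OF Ydiff this]
  have L: "limitin E (\<lambda>s. (push (r - s) (z s) (Y (z s)) - Y (z r)) /\<^sub>R (s - r)) (lie_bracket E Y X (z r)) F"
    (is "limitin E ?g _ F")
    unfolding lie_bracket_def dir_deriv_def Y.df_def[symmetric] VF.df_def[symmetric]
  proof (rule E.limitin_cong_ev)
    show "\<forall>\<^sub>F s in F. (Y (z s) - Y (z r)) /\<^sub>R (s - r) - (push (r - s) (z s) (Y (z s)) - Y (z s)) /\<^sub>R (r - s) = ?g s"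
    proof (rule always_eventually, rule allI)
      fix s
      have "inverse (r - s) = - inverse (s - r)" by (metis inverse_minus_eq minus_diff_eq)
      then show "(Y (z s) - Y (z r)) /\<^sub>R (s - r) - (push (r - s) (z s) (Y (z s)) - Y (z s)) /\<^sub>R (r - s) = ?g s"
        by (simp add: algebra_simps)
    qed
  qed
  have tr: "t - r \<in> I" by (rule tJ[OF rJ])
  have base: "limitin P (\<lambda>s. (t - r, z r)) (t - r, z r) F"
    using zrS by (intro P.limitin_konst) auto
  have "limitin P (\<lambda>s. (0, ?g s)) (0, lie_bracket E Y X (z r)) F" unfolding limitin_pair using L by simp
  then have L2: "limitin E (\<lambda>s. push (t - r) (z r) (?g s)) (push (t - r) (z r) (lie_bracket E Y X (z r))) F"
    unfolding push_def using tr zV[OF rJ] by (intro FL.df_continuous base) auto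
  have YS: "Y (z s) \<in> topspace E" if "s \<in> J" for s using Y.f_carrier zW[OF that] by blast
  have "\<forall>\<^sub>F s in F. push (t - r) (z r) (?g s) =
     (push (t - s) (z s) (Y (z s)) - push (t - r) (z r) (Y (z r))) /\<^sub>R (s - r)"
    using inJ
  proof eventually_elim
    case (elim s)
    \<comment> \<open>This time may be negative: here the flow is run backwards.\<close>
    have rs: "r - s \<in> I" using elim rJ t by (auto simp: J_def)
    have return: "Fl (r - s, z s) = z r"
      unfolding z_def using elim rJ JI y rs orbit by (subst Fl_group) (auto simp: J_def)
    have "push ((r - s) + (t - r)) (z s) (Y (z s)) = push (t - r) (Fl (r - s, z s)) (push (r - s) (z s) (Y (z s)))"
      using elim rs tr tJ[OF elim] zV rJ return YS by (intro push_cocycle) auto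
    then have "push (t - s) (z s) (Y (z s)) = push (t - r) (z r) (push (r - s) (z s) (Y (z s)))"
      by (simp add: return)
    then show ?case
      using tr zV[OF rJ] zV[OF elim] YS[OF elim] YS[OF rJ] rs
      by (simp add: push_scale push_diff push_carrier)
  qed
  with L2 have "limitin E (\<lambda>s. (push (t - s) (z s) (Y (z s)) - push (t - r) (z r) (Y (z r))) /\<^sub>R (s - r))
     (push (t - r) (z r) (lie_bracket E Y X (z r))) F"
    by (rule E.limitin_cong_ev)
  then show ?thesis unfolding E.has_vderiv_def F_def z_def J_def .
qed

end

section \<open>Flows preserve involutive distributions\<close>

lemma in_span_range_iff:
  fixes f :: "'n::finite \<Rightarrow> 'a::real_vector"
  assumes "inj f"
  shows "v \<in> span (range f) \<longleftrightarrow> (\<exists>c. v = (\<Sum>i\<in>UNIV. c i *\<^sub>R f i))"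
proof
  assume "v \<in> span (range f)"
  then obtain u where "v = (\<Sum>b\<in>range f. u b *\<^sub>R b)" using span_finite[of "range f"] by auto
  also have "\<dots> = (\<Sum>i\<in>UNIV. u (f i) *\<^sub>R f i)" using assms by (simp add: sum.reindex)
  finally show "\<exists>c. v = (\<Sum>i\<in>UNIV. c i *\<^sub>R f i)" by (rule exI[of _ "\<lambda>i. u (f i)"])
next
  assume "\<exists>c. v = (\<Sum>i\<in>UNIV. c i *\<^sub>R f i)"
  then show "v \<in> span (range f)" by (auto intro!: span_sum span_scale intro: span_base)
qed

lemma limitin_openinD: "limitin X f l F \<Longrightarrow> openin X U \<Longrightarrow> l \<in> U \<Longrightarrow> \<forall>\<^sub>F i in F. f i \<in> U"
  by (simp add: limitin_def)

text \<open>Involutivity enters the argument through \<open>bracket_D\<close>, for brackets of frame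
  fields.\<close>

locale frame = E: seminormed_space E q
  for E :: "'a::real_vector topology" and q :: "nat \<Rightarrow> 'a \<Rightarrow> real" +
  fixes W :: "'a set" and X :: "'n::finite \<Rightarrow> 'a \<Rightarrow> 'a" and D :: "'a \<Rightarrow> 'a set"
  assumes vf: "\<And>i. vector_field E W (X i)"
    and inj_X: "\<And>y. y \<in> W \<Longrightarrow> inj (\<lambda>i. X i y)"
    and indep_X: "\<And>y. y \<in> W \<Longrightarrow> independent (range (\<lambda>i. X i y))"
    and span_X: "\<And>y. y \<in> W \<Longrightarrow> span (range (\<lambda>i. X i y)) = D y"
    and bracket_D: "\<And>i j y. y \<in> W \<Longrightarrow> lie_bracket E (X i) (X j) y \<in> D y"
begin

lemma field_smooth: "open_smooth_map E q E q W (X i)"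
  using vf[of i] by unfold_locales (auto simp: vector_field_def)

lemma D_iff: "y \<in> W \<Longrightarrow> v \<in> D y \<longleftrightarrow> (\<exists>c. v = (\<Sum>i\<in>UNIV. c i *\<^sub>R X i y))"
  using in_span_range_iff[OF inj_X, of y v] span_X[of y] by simp

lemma X_in_D: "y \<in> W \<Longrightarrow> X i y \<in> D y"
  using span_X[of y] span_base[of "X i y" "range (\<lambda>i. X i y)"] by auto

lemma X_carrier: "y \<in> W \<Longrightarrow> X i y \<in> topspace E"
  using open_smooth_map.f_carrier[OF field_smooth] .

lemma D_subspace: "y \<in> W \<Longrightarrow> subspace (D y)"
  using subspace_span[of "range (\<lambda>i. X i y)"] span_X[of y] by simp

lemma D_carrier: "y \<in> W \<Longrightarrow> v \<in> D y \<Longrightarrow> v \<in> topspace E"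
  using D_iff X_carrier by (auto intro!: E.carrier_sum)

lemma dual_functionals:
  assumes "x0 \<in> W"
  obtains l where "\<And>k. E.cont_functional (l k)" "\<And>k j. l k (X j x0) = (if k = j then 1 else 0)"
proof -
  obtain f where f: "\<And>b. b \<in> range (\<lambda>i. X i x0) \<Longrightarrow> E.cont_functional (f b)"
    "\<And>b c. b \<in> range (\<lambda>i. X i x0) \<Longrightarrow> c \<in> range (\<lambda>i. X i x0) \<Longrightarrow> f b c = (if b = c then 1 else 0)"
    by (rule E.dual_basis[of "range (\<lambda>i. X i x0)"]) (use assms indep_X X_carrier in auto)
  show ?thesis
  proof (rule that[of "\<lambda>k. f (X k x0)"])
    show "E.cont_functional (f (X k x0))" for k using f(1) by blast
    show "f (X k x0) (X j x0) = (if k = j then 1 else 0)" for k j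
      using f(2)[of "X k x0" "X j x0"] inj_X[OF assms] by (auto simp: inj_def)
  qed
qed

lemma bracket_limit:
  assumes "x0 \<in> W" "limitin E z x0 F"
  shows "limitin E (\<lambda>s. lie_bracket E (X j) (X i) (z s)) (lie_bracket E (X j) (X i) x0) F"
proof -
  interpret Xi: open_smooth_map E q E q W "X i" by (rule field_smooth)
  interpret Xj: open_smooth_map E q E q W "X j" by (rule field_smooth)
  have "limitin E (\<lambda>s. Xj.df (z s) (X i (z s)) - Xi.df (z s) (X j (z s)))
     (Xj.df x0 (X i x0) - Xi.df x0 (X j x0)) F"
    using assms by (intro E.limitin_minus Xi.df_continuous Xj.df_continuous Xi.continuous Xj.continuous)
  then show ?thesis by (simp add: lie_bracket_def dir_deriv_def Xi.df_def Xj.df_def)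
qed

text \<open>Functionals dual to the frame at \<open>x0\<close> form a matrix close to the identity
  on the frame nearby, and their values on the brackets stay bounded by continuity, so
  \<open>near_identity_bound\<close> bounds the coefficients. Such a bound is what
  \<open>linear_system_zero\<close> asks for.\<close>

lemma bracket_coefficients:
  assumes x0: "x0 \<in> W"
  obtains Q K where "openin E Q" "x0 \<in> Q" "Q \<subseteq> W" "0 \<le> K"
    "\<And>z j. z \<in> Q \<Longrightarrow> \<exists>c. lie_bracket E (X j) (X i) z = (\<Sum>k\<in>UNIV. c k *\<^sub>R X k z) \<and> (\<forall>k. \<bar>c k\<bar> \<le> K)"
proof -
  obtain l where l: "\<And>k. E.cont_functional (l k)" "\<And>k j. l k (X j x0) = (if k = j then 1 else 0)"
    using dual_functionals[OF x0] by blast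
  define br where "br = (\<lambda>j z. lie_bracket E (X j) (X i) z)"
  \<comment> \<open>A strict upper bound for all values at \<open>x0\<close> at once; strictness
    makes it persist nearby.\<close>
  define b where "b = (\<Sum>j\<in>UNIV. \<Sum>k\<in>UNIV. \<bar>l k (br j x0)\<bar>) + 1"
  define F where "F = nhdsin E x0"
  have W: "openin E W" using vf by (auto simp: vector_field_def)
  have x0S: "x0 \<in> topspace E" using x0 W openin_subset by blast
  have id: "limitin E (\<lambda>z. z) x0 F" unfolding F_def by (rule limitin_nhdsin_self[OF x0S])
  have lX: "((\<lambda>z. l k (X j z)) \<longlongrightarrow> (if k = j then 1 else 0)) F" for k j
    using E.cont_functional_tendsto[OF l(1) open_smooth_map.continuous[OF field_smooth x0 id], of k j] l(2)
    by simp
  have "\<forall>\<^sub>F z in F. \<bar>l k (X j z) - (if k = j then 1 else 0)\<bar> < 1 / (2 * CARD('n))" for k j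
    using tendstoD[OF lX[of k j], of "1 / (2 * CARD('n))"] by (simp only: dist_real_def) simp
  then have e1: "\<forall>\<^sub>F z in F. \<forall>k\<in>UNIV. \<forall>j\<in>UNIV. \<bar>l k (X j z) - (if k = j then 1 else 0)\<bar> < 1 / (2 * CARD('n))"
    by (intro eventually_ball_finite ballI finite)
  have bb: "\<bar>l k (br j x0)\<bar> < b" for k j
  proof -
    have "\<bar>l k (br j x0)\<bar> \<le> (\<Sum>k\<in>UNIV. \<bar>l k (br j x0)\<bar>)" by (rule member_le_sum) auto
    also have "\<dots> \<le> (\<Sum>j\<in>UNIV. \<Sum>k\<in>UNIV. \<bar>l k (br j x0)\<bar>)"
      by (rule member_le_sum[of j UNIV "\<lambda>j. \<Sum>k\<in>UNIV. \<bar>l k (br j x0)\<bar>"]) (auto intro: sum_nonneg)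
    finally show ?thesis by (simp add: b_def)
  qed
  have "((\<lambda>z. \<bar>l k (br j z)\<bar>) \<longlongrightarrow> \<bar>l k (br j x0)\<bar>) F" for k j
    unfolding br_def by (intro tendsto_rabs E.cont_functional_tendsto[OF l(1)] bracket_limit[OF x0 id])
  then have "\<forall>\<^sub>F z in F. \<bar>l k (br j z)\<bar> < b" for k j
    by (rule order_tendstoD(2)) (rule bb)
  then have e2: "\<forall>\<^sub>F z in F. \<forall>k\<in>UNIV. \<forall>j\<in>UNIV. \<bar>l k (br j z)\<bar> < b"
    by (intro eventually_ball_finite ballI finite)
  have e3: "\<forall>\<^sub>F z in F. z \<in> W" using limitin_openinD[OF id W x0] .
  from e1 e2 e3 have "\<forall>\<^sub>F z in F. z \<in> W \<and>
    (\<forall>k\<in>UNIV. \<forall>j\<in>UNIV. \<bar>l k (X j z) - (if k = j then 1 else 0)\<bar> < 1 / (2 * CARD('n))) \<and>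
    (\<forall>k\<in>UNIV. \<forall>j\<in>UNIV. \<bar>l k (br j z)\<bar> < b)" by eventually_elim simp
  then obtain Q where Q: "openin E Q" "x0 \<in> Q" "\<And>z. z \<in> Q \<Longrightarrow> z \<in> W"
    "\<And>z k j. z \<in> Q \<Longrightarrow> \<bar>l k (X j z) - (if k = j then 1 else 0)\<bar> < 1 / (2 * CARD('n))"
    "\<And>z k j. z \<in> Q \<Longrightarrow> \<bar>l k (br j z)\<bar> < b"
    unfolding F_def eventually_nhdsin using x0S by auto
  show ?thesis
  proof (rule that[of Q "2 * b"])
    have "0 \<le> \<bar>l undefined (br undefined x0)\<bar>" by simp
    then show "0 \<le> 2 * b" using bb[of undefined undefined] by linarith
    fix z j assume z: "z \<in> Q"
    obtain c where c: "br j z = (\<Sum>k\<in>UNIV. c k *\<^sub>R X k z)"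
      using D_iff[OF Q(3)[OF z]] bracket_D[OF Q(3)[OF z], of j i] unfolding br_def by blast
    have "\<bar>c k\<bar> \<le> 2 * b" for k
    proof (rule near_identity_bound[of "\<lambda>k j. l k (X j z)"])
      show "\<bar>l k (X j z) - (if k = j then 1 else 0)\<bar> \<le> 1 / (2 * CARD('n))" for k j
        using Q(4)[OF z, of k j] by simp
      fix k
      note lin = E.cont_functional_linear[OF l(1)[of k]]
      have "l k (br j z) = (\<Sum>j\<in>UNIV. c j * l k (X j z))"
        unfolding c by (simp add: linear_sum[OF lin] linear_scale[OF lin])
      then show "\<bar>\<Sum>j\<in>UNIV. c j * l k (X j z)\<bar> \<le> b" using Q(5)[OF z, of k j] by simp
    qed
    then show "\<exists>c. lie_bracket E (X j) (X i) z = (\<Sum>k\<in>UNIV. c k *\<^sub>R X k z) \<and> (\<forall>k. \<bar>c k\<bar> \<le> 2 * b)"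
      using c unfolding br_def by blast
  qed (use Q in auto)
qed

text \<open>
  A functional annihilating \<open>D\<close> at the end point of an orbit turns the pushed forward frame
  into a solution of a homogeneous linear system that vanishes at one end, hence everywhere.
  This replaces uniqueness for linear equations in \<open>E\<close>, which fails in Frechet spaces.
\<close>

lemma flow_preserves_D:
  assumes x0: "x0 \<in> W" "x0 \<in> V" and fl: "local_flow E q W (X i) \<epsilon> V Fl"
  obtains \<delta> Q where "0 < \<delta>" "\<delta> \<le> \<epsilon>" "openin E Q" "x0 \<in> Q" "Q \<subseteq> V"
    "\<And>t y a w. \<bar>t\<bar> < \<delta> \<Longrightarrow> y \<in> Q \<Longrightarrow> w \<in> D y \<Longrightarrow> open_smooth_map.df E Fl (t, y) (a, w) \<in> D (Fl (t, y))"
proof -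
  interpret L: local_flow E q W "X i" \<epsilon> V Fl by (rule fl)
  obtain R K where R: "openin E R" "x0 \<in> R" "R \<subseteq> W" "0 \<le> K"
    "\<And>z j. z \<in> R \<Longrightarrow> \<exists>c. lie_bracket E (X j) (X i) z = (\<Sum>k\<in>UNIV. c k *\<^sub>R X k z) \<and> (\<forall>k. \<bar>c k\<bar> \<le> K)"
    by (rule bracket_coefficients[OF x0(1), where i=i]) (rule that)
  have x0S: "x0 \<in> topspace E" using x0 L.V_carrier by blast
  have 0: "(0, x0) \<in> {-\<epsilon><..<\<epsilon>} \<times> V" using x0(2) L.eps by simp
  have "limitin L.P (\<lambda>z. z) (0, x0) (nhdsin L.P (0, x0))"
    using x0S by (intro limitin_nhdsin_self) simp
  from L.FL.continuous[OF 0 this] have lim: "limitin E Fl x0 (nhdsin L.P (0, x0))"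
    by (simp add: L.Fl_0[OF x0(2)])
  have "openin E (V \<inter> R)" using R(1) L.V_open by blast
  then have "\<forall>\<^sub>F z in nhdsin L.P (0, x0). Fl z \<in> V \<inter> R"
    using limitin_openinD[OF lim] x0(2) R(2) by blast
  then obtain O1 where O1: "openin L.P O1" "(0, x0) \<in> O1" "\<And>z. z \<in> O1 \<Longrightarrow> Fl z \<in> V \<inter> R"
    unfolding eventually_nhdsin using x0S by auto
  obtain N e where e: "e > 0" "\<And>z. z \<in> topspace L.P \<Longrightarrow> L.pq N (z - (0, x0)) < e \<Longrightarrow> z \<in> O1"
    by (rule L.P.openin_ballE[OF O1(1,2)]) (rule that)
  \<comment> \<open>Half of e goes to time and half to space, since the seminorm on the product is a
    sum.\<close>
  define \<delta> where "\<delta> = min \<epsilon> (e / 2)"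
  define Q where "Q = V \<inter> {y \<in> topspace E. q N (y - x0) < e / 2}"
  have orbit: "Fl (t, y) \<in> V \<inter> R" if "\<bar>t\<bar> < \<delta>" "y \<in> Q" for t y
    using that by (intro O1(3) e(2)) (auto simp: \<delta>_def Q_def)
  have main: "L.push t y (X j y) \<in> D (Fl (t, y))" if t: "\<bar>t\<bar> < \<delta>" and y: "y \<in> Q" for t y j
  proof -
    define J where "J = {min 0 t..max 0 t}"
    define z where "z = (\<lambda>r. Fl (r, y))"
    \<comment> \<open>The frame at time r of the orbit, transported to the end of the orbit: r = t
      gives the frame there, r = 0 the pushed forward vectors in question.\<close>
    define A where "A = (\<lambda>j r. L.push (t - r) (z r) (X j (z r)))"
    have tI: "t \<in> {-\<epsilon><..<\<epsilon>}" using t by (auto simp: \<delta>_def)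
    have yV: "y \<in> V" using y by (simp add: Q_def)
    have J_le: "\<bar>r\<bar> < \<delta>" if "r \<in> J" for r using that t by (auto simp: J_def)
    have zVR: "z r \<in> V" "z r \<in> R" if "r \<in> J" for r using orbit[OF J_le[OF that] y] by (auto simp: z_def)
    have zW: "z r \<in> W" if "r \<in> J" for r using zVR[OF that] R(3) by blast
    have tJ: "t \<in> J" "0 \<in> J" by (auto simp: J_def)
    have trI: "t - r \<in> {-\<epsilon><..<\<epsilon>}" if "r \<in> J" for r using that tI by (auto simp: J_def)
    have A_deriv: "E.has_vderiv (A j) (L.push (t - r) (z r) (lie_bracket E (X j) (X i) (z r))) r J"
      if r: "r \<in> J" for r j
      unfolding A_def z_def J_def
      using zVR(1) r by (intro L.push_bracket_derivative vf tI yV) (auto simp: z_def J_def)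
    have At: "A j t = X j (z t)" for j
      using L.push_0[OF zVR(1)[OF tJ(1)] X_carrier[OF zW[OF tJ(1)]], of j] by (simp add: A_def)
    have A0: "A j 0 = L.push t y (X j y)" for j
      by (simp add: A_def z_def L.Fl_0[OF yV])
    have "A j 0 \<in> span (range (\<lambda>k. X k (z t)))"
    proof (rule E.separate_from_span)
      show "finite (range (\<lambda>k. X k (z t)))" "independent (range (\<lambda>k. X k (z t)))"
        "range (\<lambda>k. X k (z t)) \<subseteq> topspace E"
        using indep_X[OF zW[OF tJ(1)]] X_carrier[OF zW[OF tJ(1)]] by auto
      show "A j 0 \<in> topspace E"
        unfolding A_def using trI[OF tJ(2)] zVR(1)[OF tJ(2)] X_carrier[OF zW[OF tJ(2)]]
        by (intro L.push_carrier) auto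
      fix l assume l: "E.cont_functional l" "\<And>b. b \<in> range (\<lambda>k. X k (z t)) \<Longrightarrow> l b = 0"
      note lin = E.cont_functional_linear[OF l(1)]
      obtain C N' where C: "\<And>x. \<bar>l x\<bar> \<le> C * q N' x" using l(1) unfolding E.cont_functional_def by blast
      show "l (A j 0) = 0"
      proof (rule linear_system_zero[of t "\<lambda>j r. l (A j r)" "\<lambda>j r. l (L.push (t - r) (z r) (lie_bracket E (X j) (X i) (z r)))" K, folded J_def])
        fix j r assume r: "r \<in> J"
        show "((\<lambda>r. l (A j r)) has_real_derivative l (L.push (t - r) (z r) (lie_bracket E (X j) (X i) (z r)))) (at r within J)"
          by (rule E.has_vderiv_functional[OF A_deriv[OF r] lin C])
        obtain c where c: "lie_bracket E (X j) (X i) (z r) = (\<Sum>k\<in>UNIV. c k *\<^sub>R X k (z r))" "\<And>k. \<bar>c k\<bar> \<le> K"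
          using R(5)[OF zVR(2)[OF r], of j] by blast
        \<comment> \<open>Linearity of the push turns the expansion of the bracket into a linear
          system for the family \<open>A\<close>, with bounded coefficients.\<close>
        have "L.push (t - r) (z r) (lie_bracket E (X j) (X i) (z r)) = (\<Sum>k\<in>UNIV. c k *\<^sub>R A k r)"
          unfolding c(1) A_def using trI[OF r] zVR(1)[OF r] X_carrier[OF zW[OF r]]
          by (subst L.push_sum) (auto simp: L.push_scale)
        then have "\<bar>l (L.push (t - r) (z r) (lie_bracket E (X j) (X i) (z r)))\<bar> \<le> (\<Sum>k\<in>UNIV. \<bar>c k * l (A k r)\<bar>)"
          by (simp add: linear_sum[OF lin] linear_scale[OF lin] sum_abs)
        also have "\<dots> \<le> K * (\<Sum>k\<in>UNIV. \<bar>l (A k r)\<bar>)"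
          unfolding sum_distrib_left abs_mult using c(2) by (intro sum_mono mult_right_mono) auto
        finally show "\<bar>l (L.push (t - r) (z r) (lie_bracket E (X j) (X i) (z r)))\<bar> \<le> K * (\<Sum>k\<in>UNIV. \<bar>l (A k r)\<bar>)" .
      qed (use l(2) At R(4) in auto)
    qed
    then show ?thesis using span_X[OF zW[OF tJ(1)]] A0 by (simp add: z_def)
  qed
  show ?thesis
  proof (rule that[of \<delta> Q])
    show "0 < \<delta>" "\<delta> \<le> \<epsilon>" using e(1) L.eps by (auto simp: \<delta>_def)
    show "openin E Q" unfolding Q_def by (intro openin_Int L.V_open E.openin_ball x0S)
    show "x0 \<in> Q" using x0 x0S e(1) by (simp add: Q_def)
    show "Q \<subseteq> V" by (simp add: Q_def)
    fix t y a w assume t: "\<bar>t\<bar> < \<delta>" and y: "y \<in> Q" and w: "w \<in> D y"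
    have yV: "y \<in> V" using y by (simp add: Q_def)
    then have yW: "y \<in> W" using L.V_subset_W by blast
    have tI: "t \<in> {-\<epsilon><..<\<epsilon>}" using t by (auto simp: \<delta>_def)
    have zW: "Fl (t, y) \<in> W" by (rule L.Fl_W[OF tI yV])
    obtain c where c: "w = (\<Sum>k\<in>UNIV. c k *\<^sub>R X k y)" using D_iff[OF yW] w by blast
    have "L.push t y w = (\<Sum>k\<in>UNIV. c k *\<^sub>R L.push t y (X k y))"
      unfolding c using tI yV X_carrier[OF yW] by (subst L.push_sum) (auto simp: L.push_scale)
    also have "\<dots> \<in> D (Fl (t, y))"
      using D_subspace[OF zW] main[OF t y] by (intro subspace_sum subspace_scale)
    finally have "L.push t y w \<in> D (Fl (t, y))" .
    moreover have "L.FL.df (t, y) (a, w) = a *\<^sub>R X i (Fl (t, y)) + L.push t y w"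
      by (rule L.df_split[OF tI yV D_carrier[OF yW w]])
    ultimately show "L.FL.df (t, y) (a, w) \<in> D (Fl (t, y))"
      using D_subspace[OF zW] X_in_D[OF zW] by (simp add: subspace_add subspace_scale)
  qed
qed

end

section \<open>Charts composed of flows\<close>

lemma smooth_map_subset: "smooth_map S A T f \<Longrightarrow> B \<subseteq> A \<Longrightarrow> smooth_map S B T f"
  unfolding smooth_map_def by blast

locale frame_with_flows = frame E q W X D
  for E :: "'a::real_vector topology" and q :: "nat \<Rightarrow> 'a \<Rightarrow> real" and W :: "'a set"
    and X :: "'n::{finite,linorder} \<Rightarrow> 'a \<Rightarrow> 'a" and D :: "'a \<Rightarrow> 'a set" +
  fixes x0 :: 'a
  assumes x0: "x0 \<in> W"
    and flows: "\<And>i. i \<noteq> Max UNIV \<Longrightarrow> \<exists>\<epsilon> V Fl. local_flow E q W (X i) \<epsilon> V Fl \<and> x0 \<in> V"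
    and semiflow: "\<exists>\<epsilon>>0. \<exists>V Fl. openin E V \<and> x0 \<in> V \<and> flow_on E W (X (Max UNIV)) {0..<\<epsilon>} V Fl"
begin

lemma W_open: "openin E W" using vf by (auto simp: vector_field_def)

lemma x0_carrier: "x0 \<in> topspace E" using x0 W_open openin_subset by blast

definition near :: "nat \<Rightarrow> real \<Rightarrow> ((real, 'n) vec \<times> 'a) set" where
  "near M \<delta> = {u \<in> half_space. norm u < \<delta>} \<times> {x \<in> topspace E. q M (x - x0) < \<delta>}"

text \<open>One-sided neighbourhoods of (0, x0), the point itself included. Conditions near the base
  point are stated with this filter, so that finitely many of them can be met by shrinking the
  domain once.\<close>

definition near_filter :: "((real, 'n) vec \<times> 'a) filter" where
  "near_filter = (INF (M, \<delta>)\<in>UNIV \<times> {0<..}. principal (near M \<delta>))"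

lemma near_mono: "M \<le> M' \<Longrightarrow> \<delta>' \<le> \<delta> \<Longrightarrow> near M' \<delta>' \<subseteq> near M \<delta>"
  unfolding near_def using E.q_mono by (fastforce intro: order.strict_trans1 order_le_less_trans)

lemma eventually_near: "eventually P near_filter \<longleftrightarrow> (\<exists>M \<delta>. \<delta> > 0 \<and> (\<forall>z\<in>near M \<delta>. P z))"
proof -
  have "eventually P near_filter \<longleftrightarrow>
    (\<exists>b\<in>UNIV \<times> {0<..}. eventually P (case b of (M, \<delta>) \<Rightarrow> principal (near M \<delta>)))"
    unfolding near_filter_def
  proof (rule eventually_INF_base)
    show "UNIV \<times> {0<..} \<noteq> ({} :: (nat \<times> real) set)" by (auto intro: gt_ex)
    fix a b :: "nat \<times> real" assume ab: "a \<in> UNIV \<times> {0<..}" "b \<in> UNIV \<times> {0<..}"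
    have "near (max (fst a) (fst b)) (min (snd a) (snd b)) \<subseteq> near (fst a) (snd a) \<inter> near (fst b) (snd b)"
      using near_mono[of "fst a" "max (fst a) (fst b)" "min (snd a) (snd b)" "snd a"]
        near_mono[of "fst b" "max (fst a) (fst b)" "min (snd a) (snd b)" "snd b"] by simp
    then show "\<exists>x\<in>UNIV \<times> {0<..}. (case x of (M, \<delta>) \<Rightarrow> principal (near M \<delta>)) \<le>
       inf (case a of (M, \<delta>) \<Rightarrow> principal (near M \<delta>)) (case b of (M, \<delta>) \<Rightarrow> principal (near M \<delta>))"
      using ab by (intro bexI[of _ "(max (fst a) (fst b), min (snd a) (snd b))"])
        (auto simp: split_beta)
  qed
  then show ?thesis by (auto simp: eventually_principal)
qed

lemma zero_in_half_space: "0 \<in> half_space"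
  by (simp add: half_space_def)

lemma tendsto_near_coordinate: "((\<lambda>z. fst z $ i) \<longlongrightarrow> 0) near_filter"
proof (rule tendstoI)
  fix e :: real assume "e > 0"
  moreover have "dist (fst z $ i) 0 < e" if "z \<in> near 0 e" for z
    using that component_le_norm_cart[of "fst z" i] by (auto simp: near_def)
  ultimately show "\<forall>\<^sub>F z in near_filter. dist (fst z $ i) 0 < e"
    unfolding eventually_near by blast
qed

lemma limitin_near_snd: "limitin E snd x0 near_filter"
  unfolding E.limitin_iff
proof (intro conjI allI)
  show "x0 \<in> topspace E" by (rule x0_carrier)
  show "\<forall>\<^sub>F z in near_filter. snd z \<in> topspace E"
    unfolding eventually_near by (rule exI[of _ 0], rule exI[of _ 1]) (auto simp: near_def)
  fix k
  show "((\<lambda>z. q k (snd z - x0)) \<longlongrightarrow> 0) near_filter"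
  proof (rule tendstoI)
    fix e :: real assume "e > 0"
    moreover have "dist (q k (snd z - x0)) 0 < e" if "z \<in> near k e" for z
      using that by (auto simp: near_def)
    ultimately show "\<forall>\<^sub>F z in near_filter. dist (q k (snd z - x0)) 0 < e"
      unfolding eventually_near by blast
  qed
qed

text \<open>
  The composition of the flows with indices in \<open>J\<close>, restricted to a neighbourhood of the base
  point; \<open>v k\<close> is its partial derivative in direction \<open>k\<close>.
\<close>

definition is_chart :: "'n set \<Rightarrow> nat \<Rightarrow> real \<Rightarrow> ((real, 'n) vec \<times> 'a \<Rightarrow> 'a) \<Rightarrow> ('n \<Rightarrow> (real, 'n) vec \<times> 'a \<Rightarrow> 'a) \<Rightarrow> bool"
  where
  "is_chart J M \<delta> \<Phi> v \<longleftrightarrow>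
     smooth_map (prod_topology euclidean E) (near M \<delta>) E \<Phi> \<and>
     \<Phi> ` near M \<delta> \<subseteq> W \<and>
     (\<forall>u x. (u, x) \<in> near M \<delta> \<longrightarrow>
        (\<forall>k. v k (u, x) \<in> D (\<Phi> (u, x))) \<and> (\<forall>k. k \<notin> J \<longrightarrow> v k (u, x) = 0) \<and>
        (\<forall>h. (\<forall>\<^sub>F s in at_right 0. u + s *\<^sub>R h \<in> half_space) \<longrightarrow>
           limitin E (\<lambda>s. (\<Phi> (u + s *\<^sub>R h, x) - \<Phi> (u, x)) /\<^sub>R s) (\<Sum>k\<in>UNIV. h $ k *\<^sub>R v k (u, x)) (at_right 0))) \<and>
     limitin E \<Phi> x0 near_filter \<and> \<Phi> (0, x0) = x0 \<and>
     (\<forall>k\<in>J. limitin E (v k) (X k x0) near_filter) \<and>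
     (\<forall>h. \<forall>w\<in>topspace E. (\<forall>\<^sub>F s in at_right 0. s *\<^sub>R h \<in> half_space) \<longrightarrow>
        limitin E (\<lambda>s. (\<Phi> (s *\<^sub>R h, x0 + s *\<^sub>R w) - x0) /\<^sub>R s) ((\<Sum>k\<in>J. h $ k *\<^sub>R X k x0) + w) (at_right 0))"

lemma is_chart_shrink:
  assumes "is_chart J M \<delta> \<Phi> v" "eventually P near_filter" "\<delta> > 0"
  obtains M' \<delta>' where "\<delta>' > 0" "is_chart J M' \<delta>' \<Phi> v" "\<And>z. z \<in> near M' \<delta>' \<Longrightarrow> P z"
proof -
  obtain M1 \<delta>1 where 1: "\<delta>1 > 0" "\<And>z. z \<in> near M1 \<delta>1 \<Longrightarrow> P z"
    using assms(2) unfolding eventually_near by blast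
  have sub: "near (max M M1) (min \<delta> \<delta>1) \<subseteq> near M \<delta>" "near (max M M1) (min \<delta> \<delta>1) \<subseteq> near M1 \<delta>1"
    by (rule near_mono; simp)+
  show ?thesis
  proof (rule that[of "min \<delta> \<delta>1" "max M M1"])
    show "is_chart J (max M M1) (min \<delta> \<delta>1) \<Phi> v"
      using assms(1) sub(1) smooth_map_subset[OF _ sub(1)] unfolding is_chart_def
      by (elim conjE, intro conjI) (assumption | blast)+
  qed (use 1 sub assms(3) in auto)
qed

lemma smooth_coordinate_curve:
  assumes "smooth_curve (prod_topology euclidean E) c"
  shows "smooth_curve euclideanreal (\<lambda>t. fst (c t) $ i)"
proof -
  have "smooth_curve euclidean (fst \<circ> c)" using assms by (simp add: smooth_curve_prod_iff)
  from smooth_curve_vec_nth[OF this, of i] show ?thesis by simp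
qed

text \<open>With a single orbit parameter the derivative in its direction is the field at the end of
  the orbit, which lies in \<open>D\<close>. The derivative in transversal directions is established
  at the base point, by the mean value inequality in time starting from the identity at time
  0.\<close>

lemma semiflow_chart:
  "\<exists>M \<delta> \<Phi> v. \<delta> > 0 \<and> is_chart {Max UNIV} M \<delta> \<Phi> v"
proof -
  define m :: 'n where "m = Max UNIV"
  obtain \<epsilon> V Fl where \<epsilon>: "\<epsilon> > 0" and V: "openin E V" "x0 \<in> V" and fl: "flow_on E W (X m) {0..<\<epsilon>} V Fl"
    using semiflow unfolding m_def by blast
  define P where "P = prod_topology euclideanreal E"
  define A where "A = {0..<\<epsilon>} \<times> V"
  have Fl_smooth: "smooth_map P A E Fl" and Fl_W: "\<And>z. z \<in> A \<Longrightarrow> Fl z \<in> W"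
    and Fl_0: "\<And>y. y \<in> V \<Longrightarrow> Fl (0, y) = y"
    and Fl_deriv: "\<And>t y. t \<in> {0..<\<epsilon>} \<Longrightarrow> y \<in> V \<Longrightarrow> E.has_vderiv (\<lambda>s. Fl (s, y)) (X m (Fl (t, y))) t {0..<\<epsilon>}"
    using fl unfolding flow_on_def A_def P_def E.has_vderiv_def by blast+
  interpret P: seminormed_space P "\<lambda>k z. \<bar>fst z\<bar> + q k (snd z)"
    unfolding P_def by (rule E.seminormed_space_prod_real)
  interpret PE: seminormed_pair P "\<lambda>k z. \<bar>fst z\<bar> + q k (snd z)" E q ..
  interpret Xm: open_smooth_map E q E q W "X m" by (rule field_smooth)
  have VS: "V \<subseteq> topspace E" using V(1) openin_subset by blast
  have 0: "(0, x0) \<in> A" using \<epsilon> V by (simp add: A_def)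
  obtain M0 \<delta>0 where b: "\<delta>0 > 0" "\<And>y. y \<in> topspace E \<Longrightarrow> q M0 (y - x0) < \<delta>0 \<Longrightarrow> y \<in> V"
    by (rule E.openin_ballE[OF V]) (rule that)
  \<comment> \<open>The hypothesis of \<open>smooth_map_continuous\<close>: a half-open time
    interval times a ball is star-shaped around (0, x0), although this point lies on its
    boundary.\<close>
  have star: "(0, x0) + s *\<^sub>R (z - (0, x0)) \<in> A"
    if z: "z \<in> A" "\<bar>fst (z - (0, x0))\<bar> + q M0 (snd (z - (0, x0))) < \<delta>0" and s: "0 \<le> s" "s \<le> 1" for z s
  proof -
    have y: "snd z \<in> topspace E" using z(1) VS by (auto simp: A_def)
    have "q M0 (s *\<^sub>R (snd z - x0)) \<le> q M0 (snd z - x0)"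
      unfolding E.q_scale using s by (simp add: mult_left_le_one_le)
    also have "\<dots> < \<delta>0" using z(2) by simp
    finally have "x0 + s *\<^sub>R (snd z - x0) \<in> V" using y x0_carrier by (intro b(2)) auto
    moreover have "s * fst z \<le> fst z" using s z(1) by (intro mult_left_le_one_le) (auto simp: A_def)
    then have "s * fst z \<in> {0..<\<epsilon>}" using s z(1) by (auto simp: A_def)
    ultimately show ?thesis by (cases z) (simp add: A_def)
  qed
  have XFl_smooth: "smooth_map P A E (\<lambda>z. X m (Fl z))"
    using Fl_W by (intro smooth_map_compose[OF Fl_smooth Xm.smooth]) blast
  define p where "p = (\<lambda>z :: (real, 'n) vec \<times> 'a. (fst z $ m, snd z))"
  define \<Phi> where "\<Phi> = (\<lambda>z. Fl (p z))"
  define v where "v = (\<lambda>k z. if k = m then X m (\<Phi> z) else 0)"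
  have p_lim: "limitin P p (0, x0) near_filter"
    unfolding P_def p_def limitin_pair using tendsto_near_coordinate limitin_near_snd by simp
  have "\<forall>\<^sub>F z in near_filter. z \<in> near 0 1"
    unfolding eventually_near by (rule exI[of _ 0], rule exI[of _ 1]) simp
  moreover have "\<forall>\<^sub>F z in near_filter. fst z $ m < \<epsilon>"
    using order_tendstoD(2)[OF tendsto_near_coordinate \<epsilon>] .
  moreover have "\<forall>\<^sub>F z in near_filter. snd z \<in> V"
    by (rule limitin_openinD[OF limitin_near_snd V])
  ultimately have pA_ev: "\<forall>\<^sub>F z in near_filter. p z \<in> A"
    by eventually_elim (auto simp: p_def A_def near_def half_space_def m_def)
  then obtain M \<delta> where \<delta>: "\<delta> > 0" and pA: "\<And>z. z \<in> near M \<delta> \<Longrightarrow> p z \<in> A"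
    unfolding eventually_near by blast
  have \<Phi>W: "\<Phi> z \<in> W" if "z \<in> near M \<delta>" for z
    unfolding \<Phi>_def by (rule Fl_W[OF pA[OF that]])
  have \<Phi>_lim: "limitin E \<Phi> x0 near_filter"
    using PE.smooth_map_limitin[OF Fl_smooth 0 p_lim pA_ev b(1) star] Fl_0[OF V(2)]
    by (simp add: \<Phi>_def)
  have half_ge: "0 \<le> (u + s *\<^sub>R h) $ m" if "u + s *\<^sub>R h \<in> half_space" for u h :: "(real, 'n) vec" and s
    using that by (simp add: half_space_def m_def)
  have "is_chart {m} M \<delta> \<Phi> v"
    unfolding is_chart_def
  proof (intro conjI allI impI ballI)
    show "smooth_map (prod_topology euclidean E) (near M \<delta>) E \<Phi>"
      unfolding smooth_map_def
    proof (intro conjI allI impI)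
      show "near M \<delta> \<subseteq> topspace (prod_topology euclidean E)" by (auto simp: near_def)
      show "\<Phi> ` near M \<delta> \<subseteq> topspace E" using \<Phi>W W_open openin_subset by blast
      fix c assume c: "smooth_curve (prod_topology euclidean E) c \<and> range c \<subseteq> near M \<delta>"
      have "smooth_curve P (p \<circ> c)"
        unfolding P_def smooth_curve_prod_iff
        using c smooth_coordinate_curve[of c m] by (simp add: smooth_curve_prod_iff p_def o_def)
      moreover have "range (p \<circ> c) \<subseteq> A" using c pA by (simp add: image_subset_iff del: split_paired_All)
      ultimately have "smooth_curve E (Fl \<circ> (p \<circ> c))" using Fl_smooth by (auto simp: smooth_map_def)
      then show "smooth_curve E (\<Phi> \<circ> c)" by (simp add: \<Phi>_def o_def)
    qed
    show "\<Phi> ` near M \<delta> \<subseteq> W" using \<Phi>W by blast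
    show "limitin E \<Phi> x0 near_filter" by (rule \<Phi>_lim)
    show "\<Phi> (0, x0) = x0" by (simp add: \<Phi>_def p_def Fl_0 V)
    show "limitin E (v k) (X k x0) near_filter" if "k \<in> {m}" for k
      using Xm.continuous[OF x0 \<Phi>_lim] that by (simp add: v_def)
  next
    fix u x k assume z: "(u, x) \<in> near M \<delta>"
    show "v k (u, x) \<in> D (\<Phi> (u, x))"
      using X_in_D[OF \<Phi>W[OF z]] D_subspace[OF \<Phi>W[OF z]] by (simp add: v_def subspace_0)
    show "v k (u, x) = 0" if "k \<notin> {m}" using that by (simp add: v_def)
  next
    fix u x h assume z: "(u, x) \<in> near M \<delta>" and h: "\<forall>\<^sub>F s in at_right 0. u + s *\<^sub>R h \<in> half_space"
    define t where "t = u $ m"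
    have tA: "t \<in> {0..<\<epsilon>}" "x \<in> V" using pA[OF z] by (auto simp: p_def t_def A_def)
    have S: "(\<Sum>k\<in>UNIV. h $ k *\<^sub>R v k (u, x)) = h $ m *\<^sub>R X m (Fl (t, x))"
    proof -
      have "(\<Sum>k\<in>UNIV. h $ k *\<^sub>R v k (u, x)) = (\<Sum>k\<in>UNIV. if k = m then h $ m *\<^sub>R X m (\<Phi> (u, x)) else 0)"
        by (intro sum.cong refl) (simp add: v_def)
      then show ?thesis by (simp add: \<Phi>_def p_def t_def)
    qed
    have ne: "\<forall>\<^sub>F s in at_right (0::real). s > 0" by (simp add: eventually_at_filter)
    show "limitin E (\<lambda>s. (\<Phi> (u + s *\<^sub>R h, x) - \<Phi> (u, x)) /\<^sub>R s) (\<Sum>k\<in>UNIV. h $ k *\<^sub>R v k (u, x)) (at_right 0)"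
      unfolding S
    \<comment> \<open>For \<open>h $ m = 0\<close> the quotient is constantly 0; otherwise the times
      approached differ from t, as the limit defining the derivative of the orbit requires.\<close>
    proof (cases "h $ m = 0")
      case True
      then show "limitin E (\<lambda>s. (\<Phi> (u + s *\<^sub>R h, x) - \<Phi> (u, x)) /\<^sub>R s) (h $ m *\<^sub>R X m (Fl (t, x))) (at_right 0)"
        by (simp add: \<Phi>_def p_def E.limitin_konst)
    next
      case False
      have "((\<lambda>s. t + s * h $ m) \<longlongrightarrow> t + 0 * h $ m) (at_right 0)" by (intro tendsto_intros)
      then have lim: "((\<lambda>s. t + s * h $ m) \<longlongrightarrow> t) (at_right 0)" by simp
      have "filterlim (\<lambda>s. t + s * h $ m) (at t within {0..<\<epsilon>}) (at_right 0)"
        unfolding filterlim_at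
      proof (intro conjI lim)
        have "\<forall>\<^sub>F s in at_right 0. t + s * h $ m < \<epsilon>" using order_tendstoD(2)[OF lim] tA(1) by simp
        with h ne show "\<forall>\<^sub>F s in at_right 0. t + s * h $ m \<in> {0..<\<epsilon>} \<and> t + s * h $ m \<noteq> t"
        proof eventually_elim
          case (elim s)
          then show ?case using half_ge[of u s h] False by (simp add: t_def)
        qed
      qed
      from E.limitin_compose_filterlim[OF Fl_deriv[OF tA, unfolded E.has_vderiv_def] this]
      have "limitin E (\<lambda>s. h $ m *\<^sub>R ((Fl (t + s * h $ m, x) - Fl (t, x)) /\<^sub>R (t + s * h $ m - t)))
         (h $ m *\<^sub>R X m (Fl (t, x))) (at_right 0)"
        by (intro E.limitin_scale tendsto_const)
      then show "limitin E (\<lambda>s. (\<Phi> (u + s *\<^sub>R h, x) - \<Phi> (u, x)) /\<^sub>R s) (h $ m *\<^sub>R X m (Fl (t, x))) (at_right 0)"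
      proof (rule E.limitin_cong_ev)
        show "\<forall>\<^sub>F s in at_right 0. h $ m *\<^sub>R ((Fl (t + s * h $ m, x) - Fl (t, x)) /\<^sub>R (t + s * h $ m - t)) =
          (\<Phi> (u + s *\<^sub>R h, x) - \<Phi> (u, x)) /\<^sub>R s"
          using ne by eventually_elim (use False in \<open>simp add: \<Phi>_def p_def t_def\<close>)
      qed
    qed
  next
    fix h :: "(real, 'n) vec" and w assume w: "w \<in> topspace E" and h: "\<forall>\<^sub>F s in at_right 0. s *\<^sub>R h \<in> half_space"
    have ne: "\<forall>\<^sub>F s in at_right (0::real). s > 0" by (simp add: eventually_at_filter)
    from h ne have "\<forall>\<^sub>F s in at_right (0::real). 0 \<le> h $ m"
      by eventually_elim (auto simp: half_space_def m_def zero_le_mult_iff)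
    \<comment> \<open>An inward direction at 0 has nonnegative last coordinate, so the semiflow is
      evaluated at nonnegative times only.\<close>
    then have hm: "0 \<le> h $ m" by simp
    define Y where "Y = X m x0"
    have YS: "Y \<in> topspace E" using X_carrier[OF x0] by (simp add: Y_def)
    have id: "((\<lambda>s. s) \<longlongrightarrow> 0) (at_right (0::real))" by (rule tendsto_ident_at)
    have xlim: "limitin E (\<lambda>s. x0 + s *\<^sub>R w) (x0 + 0 *\<^sub>R w) (at_right 0)"
      by (intro E.limitin_plus E.limitin_scale E.limitin_konst x0_carrier w id)
    have xV: "\<forall>\<^sub>F s in at_right 0. x0 + s *\<^sub>R w \<in> V" using limitin_openinD[OF xlim V(1)] V(2) by simp
    have "((\<lambda>s. s * h $ m) \<longlongrightarrow> 0 * h $ m) (at_right 0)" by (intro tendsto_intros)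
    then have slim: "((\<lambda>s. s * h $ m) \<longlongrightarrow> 0) (at_right 0)" by simp
    have s\<epsilon>: "\<forall>\<^sub>F s in at_right 0. s * h $ m < \<epsilon>" using order_tendstoD(2)[OF slim \<epsilon>] .
    show "limitin E (\<lambda>s. (\<Phi> (s *\<^sub>R h, x0 + s *\<^sub>R w) - x0) /\<^sub>R s) ((\<Sum>k\<in>{m}. h $ k *\<^sub>R X k x0) + w) (at_right 0)"
      unfolding E.limitin_iff
    proof (intro conjI allI)
      show "(\<Sum>k\<in>{m}. h $ k *\<^sub>R X k x0) + w \<in> topspace E" using YS w by (auto simp: Y_def)
      show "\<forall>\<^sub>F s in at_right 0. (\<Phi> (s *\<^sub>R h, x0 + s *\<^sub>R w) - x0) /\<^sub>R s \<in> topspace E"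
        using xV s\<epsilon> ne
      proof eventually_elim
        case (elim s)
        then have "(s * h $ m, x0 + s *\<^sub>R w) \<in> A" using hm by (simp add: A_def)
        from Fl_W[OF this] have "Fl (s * h $ m, x0 + s *\<^sub>R w) \<in> topspace E" using W_open openin_subset by blast
        then show ?case using x0_carrier by (auto simp: \<Phi>_def p_def)
      qed
      fix N
      show "((\<lambda>s. q N ((\<Phi> (s *\<^sub>R h, x0 + s *\<^sub>R w) - x0) /\<^sub>R s - ((\<Sum>k\<in>{m}. h $ k *\<^sub>R X k x0) + w))) \<longlongrightarrow> 0) (at_right 0)"
      proof (rule tendstoI)
        fix e :: real assume e: "e > 0"
        \<comment> \<open>The tolerance per unit of time. The orbit runs for time s times
          \<open>h $ m\<close>, and the added 1 covers \<open>h $ m = 0\<close>.\<close>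
        define e' where "e' = e / (h $ m + 1)"
        have e': "e' > 0" "h $ m * e' < e" using e hm by (auto simp: e'_def field_simps)
        obtain M1 \<delta>1 where \<delta>1: "\<delta>1 > 0" "\<And>z. z \<in> A \<Longrightarrow> \<bar>fst (z - (0, x0))\<bar> + q M1 (snd (z - (0, x0))) < \<delta>1 \<Longrightarrow>
           q N (X m (Fl z) - X m (Fl (0, x0))) < e'"
          by (rule PE.smooth_map_continuous[OF XFl_smooth 0 e'(1) b(1) star]) (assumption, assumption, assumption, assumption, rule that)
        have c1: "\<forall>\<^sub>F s in at_right 0. q M1 (x0 + s *\<^sub>R w - x0) < \<delta>1 / 2"
          using E.limitin_small[OF xlim, of "\<delta>1 / 2" M1] \<delta>1(1) by simp
        have c2: "\<forall>\<^sub>F s in at_right 0. s * h $ m < \<delta>1 / 2" using order_tendstoD(2)[OF slim, of "\<delta>1 / 2"] \<delta>1(1) by simp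
        from c1 c2 xV s\<epsilon> ne
        show "\<forall>\<^sub>F s in at_right 0. dist (q N ((\<Phi> (s *\<^sub>R h, x0 + s *\<^sub>R w) - x0) /\<^sub>R s - ((\<Sum>k\<in>{m}. h $ k *\<^sub>R X k x0) + w))) 0 < e"
        proof eventually_elim
          case (elim s)
          define r where "r = s * h $ m"
          have r: "0 \<le> r" "r < \<epsilon>" "r < \<delta>1 / 2" using elim hm by (auto simp: r_def)
          define y where "y = x0 + s *\<^sub>R w"
          \<comment> \<open>The slope \<open>Y\<close> is compared with the field along the short
            orbit, which is close to it by continuity of the field along the semiflow at the corner
            (0, x0).\<close>
          have "q N (Fl (r, y) - Fl (0, y) - (r - 0) *\<^sub>R Y) \<le> \<bar>r - 0\<bar> * e'"
          proof (rule E.mean_value_bound[of "{0..r}"])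
            fix \<tau> assume \<tau>: "\<tau> \<in> {0..r}"
            have sub: "{0..r} \<subseteq> {0..<\<epsilon>}" using r by auto
            show "E.has_vderiv (\<lambda>\<tau>. Fl (\<tau>, y)) (X m (Fl (\<tau>, y))) \<tau> {0..r}"
              using \<tau> sub elim by (intro E.has_vderiv_subset[OF Fl_deriv sub]) (auto simp: y_def)
            have "(\<tau>, y) \<in> A" using \<tau> sub elim by (auto simp: A_def y_def)
            moreover have "\<bar>fst ((\<tau>, y) - (0, x0))\<bar> + q M1 (snd ((\<tau>, y) - (0, x0))) < \<delta>1"
              using \<tau> r elim by (simp add: y_def)
            ultimately show "q N (X m (Fl (\<tau>, y)) - Y) \<le> e'"
              using \<delta>1(2)[of "(\<tau>, y)"] by (simp add: Fl_0 V Y_def)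
          qed (use r in \<open>auto simp: is_interval_cc\<close>)
          then have "q N (Fl (r, y) - y - r *\<^sub>R Y) \<le> r * e'" using r elim by (simp add: Fl_0 y_def)
          moreover have "(\<Phi> (s *\<^sub>R h, x0 + s *\<^sub>R w) - x0) /\<^sub>R s - ((\<Sum>k\<in>{m}. h $ k *\<^sub>R X k x0) + w)
             = inverse s *\<^sub>R (Fl (r, y) - y - r *\<^sub>R Y)"
            using elim by (simp add: \<Phi>_def p_def r_def y_def Y_def algebra_simps)
          ultimately have "q N ((\<Phi> (s *\<^sub>R h, x0 + s *\<^sub>R w) - x0) /\<^sub>R s - ((\<Sum>k\<in>{m}. h $ k *\<^sub>R X k x0) + w))
             \<le> inverse s * (r * e')"
            using elim by (simp only: E.q_scale) (simp add: mult_left_mono)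
          also have "\<dots> = h $ m * e'" using elim by (simp add: r_def)
          finally show ?case using e'(2) by simp
        qed
      qed
    qed
  qed
  then show ?thesis using \<delta> unfolding m_def by blast
qed

text \<open>By the chain rule the new partial derivatives are images of old ones under the
  differential of the flow, with a unit of time added for the index \<open>i\<close>, and
  \<open>flow_preserves_D\<close> keeps them in \<open>D\<close>. Since \<open>i\<close> is new, the
  old i-th derivative is 0 and the new one is the field \<open>X i\<close> at the end point.\<close>

lemma flow_chart_step:
  assumes ch: "is_chart J M \<delta> \<Phi> v" and \<delta>: "\<delta> > 0" and i: "i \<noteq> Max UNIV" "i \<notin> J"
  shows "\<exists>M \<delta> \<Phi> v. \<delta> > 0 \<and> is_chart (insert i J) M \<delta> \<Phi> v"
proof -
  obtain \<epsilon> V Fl where lf: "local_flow E q W (X i) \<epsilon> V Fl" and V: "x0 \<in> V" using flows[OF i(1)] by blast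
  interpret L: local_flow E q W "X i" \<epsilon> V Fl by (rule lf)
  obtain \<delta>1 Q where Q: "0 < \<delta>1" "\<delta>1 \<le> \<epsilon>" "openin E Q" "x0 \<in> Q" "Q \<subseteq> V"
    and pres: "\<And>t y a w. \<bar>t\<bar> < \<delta>1 \<Longrightarrow> y \<in> Q \<Longrightarrow> w \<in> D y \<Longrightarrow> L.FL.df (t, y) (a, w) \<in> D (Fl (t, y))"
    by (rule flow_preserves_D[OF x0 V lf]) (rule that)
  have \<Phi>_lim: "limitin E \<Phi> x0 near_filter" using ch by (simp add: is_chart_def)
  define p where "p = (\<lambda>z :: (real, 'n) vec \<times> 'a. (fst z $ i, \<Phi> z))"
  have c1: "\<forall>\<^sub>F z in near_filter. \<bar>fst z $ i\<bar> < \<delta>1"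
    using tendstoD[OF tendsto_near_coordinate Q(1)] by simp
  have c2: "\<forall>\<^sub>F z in near_filter. \<Phi> z \<in> Q" by (rule limitin_openinD[OF \<Phi>_lim Q(3,4)])
  from c1 c2 have "\<forall>\<^sub>F z in near_filter. \<bar>fst z $ i\<bar> < \<delta>1 \<and> \<Phi> z \<in> Q" by eventually_elim simp
  then obtain M' \<delta>' where \<delta>': "\<delta>' > 0" and ch': "is_chart J M' \<delta>' \<Phi> v"
    and nearQ: "\<And>z. z \<in> near M' \<delta>' \<Longrightarrow> \<bar>fst z $ i\<bar> < \<delta>1 \<and> \<Phi> z \<in> Q"
    by (rule is_chart_shrink[OF ch _ \<delta>]) (rule that)
  have \<Phi>_smooth: "smooth_map (prod_topology euclidean E) (near M' \<delta>') E \<Phi>"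
    and \<Phi>W: "\<And>z. z \<in> near M' \<delta>' \<Longrightarrow> \<Phi> z \<in> W"
    and vD: "\<And>u x k. (u, x) \<in> near M' \<delta>' \<Longrightarrow> v k (u, x) \<in> D (\<Phi> (u, x))"
    and v0: "\<And>u x k. (u, x) \<in> near M' \<delta>' \<Longrightarrow> k \<notin> J \<Longrightarrow> v k (u, x) = 0"
    and \<Phi>_deriv: "\<And>u x h. (u, x) \<in> near M' \<delta>' \<Longrightarrow> (\<forall>\<^sub>F s in at_right 0. u + s *\<^sub>R h \<in> half_space) \<Longrightarrow>
       limitin E (\<lambda>s. (\<Phi> (u + s *\<^sub>R h, x) - \<Phi> (u, x)) /\<^sub>R s) (\<Sum>k\<in>UNIV. h $ k *\<^sub>R v k (u, x)) (at_right 0)"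
    and \<Phi>0: "\<Phi> (0, x0) = x0"
    and v_lim: "\<And>k. k \<in> J \<Longrightarrow> limitin E (v k) (X k x0) near_filter"
    and \<Phi>_deriv0: "\<And>h w. w \<in> topspace E \<Longrightarrow> (\<forall>\<^sub>F s in at_right 0. s *\<^sub>R h \<in> half_space) \<Longrightarrow>
       limitin E (\<lambda>s. (\<Phi> (s *\<^sub>R h, x0 + s *\<^sub>R w) - x0) /\<^sub>R s) ((\<Sum>k\<in>J. h $ k *\<^sub>R X k x0) + w) (at_right 0)"
    using ch' unfolding is_chart_def by blast+
  define \<Psi> where "\<Psi> = (\<lambda>z. Fl (p z))"
  define v' where "v' = (\<lambda>k z. L.FL.df (p z) (if k = i then 1 else 0, v k z))"
  have p_in: "p z \<in> {-\<epsilon><..<\<epsilon>} \<times> V" if "z \<in> near M' \<delta>'" for z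
    using nearQ[OF that] Q(2,5) by (auto simp: p_def)
  have p0: "p (0, x0) = (0, x0)" by (simp add: p_def \<Phi>0)
  have 0: "(0, x0) \<in> {-\<epsilon><..<\<epsilon>} \<times> V" using V L.eps by simp
  have p_lim: "limitin L.P p (0, x0) near_filter"
    unfolding p_def limitin_pair using tendsto_near_coordinate \<Phi>_lim by simp
  have \<Psi>W: "\<Psi> z \<in> W" if "z \<in> near M' \<delta>'" for z
    using p_in[OF that] L.Fl_W unfolding \<Psi>_def by (cases "p z") auto
  have vS: "v k (u, x) \<in> topspace E" if "(u, x) \<in> near M' \<delta>'" for u x k
    using D_carrier[OF \<Phi>W vD] that by blast
  have ne: "\<forall>\<^sub>F s in at_right (0::real). s \<noteq> 0" by (simp add: eventually_at_filter)
  have id: "((\<lambda>s. s) \<longlongrightarrow> 0) (at_right (0::real))" by (rule tendsto_ident_at)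
  have df_0: "L.FL.df (0, x0) (a, w) = a *\<^sub>R X i x0 + w" if "w \<in> topspace E" for a w
    using L.df_split[OF L.zero_in_I V that, of a] L.push_0[OF V that] L.Fl_0[OF V] by simp
  have "is_chart (insert i J) M' \<delta>' \<Psi> v'"
    unfolding is_chart_def
  proof (intro conjI allI impI ballI)
    show "smooth_map (prod_topology euclidean E) (near M' \<delta>') E \<Psi>"
      unfolding smooth_map_def
    proof (intro conjI allI impI)
      show "near M' \<delta>' \<subseteq> topspace (prod_topology euclidean E)" by (auto simp: near_def)
      show "\<Psi> ` near M' \<delta>' \<subseteq> topspace E" using \<Psi>W W_open openin_subset by blast
      fix c assume c: "smooth_curve (prod_topology euclidean E) c \<and> range c \<subseteq> near M' \<delta>'"
      then have "smooth_curve E (\<Phi> \<circ> c)" using \<Phi>_smooth by (auto simp: smooth_map_def)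
      then have "smooth_curve L.P (p \<circ> c)"
        unfolding smooth_curve_prod_iff using c smooth_coordinate_curve[of c i] by (simp add: p_def o_def)
      moreover have "range (p \<circ> c) \<subseteq> {-\<epsilon><..<\<epsilon>} \<times> V"
        using c p_in by (simp add: image_subset_iff del: split_paired_All)
      ultimately have "smooth_curve E (Fl \<circ> (p \<circ> c))" using L.Fl_smooth by (auto simp: smooth_map_def)
      then show "smooth_curve E (\<Psi> \<circ> c)" by (simp add: \<Psi>_def o_def)
    qed
    show "\<Psi> ` near M' \<delta>' \<subseteq> W" using \<Psi>W by blast
    show "limitin E \<Psi> x0 near_filter"
      using L.FL.continuous[OF 0 p_lim] L.Fl_0[OF V] by (simp add: \<Psi>_def)
    show "\<Psi> (0, x0) = x0" using L.Fl_0[OF V] by (simp add: \<Psi>_def p0)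
  next
    fix u x k assume z: "(u, x) \<in> near M' \<delta>'"
    show "v' k (u, x) \<in> D (\<Psi> (u, x))"
      unfolding v'_def \<Psi>_def p_def using nearQ[OF z] vD[OF z] by (intro pres) auto
    show "v' k (u, x) = 0" if k: "k \<notin> insert i J"
      using k v0[OF z, of k] L.FL.df_scale[OF p_in[OF z] L.P.carrier_0, of 0]
      by (simp add: v'_def zero_prod_def)
  next
    fix u x h assume z: "(u, x) \<in> near M' \<delta>'" and h: "\<forall>\<^sub>F s in at_right 0. u + s *\<^sub>R h \<in> half_space"
    let ?g = "\<lambda>s. (\<Phi> (u + s *\<^sub>R h, x) - \<Phi> (u, x)) /\<^sub>R s"
    have pz: "p (u, x) \<in> {-\<epsilon><..<\<epsilon>} \<times> V" by (rule p_in[OF z])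
    have "limitin L.P (\<lambda>s. (h $ i, ?g s)) (h $ i, \<Sum>k\<in>UNIV. h $ k *\<^sub>R v k (u, x)) (at_right 0)"
      unfolding limitin_pair using \<Phi>_deriv[OF z h] by simp
    then have L: "limitin E (\<lambda>s. (Fl (p (u, x) + s *\<^sub>R (h $ i, ?g s)) - Fl (p (u, x))) /\<^sub>R s)
      (L.FL.df (p (u, x)) (h $ i, \<Sum>k\<in>UNIV. h $ k *\<^sub>R v k (u, x))) (at_right 0)"
      using pz L.FL.A_carrier[OF pz] ne by (intro L.FL.chain_rule[where r="\<lambda>s. s"] L.P.limitin_konst id) auto
    \<comment> \<open>Distributing the time component over the index set, all of it at k = i, lets
      linearity of the differential produce all the \<open>v' k\<close> at once.\<close>
    have "(h $ i, \<Sum>k\<in>UNIV. h $ k *\<^sub>R v k (u, x)) = (\<Sum>k\<in>UNIV. h $ k *\<^sub>R (if k = i then 1 else 0, v k (u, x)))"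
      by (simp add: prod_eq_iff fst_sum snd_sum if_distrib[of "(*) _"] cong: if_cong)
    also have "L.FL.df (p (u, x)) \<dots> = (\<Sum>k\<in>UNIV. h $ k *\<^sub>R v' k (u, x))"
    proof -
      have mem: "(if k = i then 1 else 0, v k (u, x)) \<in> topspace L.P" for k using vS[OF z] by auto
      have "L.FL.df (p (u, x)) (\<Sum>k\<in>UNIV. h $ k *\<^sub>R (if k = i then 1 else 0, v k (u, x))) =
        (\<Sum>k\<in>UNIV. L.FL.df (p (u, x)) (h $ k *\<^sub>R (if k = i then 1 else 0, v k (u, x))))"
        by (rule L.FL.df_sum[OF pz]) (rule L.P.carrier_scale[OF mem])
      also have "\<dots> = (\<Sum>k\<in>UNIV. h $ k *\<^sub>R v' k (u, x))"
        unfolding v'_def by (intro sum.cong refl L.FL.df_scale[OF pz mem])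
      finally show ?thesis .
    qed
    finally have eq: "L.FL.df (p (u, x)) (h $ i, \<Sum>k\<in>UNIV. h $ k *\<^sub>R v k (u, x)) = (\<Sum>k\<in>UNIV. h $ k *\<^sub>R v' k (u, x))" .
    have "\<forall>\<^sub>F s in at_right 0. (Fl (p (u, x) + s *\<^sub>R (h $ i, ?g s)) - Fl (p (u, x))) /\<^sub>R s =
       (\<Psi> (u + s *\<^sub>R h, x) - \<Psi> (u, x)) /\<^sub>R s"
      using ne by eventually_elim (simp add: \<Psi>_def p_def)
    from E.limitin_cong_ev[OF L this]
    show "limitin E (\<lambda>s. (\<Psi> (u + s *\<^sub>R h, x) - \<Psi> (u, x)) /\<^sub>R s) (\<Sum>k\<in>UNIV. h $ k *\<^sub>R v' k (u, x)) (at_right 0)"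
      unfolding eq .
  next
    fix k assume k: "k \<in> insert i J"
    \<comment> \<open>\<open>v_lim\<close> covers the old indices; at the new index
      \<open>v i\<close> is identically 0 near the base point.\<close>
    have "limitin E (v k) (if k = i then 0 else X k x0) near_filter"
    proof (cases "k = i")
      case True
      have "\<forall>\<^sub>F z in near_filter. 0 = v k z"
        unfolding eventually_near using \<delta>' v0 i(2) True by (intro exI[of _ M'] exI[of _ \<delta>']) auto
      then show ?thesis using True by (auto intro: E.limitin_cong_ev[OF E.limitin_konst])
    next
      case False
      then show ?thesis using v_lim k by simp
    qed
    then have "limitin L.P (\<lambda>z. (if k = i then 1 else 0, v k z)) (if k = i then 1 else 0, if k = i then 0 else X k x0) near_filter"
      unfolding limitin_pair by simp
    from L.FL.df_continuous[OF 0 p_lim this]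
    show "limitin E (v' k) (X k x0) near_filter"
      unfolding v'_def using df_0 X_carrier[OF x0] by (auto split: if_splits)
  next
    fix h :: "(real, 'n) vec" and w assume w: "w \<in> topspace E" and h: "\<forall>\<^sub>F s in at_right 0. s *\<^sub>R h \<in> half_space"
    let ?g = "\<lambda>s. (\<Phi> (s *\<^sub>R h, x0 + s *\<^sub>R w) - x0) /\<^sub>R s"
    have "limitin L.P (\<lambda>s. (h $ i, ?g s)) (h $ i, (\<Sum>k\<in>J. h $ k *\<^sub>R X k x0) + w) (at_right 0)"
      unfolding limitin_pair using \<Phi>_deriv0[OF w h] by simp
    then have L: "limitin E (\<lambda>s. (Fl ((0, x0) + s *\<^sub>R (h $ i, ?g s)) - Fl (0, x0)) /\<^sub>R s)
      (L.FL.df (0, x0) (h $ i, (\<Sum>k\<in>J. h $ k *\<^sub>R X k x0) + w)) (at_right 0)"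
      using 0 L.FL.A_carrier[OF 0] ne by (intro L.FL.chain_rule[where r="\<lambda>s. s"] L.P.limitin_konst id) auto
    have "(\<Sum>k\<in>J. h $ k *\<^sub>R X k x0) + w \<in> topspace E"
      using X_carrier[OF x0] w by (intro E.carrier_add E.carrier_sum E.carrier_scale)
    from df_0[OF this, of "h $ i"]
    have eq: "L.FL.df (0, x0) (h $ i, (\<Sum>k\<in>J. h $ k *\<^sub>R X k x0) + w) = (\<Sum>k\<in>insert i J. h $ k *\<^sub>R X k x0) + w"
      using i(2) by (simp add: add.assoc)
    have "\<forall>\<^sub>F s in at_right 0. (Fl ((0, x0) + s *\<^sub>R (h $ i, ?g s)) - Fl (0, x0)) /\<^sub>R s =
       (\<Psi> (s *\<^sub>R h, x0 + s *\<^sub>R w) - x0) /\<^sub>R s"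
      using ne by eventually_elim (simp add: \<Psi>_def p_def L.Fl_0[OF V])
    from E.limitin_cong_ev[OF L this]
    show "limitin E (\<lambda>s. (\<Psi> (s *\<^sub>R h, x0 + s *\<^sub>R w) - x0) /\<^sub>R s) ((\<Sum>k\<in>insert i J. h $ k *\<^sub>R X k x0) + w) (at_right 0)"
      unfolding eq .
  qed
  then show ?thesis using \<delta>' by blast
qed

text \<open>The index set grows from the singleton of the semiflow, which is therefore innermost;
  the order of the genuine flows around it is left to the induction.\<close>

lemma full_chart: "\<exists>M \<delta> \<Phi> v. \<delta> > 0 \<and> is_chart UNIV M \<delta> \<Phi> v"
proof -
  have "\<exists>M \<delta> \<Phi> v. \<delta> > 0 \<and> is_chart (insert (Max UNIV) A) M \<delta> \<Phi> v" if "A \<subseteq> UNIV - {Max UNIV}" for A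
    using finite[of A] that
  proof (induction A rule: finite_induct)
    case empty
    then show ?case using semiflow_chart by simp
  next
    case (insert i A)
    then obtain M \<delta> \<Phi> v where "\<delta> > 0" "is_chart (insert (Max UNIV) A) M \<delta> \<Phi> v" by auto
    moreover have "i \<noteq> Max UNIV" "i \<notin> insert (Max UNIV) A" using insert by auto
    ultimately show ?case using flow_chart_step by (simp add: insert_commute)
  qed
  from this[of "UNIV - {Max UNIV}"] show ?thesis by (simp add: insert_absorb)
qed

end

section \<open>The weak foliation\<close>

lemma limitin_atin_self: "x \<in> topspace X \<Longrightarrow> limitin X (\<lambda>y. y) x (atin X x)"
  by (auto simp: limitin_def eventually_atin)

text \<open>A further vector of the span outside the span of \<open>B\<close> would give an
  independent set with more elements than \<open>C\<close>.\<close>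

lemma span_eq_of_card_eq:
  fixes B C :: "'a::real_vector set"
  assumes "finite C" "independent B" "B \<subseteq> span C" "card B = card C"
  shows "span C \<subseteq> span B"
proof
  fix x assume x: "x \<in> span C"
  show "x \<in> span B"
  proof (rule ccontr)
    assume "x \<notin> span B"
    then have "independent (insert x B)" "x \<notin> B" using assms(2) span_base by (auto simp: independent_insert)
    moreover have "insert x B \<subseteq> span C" using x assms(3) by simp
    ultimately have "finite B" "card (insert x B) \<le> card C"
      using independent_span_bound[OF assms(1)] assms(2,3) by (blast, blast)
    then show False using assms(4) \<open>x \<notin> B\<close> by simp
  qed
qed

text \<open>The requirements at one point, with the final clause on tangent spaces in place of the
  rank condition: it involves no other chart, so charts can be constructed pointwise.\<close>

definition integral_chart ::
  "'a::real_vector topology \<Rightarrow> 'a set \<Rightarrow> ('a \<Rightarrow> 'a set) \<Rightarrow> 'a \<Rightarrow> (real ^ 'n::{finite,linorder}) set \<Rightarrow>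
   'a topology \<Rightarrow> 'a set \<Rightarrow> ((real ^ 'n::{finite,linorder}) \<times> 'a \<Rightarrow> 'a) \<Rightarrow> bool" where
  "integral_chart E U D x0 V F W \<psi> \<longleftrightarrow>
     openin (top_of_set half_space) V \<and> frechet_space F \<and> openin F W \<and>
     smooth_map (prod_topology euclidean F) (V \<times> W) E \<psi> \<and> \<psi> ` (V \<times> W) \<subseteq> U \<and>
     (\<exists>u0\<in>V. \<exists>x0''\<in>W. \<psi> (u0, x0'') = x0 \<and>
        (\<exists>L. has_tangent_map (prod_topology euclidean F) (V \<times> W) E \<psi> (u0, x0'') L \<and>
             homeomorphic_map (prod_topology euclidean F) E L)) \<and>
     (\<forall>x''\<in>W. tangential_manifold E U D V (\<lambda>u. \<psi> (u, x''))) \<and>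
     (\<forall>x''\<in>W. \<forall>u\<in>V. tangent_space E V (\<lambda>u. \<psi> (u, x'')) u = D (\<psi> (u, x'')))"

context seminormed_space
begin

lemma cont_functional_continuous_map:
  assumes "cont_functional l"
  shows "continuous_map T euclideanreal l"
  unfolding continuous_map_atin
  using cont_functional_tendsto[OF assms limitin_atin_self] by simp

text \<open>Every positive coordinate direction points into the half space, also at its boundary, so
  a tangent map is determined on the standard basis. This makes \<open>tangent_space\<close>, a
  union over all tangent maps, the range of a single one.\<close>

lemma tangent_map_unique:
  fixes V :: "(real ^ 'n::{finite,linorder}) set"
  assumes V: "openin (top_of_set half_space) V" and u: "u \<in> V"
    and L: "has_tangent_map euclidean V T f u L" and L': "has_tangent_map euclidean V T f u L'"
  shows "L' = L"
proof -
  have lin: "linear L" "linear L'" using L L' by (auto simp: has_tangent_map_def intro!: linearI)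
  obtain B where B: "open B" "V = half_space \<inter> B" using V by (auto simp: openin_open)
  have "L' b = L b" if b: "b \<in> Basis" for b
  proof -
    obtain k where k: "b = axis k 1" using b by (auto simp: Basis_vec_def)
    have "((\<lambda>s. u + s *\<^sub>R b) \<longlongrightarrow> u + 0 *\<^sub>R b) (at_right 0)" by (intro tendsto_intros)
    then have "\<forall>\<^sub>F s in at_right 0. u + s *\<^sub>R b \<in> B"
      using u B by (intro topological_tendstoD[of _ "u + 0 *\<^sub>R b"]) auto
    moreover have "\<forall>\<^sub>F s in at_right (0::real). s > 0" by (simp add: eventually_at_filter)
    ultimately have "\<forall>\<^sub>F s in at_right 0. u + s *\<^sub>R b \<in> V"
    proof eventually_elim
      case (elim s)
      then show ?case using u B(2) by (auto simp: k half_space_def axis_def)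
    qed
    then have "limitin T (\<lambda>s. (f (u + s *\<^sub>R b) - f u) /\<^sub>R s) (L b) (at_right 0)"
      "limitin T (\<lambda>s. (f (u + s *\<^sub>R b) - f u) /\<^sub>R s) (L' b) (at_right 0)"
      using L L' by (auto simp: has_tangent_map_def)
    then show ?thesis by (intro limitin_unique) auto
  qed
  then show ?thesis using linear_eq_stdbasis[OF lin(2,1)] by blast
qed

end

context frame_with_flows
begin

text \<open>The parameter space is the common kernel of functionals dual to the frame at
  \<open>x0\<close>. It is closed, and together with the frame it decomposes \<open>E\<close> by an
  explicit formula, so the tangent map at the base point has a continuous inverse.\<close>

lemma integral_chart_exists:
  assumes E: "frechet_space E" and WU: "W \<subseteq> U"
  shows "\<exists>(V :: ((real, 'n) vec) set) F W' \<psi>. integral_chart E U D x0 V F W' \<psi>"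
proof -
  obtain l where l: "\<And>k. E.cont_functional (l k)" "\<And>k j. l k (X j x0) = (if k = j then 1 else 0)"
    using dual_functionals[OF x0] by blast
  note lin = E.cont_functional_linear[OF l(1)]
  obtain M0 \<delta>0 \<Phi> v where \<delta>0: "\<delta>0 > 0" and ch0: "is_chart UNIV M0 \<delta>0 \<Phi> v" using full_chart by blast
  \<comment> \<open>Functionals dual to the frame at \<open>x0\<close> stay almost dual to the
    partial derivatives on a whole neighbourhood; this will give injectivity of all tangent maps
    there.\<close>
  have "((\<lambda>z. l k (v j z)) \<longlongrightarrow> (if k = j then 1 else 0)) near_filter" for k j
    using E.cont_functional_tendsto[OF l(1), of "v j" "X j x0" near_filter k] ch0 l(2)
    by (simp add: is_chart_def)
  then have "\<forall>\<^sub>F z in near_filter. dist (l k (v j z)) (if k = j then 1 else 0) < 1 / (2 * CARD('n))" for k j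
    by (rule tendstoD) simp
  then have "\<forall>\<^sub>F z in near_filter. \<forall>k\<in>UNIV. \<forall>j\<in>UNIV. dist (l k (v j z)) (if k = j then 1 else 0) < 1 / (2 * CARD('n))"
    by (intro eventually_ball_finite ballI finite)
  then obtain M \<delta> where \<delta>: "\<delta> > 0" and ch: "is_chart UNIV M \<delta> \<Phi> v"
    and near_id: "\<And>z. z \<in> near M \<delta> \<Longrightarrow> \<forall>k\<in>UNIV. \<forall>j\<in>UNIV. dist (l k (v j z)) (if k = j then 1 else 0) < 1 / (2 * CARD('n))"
    by (rule is_chart_shrink[OF ch0 _ \<delta>0]) (rule that)
  have \<Phi>_smooth: "smooth_map (prod_topology euclidean E) (near M \<delta>) E \<Phi>"
    and \<Phi>W: "\<And>z. z \<in> near M \<delta> \<Longrightarrow> \<Phi> z \<in> W"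
    and vD: "\<And>u x k. (u, x) \<in> near M \<delta> \<Longrightarrow> v k (u, x) \<in> D (\<Phi> (u, x))"
    and \<Phi>_deriv: "\<And>u x h. (u, x) \<in> near M \<delta> \<Longrightarrow> (\<forall>\<^sub>F s in at_right 0. u + s *\<^sub>R h \<in> half_space) \<Longrightarrow>
       limitin E (\<lambda>s. (\<Phi> (u + s *\<^sub>R h, x) - \<Phi> (u, x)) /\<^sub>R s) (\<Sum>k\<in>UNIV. h $ k *\<^sub>R v k (u, x)) (at_right 0)"
    and \<Phi>0: "\<Phi> (0, x0) = x0"
    and \<Phi>_deriv0: "\<And>h w. w \<in> topspace E \<Longrightarrow> (\<forall>\<^sub>F s in at_right 0. s *\<^sub>R h \<in> half_space) \<Longrightarrow>
       limitin E (\<lambda>s. (\<Phi> (s *\<^sub>R h, x0 + s *\<^sub>R w) - x0) /\<^sub>R s) ((\<Sum>k\<in>UNIV. h $ k *\<^sub>R X k x0) + w) (at_right 0)"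
    using ch unfolding is_chart_def by blast+
  define K where "K = {x \<in> topspace E. \<forall>k. l k x = 0}"
  define F where "F = subtopology E K"
  define V where "V = {u::(real, 'n) vec. u \<in> half_space \<and> norm u < \<delta>}"
  define W' where "W' = {x \<in> K. q M x < \<delta>}"
  \<comment> \<open>The shift by \<open>x0\<close> places the base point at the origin of the
    subspace \<open>K\<close>.\<close>
  define \<psi> where "\<psi> = (\<lambda>z :: (real, 'n) vec \<times> 'a. \<Phi> (fst z, x0 + snd z))"
  have KE: "K \<subseteq> topspace E" by (auto simp: K_def)
  have topF: "topspace F = K" using KE by (auto simp: F_def)
  have in_near: "(u, x0 + x) \<in> near M \<delta>" if "u \<in> V" "x \<in> W'" for u x
    using that x0_carrier by (auto simp: near_def V_def W'_def K_def)
  have V_open: "openin (top_of_set half_space) V"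
  proof -
    have "V = half_space \<inter> ball 0 \<delta>" by (auto simp: V_def)
    then show ?thesis by (simp add: openin_open_Int)
  qed
  have "closedin E {x \<in> topspace E. l k x \<in> {0}}" for k
    by (rule closedin_continuous_map_preimage[OF E.cont_functional_continuous_map[OF l(1)]]) simp
  then have "closedin E (\<Inter>k. {x \<in> topspace E. l k x \<in> {0}})" by (intro closedin_Inter) auto
  moreover have "(\<Inter>k. {x \<in> topspace E. l k x \<in> {0}}) = K" by (auto simp: K_def)
  ultimately have K_closed: "closedin E K" by simp
  have K_sub: "subspace K"
    unfolding K_def subspace_def by (auto simp: linear_add[OF lin] linear_scale[OF lin] linear_0[OF lin])
  have F_frechet: "frechet_space F"
    unfolding F_def by (rule frechet_space_closed_subspace[OF E K_sub K_closed])
  have W'_open: "openin F W'"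
  proof -
    have "W' = {y \<in> topspace E. q M (y - 0) < \<delta>} \<inter> K" using KE by (auto simp: W'_def)
    then show ?thesis unfolding F_def openin_subtopology using E.openin_ball[OF E.carrier_0] by blast
  qed
  have shift_curve: "smooth_curve (prod_topology euclidean E) (\<lambda>t. (fst (c t), x0 + snd (c t)))"
    if "smooth_curve (prod_topology euclidean E) c" for c :: "real \<Rightarrow> (real, 'n) vec \<times> 'a"
    using that E.smooth_curve_plus[OF E.smooth_curve_const[OF x0_carrier], of "snd \<circ> c"]
    by (simp add: smooth_curve_prod_iff o_def)
  have \<psi>_E: "\<psi> ` (V \<times> W') \<subseteq> topspace E"
    using in_near \<Phi>W W_open openin_subset by (fastforce simp: \<psi>_def)
  have \<psi>_curve: "smooth_curve E (\<psi> \<circ> c)"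
    if c: "smooth_curve (prod_topology euclidean E) c" "\<And>t. c t \<in> V \<times> W'" for c
  proof -
    have "(fst (c t), x0 + snd (c t)) \<in> near M \<delta>" for t
      using in_near[of "fst (c t)" "snd (c t)"] c(2)[of t] by (simp add: mem_Times_iff)
    then have "smooth_curve E (\<Phi> \<circ> (\<lambda>t. (fst (c t), x0 + snd (c t))))"
      using \<Phi>_smooth shift_curve[OF c(1)] unfolding smooth_map_def by blast
    then show ?thesis by (simp add: \<psi>_def o_def)
  qed
  have \<psi>_smooth: "smooth_map (prod_topology euclidean F) (V \<times> W') E \<psi>"
    unfolding smooth_map_def
  proof (intro conjI allI impI)
    show "V \<times> W' \<subseteq> topspace (prod_topology euclidean F)" by (auto simp: topF W'_def)
    fix c assume c: "smooth_curve (prod_topology euclidean F) c \<and> range c \<subseteq> V \<times> W'"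
    then have "smooth_curve (prod_topology euclidean E) c"
      using smooth_curve_subtopology[of E K "snd \<circ> c"] by (simp add: smooth_curve_prod_iff F_def)
    then show "smooth_curve E (\<psi> \<circ> c)" using c by (intro \<psi>_curve) auto
  qed (rule \<psi>_E)
  have \<psi>U: "\<psi> ` (V \<times> W') \<subseteq> U" using in_near \<Phi>W WU by (fastforce simp: \<psi>_def)
  have u0: "0 \<in> V" using \<delta> zero_in_half_space by (simp add: V_def)
  have x0'': "0 \<in> W'" using \<delta> K_sub by (simp add: W'_def subspace_0)
  define L where "L = (\<lambda>z :: (real, 'n) vec \<times> 'a. (\<Sum>k\<in>UNIV. fst z $ k *\<^sub>R X k x0) + snd z)"
  have L_tangent: "has_tangent_map (prod_topology euclidean F) (V \<times> W') E \<psi> (0, 0) L"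
    unfolding has_tangent_map_def
  proof (intro conjI ballI allI impI)
    show "L (z + w) = L z + L w" for z w
      by (simp add: L_def scaleR_left_distrib sum.distrib algebra_simps)
    show "L (a *\<^sub>R z) = a *\<^sub>R L z" for a z
      by (simp add: L_def scaleR_right_distrib scaleR_sum_right)
    fix z assume z: "z \<in> topspace (prod_topology euclidean F)"
      and h: "\<forall>\<^sub>F s in at_right 0. (0, 0) + s *\<^sub>R z \<in> V \<times> W'"
    have "snd z \<in> topspace E" using z topF KE by auto
    moreover from h have "\<forall>\<^sub>F s in at_right 0. s *\<^sub>R fst z \<in> half_space"
      by eventually_elim (auto simp: V_def mem_Times_iff)
    ultimately show "limitin E (\<lambda>s. (\<psi> ((0, 0) + s *\<^sub>R z) - \<psi> (0, 0)) /\<^sub>R s) (L z) (at_right 0)"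
      using \<Phi>_deriv0[of "snd z" "fst z"] by (simp add: \<psi>_def L_def \<Phi>0)
  qed
  \<comment> \<open>The functionals give the coordinates along the frame, and what remains lies in
    their kernel.\<close>
  define L' where "L' = (\<lambda>x. ((\<chi> k. l k x) :: (real, 'n) vec, x - (\<Sum>k\<in>UNIV. l k x *\<^sub>R X k x0)))"
  have XE: "X k x0 \<in> topspace E" for k by (rule X_carrier[OF x0])
  have l_sum: "l k (\<Sum>j\<in>UNIV. c j *\<^sub>R X j x0) = c k" for k c
  proof -
    have "l k (\<Sum>j\<in>UNIV. c j *\<^sub>R X j x0) = (\<Sum>j\<in>UNIV. if k = j then c k else 0)"
      unfolding linear_sum[OF lin] linear_scale[OF lin] by (intro sum.cong refl) (simp add: l(2))
    then show ?thesis by simp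
  qed
  have L'_K: "snd (L' x) \<in> K" if "x \<in> topspace E" for x
    using that XE unfolding K_def L'_def by (auto simp: linear_diff[OF lin] l_sum intro!: E.carrier_diff E.carrier_sum)
  have "homeomorphic_maps (prod_topology euclidean F) E L L'"
    unfolding homeomorphic_maps_def
  proof (intro conjI ballI)
    show "continuous_map (prod_topology euclidean F) E L"
      unfolding continuous_map_atin
    proof
      fix z :: "(real, 'n) vec \<times> 'a" assume z: "z \<in> topspace (prod_topology euclidean F)"
      define G where "G = atin (prod_topology euclidean F) z"
      have "limitin (prod_topology euclidean F) (\<lambda>y. y) z G" unfolding G_def by (rule limitin_atin_self[OF z])
      then have "(fst \<longlongrightarrow> fst z) G" "limitin E snd (snd z) G"
        by (simp_all add: limitin_pairwise F_def limitin_subtopology o_def)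
      then show "limitin E L (L z) G"
        unfolding L_def by (intro E.limitin_plus E.limitin_sums E.limitin_scale E.limitin_konst XE tendsto_vec_nth)
    qed
    show "continuous_map E (prod_topology euclidean F) L'"
      unfolding continuous_map_atin
    proof
      fix x assume x: "x \<in> topspace E"
      define G where "G = atin E x"
      have id: "limitin E (\<lambda>y. y) x G" unfolding G_def by (rule limitin_atin_self[OF x])
      have tl: "((\<lambda>y. l k y) \<longlongrightarrow> l k x) G" for k by (rule E.cont_functional_tendsto[OF l(1) id])
      have "limitin E (\<lambda>y. y - (\<Sum>k\<in>UNIV. l k y *\<^sub>R X k x0)) (x - (\<Sum>k\<in>UNIV. l k x *\<^sub>R X k x0)) G"
        by (intro E.limitin_minus E.limitin_sums E.limitin_scale E.limitin_konst XE tl id)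
      moreover have "\<forall>\<^sub>F y in G. y - (\<Sum>k\<in>UNIV. l k y *\<^sub>R X k x0) \<in> K"
        using E.limitin_carrier_ev[OF id] by eventually_elim (use L'_K in \<open>simp add: L'_def\<close>)
      moreover have "((\<lambda>y. (\<chi> k. l k y) :: (real, 'n) vec) \<longlongrightarrow> (\<chi> k. l k x)) G"
        by (intro tendsto_vec_lambda tl)
      ultimately show "limitin (prod_topology euclidean F) L' (L' x) G"
        using L'_K[OF x] unfolding L'_def limitin_pair by (simp add: F_def limitin_subtopology)
    qed
    show "L' (L z) = z" if "z \<in> topspace (prod_topology euclidean F)" for z :: "(real, 'n) vec \<times> 'a"
    proof -
      have "l k (snd z) = 0" for k using that topF by (auto simp: K_def)
      then have "l k (L z) = fst z $ k" for k by (simp add: L_def linear_add[OF lin] l_sum)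
      then show ?thesis by (simp add: L'_def prod_eq_iff vec_eq_iff) (simp add: L_def)
    qed
    show "L (L' x) = x" if "x \<in> topspace E" for x
      by (simp add: L_def L'_def)
  qed
  then have L_homeo: "homeomorphic_map (prod_topology euclidean F) E L"
    by (rule homeomorphic_maps_imp_map)
  have leaf: "smooth_map euclidean V E (\<lambda>u. \<psi> (u, x))" if x: "x \<in> W'" for x
    unfolding smooth_map_def
  proof (intro conjI allI impI)
    show "(\<lambda>u. \<psi> (u, x)) ` V \<subseteq> topspace E" using \<psi>_E x by auto
    fix c :: "real \<Rightarrow> (real, 'n) vec" assume c: "smooth_curve euclidean c \<and> range c \<subseteq> V"
    have "x \<in> topspace E" using x KE by (auto simp: W'_def)
    then have "smooth_curve E (\<psi> \<circ> (\<lambda>t. (c t, x)))"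
      using c x by (intro \<psi>_curve) (auto simp: smooth_curve_prod_iff o_def E.smooth_curve_const)
    then show "smooth_curve E ((\<lambda>u. \<psi> (u, x)) \<circ> c)" by (simp add: o_def)
  qed auto
  have leaf_tangent: "\<exists>T. has_tangent_map euclidean V E (\<lambda>u. \<psi> (u, x)) u T \<and> inj T \<and> range T = D (\<psi> (u, x))"
    if u: "u \<in> V" and x: "x \<in> W'" for u x
  proof -
    define z where "z = (u, x0 + x)"
    have z: "z \<in> near M \<delta>" unfolding z_def by (rule in_near[OF u x])
    have zW: "\<psi> (u, x) \<in> W" using \<Phi>W[OF z] by (simp add: \<psi>_def z_def)
    have vz: "v k z \<in> D (\<psi> (u, x))" for k using vD[OF z[unfolded z_def]] by (simp add: \<psi>_def z_def)
    define T where "T = (\<lambda>h :: (real, 'n) vec. \<Sum>k\<in>UNIV. h $ k *\<^sub>R v k z)"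
    have T_lin: "linear T"
      by (rule linearI) (simp_all add: T_def scaleR_left_distrib sum.distrib scaleR_sum_right)
    have T_tangent: "has_tangent_map euclidean V E (\<lambda>u. \<psi> (u, x)) u T"
      unfolding has_tangent_map_def
    proof (intro conjI ballI allI impI)
      fix h :: "(real, 'n) vec" assume "\<forall>\<^sub>F s in at_right 0. u + s *\<^sub>R h \<in> V"
      then have "\<forall>\<^sub>F s in at_right 0. u + s *\<^sub>R h \<in> half_space" by eventually_elim (simp add: V_def)
      from \<Phi>_deriv[OF z[unfolded z_def] this]
      show "limitin E (\<lambda>s. (\<psi> (u + s *\<^sub>R h, x) - \<psi> (u, x)) /\<^sub>R s) (T h) (at_right 0)"
        by (simp add: \<psi>_def T_def z_def)
    qed (simp_all add: linear_add[OF T_lin] linear_scale[OF T_lin])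
    \<comment> \<open>A vector in the kernel of \<open>T\<close> solves a system with matrix close
      to the identity and right-hand side 0.\<close>
    have "h = 0" if Th: "T h = 0" for h
    proof -
      have "\<bar>h $ k\<bar> \<le> 2 * 0" for k
      proof (rule near_identity_bound[of "\<lambda>k j. l k (v j z)"])
        show "\<bar>l k (v j z) - (if k = j then 1 else 0)\<bar> \<le> 1 / (2 * CARD('n))" for k j
          using near_id[OF z] by (auto simp only: dist_real_def intro: less_imp_le)
        fix k
        have "l k (T h) = (\<Sum>j\<in>UNIV. h $ j * l k (v j z))"
          unfolding T_def linear_sum[OF lin] linear_scale[OF lin] by simp
        then show "\<bar>\<Sum>j\<in>UNIV. h $ j * l k (v j z)\<bar> \<le> 0" using Th linear_0[OF lin] by simp
      qed
      then show ?thesis by (simp add: vec_eq_iff)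
    qed
    then have T_inj: "inj T" using linear_injective_0[OF T_lin] by blast
    have range_sub: "range T \<subseteq> D (\<psi> (u, x))"
      unfolding T_def using vz D_subspace[OF zW] by (auto intro!: subspace_sum subspace_scale)
    \<comment> \<open>The range of \<open>T\<close> and the fibre of \<open>D\<close> both have
      dimension n, so the inclusion is an equality.\<close>
    define C where "C = range (\<lambda>i. X i (\<psi> (u, x)))"
    have C: "finite C" "span C = D (\<psi> (u, x))" "card C = CARD('n)"
      using span_X[OF zW] inj_X[OF zW] by (auto simp: C_def card_image)
    have B: "independent (T ` Basis)" "card (T ` Basis) = CARD('n)"
      using T_inj linear_independent_injective_image[OF T_lin independent_Basis]
      by (auto simp: card_image inj_on_subset)
    have "span C \<subseteq> span (T ` Basis)"
      using C B range_sub by (intro span_eq_of_card_eq) auto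
    also have "span (T ` Basis) = range T" using linear_span_image[OF T_lin, of Basis] by simp
    finally have "range T = D (\<psi> (u, x))" using range_sub C(2) by auto
    then show ?thesis using T_tangent T_inj by blast
  qed
  have "tangential_manifold E U D V (\<lambda>u. \<psi> (u, x))" if x: "x \<in> W'" for x
    unfolding tangential_manifold_def
  proof (intro conjI ballI)
    show "(\<lambda>u. \<psi> (u, x)) ` V \<subseteq> U" using \<psi>U x by auto
    show "\<exists>T. has_tangent_map euclidean V E (\<lambda>u. \<psi> (u, x)) u T \<and> inj T \<and> D (\<psi> (u, x)) \<subseteq> range T"
      if "u \<in> V" for u using leaf_tangent[OF that x] by blast
  qed (use V_open leaf[OF x] in auto)
  moreover have "tangent_space E V (\<lambda>u. \<psi> (u, x)) u = D (\<psi> (u, x))" if u: "u \<in> V" and x: "x \<in> W'" for u x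
  proof -
    obtain T where T: "has_tangent_map euclidean V E (\<lambda>u. \<psi> (u, x)) u T" "range T = D (\<psi> (u, x))"
      using leaf_tangent[OF u x] by blast
    show ?thesis
      unfolding tangent_space_def T(2)[symmetric]
      using E.tangent_map_unique[OF V_open u T(1)] T(1) by blast
  qed
  moreover have "\<psi> (0, 0) = x0" by (simp add: \<psi>_def \<Phi>0)
  ultimately have "integral_chart E U D x0 V F W' \<psi>"
    unfolding integral_chart_def
    using V_open F_frechet W'_open \<psi>_smooth \<psi>U u0 x0'' L_tangent L_homeo by blast
  then show ?thesis by blast
qed

end

theorem theorem8:
  fixes E :: "'e::real_vector topology" and U :: "'e set" and D :: "'e \<Rightarrow> 'e set"
  assumes "frechet_space E" and "openin E U"
    and "distribution_on E U D" and "involutive E U D" and "smooth_distribution E U D"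
    and "constant_rank U D CARD('n::{finite,linorder})"
    and "\<forall>x0\<in>U. \<exists>W. \<exists>X :: 'n \<Rightarrow> 'e \<Rightarrow> 'e.
           x0 \<in> W \<and> W \<subseteq> U \<and>
           (\<forall>i. vector_field E W (X i)) \<and>
           (\<forall>y\<in>W. inj (\<lambda>i. X i y) \<and> independent (range (\<lambda>i. X i y)) \<and>
                   span (range (\<lambda>i. X i y)) = D y) \<and>
           (\<forall>i. i \<noteq> Max UNIV \<longrightarrow> admits_local_flow E W (X i)) \<and>
           admits_local_semiflow E W (X (Max UNIV))"
  shows "admits_weak_foliation TYPE('n) E U D"
proof -
  obtain q where q: "seminormed_space E q" using frechet_space_seminormed[OF assms(1)] by blast
  have "\<exists>(V :: (real ^ 'n::{finite,linorder}) set) F W \<psi>. integral_chart E U D x0 V F W \<psi>" if x0U: "x0 \<in> U" for x0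
  proof -
    obtain W and X :: "'n \<Rightarrow> 'e \<Rightarrow> 'e" where W: "x0 \<in> W" "W \<subseteq> U" and vf: "\<And>i. vector_field E W (X i)"
      and basis: "\<And>y. y \<in> W \<Longrightarrow> inj (\<lambda>i. X i y) \<and> independent (range (\<lambda>i. X i y)) \<and> span (range (\<lambda>i. X i y)) = D y"
      and flows: "\<And>i. i \<noteq> Max UNIV \<Longrightarrow> admits_local_flow E W (X i)"
      and semiflow: "admits_local_semiflow E W (X (Max UNIV))"
      using bspec[OF assms(7) x0U] by (elim exE conjE) blast
    have XD: "X i y \<in> D y" if "y \<in> W" for i y
      using basis[OF that] span_base[of "X i y" "range (\<lambda>i. X i y)"] by auto
    interpret seminormed_space E q by (rule q)
    interpret frame_with_flows E q W X D x0
    proof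
      show "lie_bracket E (X i) (X j) y \<in> D y" if "y \<in> W" for i j y
        using assms(4) W(2) vf XD that unfolding involutive_def by blast
      show "\<exists>\<epsilon> V Fl. local_flow E q W (X i) \<epsilon> V Fl \<and> x0 \<in> V" if i: "i \<noteq> Max UNIV" for i
      proof -
        obtain \<epsilon> V Fl where "\<epsilon> > 0" "openin E V" "x0 \<in> V" "flow_on E W (X i) {-\<epsilon><..<\<epsilon>} V Fl"
          using flows[OF i] W(1) unfolding admits_local_flow_def by blast
        then have "local_flow E q W (X i) \<epsilon> V Fl" using vf by unfold_locales
        then show ?thesis using \<open>x0 \<in> V\<close> by blast
      qed
      show "\<exists>\<epsilon>>0. \<exists>V Fl. openin E V \<and> x0 \<in> V \<and> flow_on E W (X (Max UNIV)) {0..<\<epsilon>} V Fl"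
        using semiflow W(1) unfolding admits_local_semiflow_def by blast
    qed (use vf basis W in auto)
    show ?thesis by (rule integral_chart_exists[OF assms(1) W(2)])
  qed
  then obtain V :: "'e \<Rightarrow> (real ^ 'n::{finite,linorder}) set" and F W \<psi>
    where ch: "\<And>x0. x0 \<in> U \<Longrightarrow> integral_chart E U D x0 (V x0) (F x0) (W x0) (\<psi> x0)"
    by metis
  \<comment> \<open>All members of the family through \<open>y\<close>, from whichever chart, have
    the tangent space \<open>D y\<close>, and the chart at \<open>y\<close> provides one; so the
    family to be spanned is a singleton.\<close>
  have "tangent_distribution E U V W \<psi> y = D y" if y: "y \<in> U" for y
  proof -
    have ts: "tangent_space E (V x0) (\<lambda>u'. \<psi> x0 (u', x'')) u = D (\<psi> x0 (u, x''))"
      if "x0 \<in> U" "u \<in> V x0" "x'' \<in> W x0" for x0 u x''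
      using ch[OF that(1)] that unfolding integral_chart_def by blast
    obtain u x'' where "u \<in> V y" "x'' \<in> W y" "\<psi> y (u, x'') = y"
      using ch[OF y] unfolding integral_chart_def by blast
    then have "{tangent_space E (V x0) (\<lambda>u'. \<psi> x0 (u', x'')) u | x0 u x''.
       x0 \<in> U \<and> u \<in> V x0 \<and> x'' \<in> W x0 \<and> \<psi> x0 (u, x'') = y} = {D y}"
      using ts y by (auto intro!: exI[of _ y]) metis
    then have "tangent_distribution E U V W \<psi> y = span (D y)"
      unfolding tangent_distribution_def by simp
    moreover have "subspace (D y)" using assms(3) y unfolding distribution_on_def by blast
    ultimately show ?thesis by (simp add: span_eq_iff)
  qed
  then have rank: "constant_rank U (tangent_distribution E U V W \<psi>) CARD('n)"
    using assms(6) by (simp add: constant_rank_def)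
  show ?thesis
    unfolding admits_weak_foliation_def
    by (rule exI[of _ V], rule exI[of _ F], rule exI[of _ W], rule exI[of _ \<psi>])
      (use ch rank in \<open>simp add: integral_chart_def\<close>)
qed

end
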